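(* Let $EP \in e\mathcal{MPGN}4$. Suppose $EP$ contains distinct vertices $a,b,v_1,v_2,v_4,v_5,c,d,u_1,u_2,u_3,u_4,u_5,u_6$ such that each of $a,b,v_1,v_2,v_4,v_5$ has degree $5$ with neighbourhoods $N(a)=\{b,c,d,v_1,v_2\}$, $N(b)=\{a,c,d,v_4,v_5\}$, $N(v_1)=\{a,v_2,d,u_1,u_2\}$, $N(v_2)=\{a,v_1,c,u_2,u_3\}$, $N(v_4)=\{b,v_5,c,u_4,u_5\}$, $N(v_5)=\{b,v_4,d,u_5,u_6\}$, so that these six degree-5 vertices form a "dumbbell" (the adjacent pair $a,b$ together with the triangles $av_1v_2$ and $bv_4v_5$) whose surrounding cycle of neighbours is $d$-$u_1$-$u_2$-$u_3$-$c$-$u_4$-$u_5$-$u_6$-$d$. Then $\deg(c)\ge 8$ and $\deg(d)\ge 8$.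
   Context: All graphs are simple and connected. A maximal planar graph (MPG) is a planar graph to which no edge joining two nonadjacent vertices can be added while keeping it planar (equivalently, for at least 3 vertices, a plane graph all of whose faces are triangles). Let $\mathcal{N}4$ be the set of all simple connected planar graphs that are not 4-colorable (in the usual proper vertex-coloring sense). Then $e\mathcal{MPGN}4$ denotes the set of graphs $EP\in\mathcal{N}4$ that are maximal planar graphs and have the minimum possible number of vertices among graphs in $\mathcal{N}4$ (i.e., minimal counterexamples to the Four Color Theorem that are MPGs). $\deg(x)$ denotes the degree of vertex $x$ and $N(x)$ its set of neighbours. *)

theory Defs
  imports "HOL-Analysis.Analysis"
begin

definition simple_graph :: "'a set \<Rightarrow> ('a \<Rightarrow> 'a \<Rightarrow> bool) \<Rightarrow> bool" where
  "simple_graph V E \<longleftrightarrow> finite V \<and>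
     (\<forall>u v. E u v \<longrightarrow> u \<in> V \<and> v \<in> V \<and> u \<noteq> v) \<and>
     (\<forall>u v. E u v \<longrightarrow> E v u)"

definition connected_graph :: "'a set \<Rightarrow> ('a \<Rightarrow> 'a \<Rightarrow> bool) \<Rightarrow> bool" where
  "connected_graph V E \<longleftrightarrow> V \<noteq> {} \<and> (\<forall>u\<in>V. \<forall>v\<in>V. E\<^sup>*\<^sup>* u v)"

definition planar :: "'a set \<Rightarrow> ('a \<Rightarrow> 'a \<Rightarrow> bool) \<Rightarrow> bool" where
  "planar V E \<longleftrightarrow> (\<exists>(p :: 'a \<Rightarrow> complex) (\<gamma> :: 'a \<Rightarrow> 'a \<Rightarrow> real \<Rightarrow> complex).
     inj_on p V \<and>
     (\<forall>u v. E u v \<longrightarrow> arc (\<gamma> u v) \<and> pathstart (\<gamma> u v) = p u \<and> pathfinish (\<gamma> u v) = p v) \<and>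
     (\<forall>u v w. E u v \<and> w \<in> V \<and> p w \<in> path_image (\<gamma> u v) \<longrightarrow> w = u \<or> w = v) \<and>
     (\<forall>u v x y. E u v \<and> E x y \<and> {u, v} \<noteq> {x, y} \<longrightarrow>
        path_image (\<gamma> u v) \<inter> path_image (\<gamma> x y) \<subseteq> p ` ({u, v} \<inter> {x, y})))"

definition colorable :: "nat \<Rightarrow> 'a set \<Rightarrow> ('a \<Rightarrow> 'a \<Rightarrow> bool) \<Rightarrow> bool" where
  "colorable k V E \<longleftrightarrow> (\<exists>c :: 'a \<Rightarrow> nat. (\<forall>v\<in>V. c v < k) \<and> (\<forall>u v. E u v \<longrightarrow> c u \<noteq> c v))"

definition add_edge :: "('a \<Rightarrow> 'a \<Rightarrow> bool) \<Rightarrow> 'a \<Rightarrow> 'a \<Rightarrow> ('a \<Rightarrow> 'a \<Rightarrow> bool)" where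
  "add_edge E a b = (\<lambda>x y. E x y \<or> (x = a \<and> y = b) \<or> (x = b \<and> y = a))"

definition N4 :: "'a set \<Rightarrow> ('a \<Rightarrow> 'a \<Rightarrow> bool) \<Rightarrow> bool" where
  "N4 V E \<longleftrightarrow> simple_graph V E \<and> connected_graph V E \<and> planar V E \<and> \<not> colorable 4 V E"

definition maximal_planar :: "'a set \<Rightarrow> ('a \<Rightarrow> 'a \<Rightarrow> bool) \<Rightarrow> bool" where
  "maximal_planar V E \<longleftrightarrow> planar V E \<and>
     (\<forall>u\<in>V. \<forall>v\<in>V. u \<noteq> v \<and> \<not> E u v \<longrightarrow> \<not> planar V (add_edge E u v))"

text \<open>eMPGN4: maximal planar members of N4 with the minimum number of vertices among
  all members of N4 (every finite graph is isomorphic to one on natural numbers,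
  so comparing against graphs on nat covers all graphs).\<close>
definition eMPGN4 :: "'a set \<Rightarrow> ('a \<Rightarrow> 'a \<Rightarrow> bool) \<Rightarrow> bool" where
  "eMPGN4 V E \<longleftrightarrow> N4 V E \<and> maximal_planar V E \<and>
     (\<forall>(V' :: nat set) E'. N4 V' E' \<longrightarrow> card V \<le> card V')"

definition nbrs :: "'a set \<Rightarrow> ('a \<Rightarrow> 'a \<Rightarrow> bool) \<Rightarrow> 'a \<Rightarrow> 'a set" where
  "nbrs V E x = {y \<in> V. E x y}"

definition deg :: "'a set \<Rightarrow> ('a \<Rightarrow> 'a \<Rightarrow> bool) \<Rightarrow> 'a \<Rightarrow> nat" where
  "deg V E x = card (nbrs V E x)"

end

theory Submission
  imports Defs "HOL-Complex_Analysis.Riemann_Mapping"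
begin

text \<open>Only two planarity facts are used: planar graphs are closed under contraction (an arc in the plane
  can be collapsed to a point, by the Riemann mapping theorem), and \<open>K5\<close> is not planar. Hence every proper
  contraction of a minimal counterexample is 4-colourable, and a pair of crossing Kempe chains, which
  would produce a \<open>K5\<close> minor, is impossible.

  Since no three neighbours of a vertex of degree 5 are independent, all boundary edges of the dumbbell are
  present. If \<open>c\<close> has degree at most 7, delete the core \<open>a, b, v1, v2, v4, v5, c\<close>: a suitable contraction
  gives a colouring of the remaining graph which extends to the core, except for three boundary colourings
  in the case of degree 7, and these become extendable after at most one Kempe switch. The argument for \<open>d\<close> is
  symmetric.\<close>

section \<open>Chords of a Jordan curve and the graph K5\<close>

text \<open>The data are neighbourhoods and arcs; neither faces nor the cyclic order of the edges at
  a vertex is available. Arguments that would speak of the two sides of the dumbbell are therefore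
  replaced by exhibiting five disjoint, connected, pairwise adjacent sets.

  The contracted blocks deliberately mix core and boundary vertices. A core vertex that shares a
  block with a boundary vertex such as \<open>u3\<close> passes on its own adjacencies: the colour
  of \<open>u3\<close> must then differ from that of every vertex outside the block that is adjacent
  to it. Deleting the core alone would not impose these inequalities, and they are what makes the
  list of boundary colourings to be treated so short.\<close>

lemma connected_subset_disjoint_open:
  "connected S \<Longrightarrow> open A \<Longrightarrow> open B \<Longrightarrow> A \<inter> B = {} \<Longrightarrow> S \<subseteq> A \<union> B \<Longrightarrow> S \<subseteq> A \<or> S \<subseteq> B"
  using connectedD[of S A B] by blast

text \<open>The arc \<open>c\<close> cuts the inside of the closed curve into two regions, and away
  from \<open>a\<close> and \<open>b\<close> the closure of each region reaches only one of
  \<open>c1\<close> and \<open>c2\<close>. A connected set avoiding \<open>c\<close> stays in one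
  region, so it cannot touch both.\<close>

lemma connected_touching_theta_inside:
  fixes c :: "real \<Rightarrow> complex"
  assumes c1: "arc c1" "pathstart c1 = a" "pathfinish c1 = b"
    and c2: "arc c2" "pathstart c2 = a" "pathfinish c2 = b"
    and c: "arc c" "pathstart c = a" "pathfinish c = b"
    and i12: "path_image c1 \<inter> path_image c2 = {a,b}"
    and i1: "path_image c1 \<inter> path_image c = {a,b}"
    and i2: "path_image c2 \<inter> path_image c = {a,b}"
    and cin: "path_image c - {a,b} \<subseteq> inside (path_image c1 \<union> path_image c2)"
    and Q: "connected Q" "Q \<inter> path_image c = {}" "Q \<subseteq> inside (path_image c1 \<union> path_image c2)"
    and x: "x \<in> closure Q" "x \<in> path_image c1" "x \<notin> {a,b}"
    and y: "y \<in> closure Q" "y \<in> path_image c2" "y \<notin> {a,b}"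
  shows False
proof -
  let ?I = "inside (path_image c1 \<union> path_image c2)"
  let ?I1 = "inside (path_image c1 \<union> path_image c)"
  let ?I2 = "inside (path_image c2 \<union> path_image c)"
  have ab: "a \<noteq> b"
    using c1 arc_distinct_ends by blast
  have cl: "closed (path_image c1)" "closed (path_image c2)" "closed (path_image c)"
    using c1 c2 c by (auto simp: arc_def closed_path_image)
  \<comment> \<open>An arc has uncountably many points, hence one besides its ends; this shows that
    \<open>c\<close> really enters the inside.\<close>
  have "\<exists>t. t \<in> path_image c - {a,b}"
  proof -
    have "uncountable (path_image c)"
      using c simple_path_image_uncountable arc_imp_simple_path by blast
    then have "infinite (path_image c)"
      using uncountable_infinite by blast
    then show ?thesis
      by (meson Diff_eq_empty_iff ex_in_conv finite.emptyI finite_insert finite_subset)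
  qed
  then have ne: "path_image c \<inter> ?I \<noteq> {}"
    using cin by blast
  have disj: "?I1 \<inter> ?I2 = {}" and un: "?I1 \<union> ?I2 \<union> (path_image c - {a,b}) = ?I"
    using split_inside_simple_closed_curve[OF arc_imp_simple_path[OF c1(1)] c1(2,3)
        arc_imp_simple_path[OF c2(1)] c2(2,3) arc_imp_simple_path[OF c(1)] c(2,3) ab i12 i1 i2 ne]
    by metis+
  have sub: "Q \<subseteq> ?I1 \<union> ?I2"
    using Q un by blast
  have op: "open ?I1" "open ?I2"
    using cl by (auto intro!: open_inside)
  have "Q \<subseteq> ?I1 \<or> Q \<subseteq> ?I2"
    using connected_subset_disjoint_open[OF Q(1) op disj sub] .
  then show False
  proof
    assume "Q \<subseteq> ?I1"
    then have "y \<in> ?I1 \<union> (path_image c1 \<union> path_image c)"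
      using y(1) closure_inside_subset[of "path_image c1 \<union> path_image c"] cl closure_mono
      by blast
    moreover have "y \<notin> path_image c1 \<union> path_image c"
      using y i12 i2 by auto
    moreover have "y \<notin> ?I1"
      using un y inside_no_overlap[of "path_image c1 \<union> path_image c2"] by blast
    ultimately show False by blast
  next
    assume "Q \<subseteq> ?I2"
    then have "x \<in> ?I2 \<union> (path_image c2 \<union> path_image c)"
      using x(1) closure_inside_subset[of "path_image c2 \<union> path_image c"] cl closure_mono
      by blast
    moreover have "x \<notin> path_image c2 \<union> path_image c"
      using x i12 i1 by auto
    moreover have "x \<notin> ?I2"
      using un x inside_no_overlap[of "path_image c1 \<union> path_image c2"] by blast
    ultimately show False by blast
  qed
qed

text \<open>Inversion about a point inside the curve sends the punctured inside to an unbounded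
  connected set, which must lie outside the image curve. Something has to fill the inside of the
  image curve, and only the image of the outside is left; being connected, that image lies there
  entirely.\<close>

lemma inversion_outside_subset_inside:
  fixes C :: "complex set"
  assumes C: "simple_path g" "pathfinish g = pathstart g" "path_image g = C" and z: "z0 \<in> inside C"
  shows "(\<lambda>z. inverse (z - z0)) ` outside C \<subseteq> inside ((\<lambda>z. inverse (z - z0)) ` C)"
proof -
  define f where "f = (\<lambda>z. inverse (z - z0))"
  have z0: "z0 \<notin> C" using z inside_no_overlap by blast
  have cont: "continuous_on (-{z0}) f"
    unfolding f_def by (intro continuous_intros) auto
  have inj: "inj_on f (-{z0})"
    unfolding f_def by (auto simp: inj_on_def)
  have J: "inside C \<noteq> {}" "open (inside C)" "connected (inside C)"
      "outside C \<noteq> {}" "open (outside C)" "connected (outside C)"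
      "bounded (inside C)" "\<not> bounded (outside C)" "inside C \<inter> outside C = {}"
      "inside C \<union> outside C = - C"
    using Jordan_inside_outside[OF C(1,2)] C(3) by auto
  have g': "simple_path (f \<circ> g)" "pathfinish (f \<circ> g) = pathstart (f \<circ> g)"
      "path_image (f \<circ> g) = f ` C"
  proof -
    have sub: "path_image g \<subseteq> -{z0}" using C z0 by auto
    show "simple_path (f \<circ> g)"
      using simple_path_continuous_image[OF C(1)] continuous_on_subset[OF cont sub]
        inj_on_subset[OF inj sub] by blast
    show "pathfinish (f \<circ> g) = pathstart (f \<circ> g)"
      using C by (simp add: pathfinish_compose pathstart_compose)
    show "path_image (f \<circ> g) = f ` C"
      using C by (simp add: path_image_compose)
  qed
  let ?C = "f ` C"
  have J': "inside ?C \<noteq> {}" "open (inside ?C)" "connected (inside ?C)"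
      "outside ?C \<noteq> {}" "open (outside ?C)" "connected (outside ?C)"
      "bounded (inside ?C)" "\<not> bounded (outside ?C)" "inside ?C \<inter> outside ?C = {}"
      "inside ?C \<union> outside ?C = - ?C"
    using Jordan_inside_outside[OF g'(1,2)] g'(3) by auto
  have disjC: "f w \<notin> ?C" if "w \<notin> C" "w \<noteq> z0" for w
    using that inj z0 by (auto simp: inj_on_def f_def)
  have out: "f ` outside C \<subseteq> - ?C"
  proof (rule image_subsetI)
    fix w assume "w \<in> outside C"
    then have "w \<notin> C" "w \<noteq> z0" using J(9,10) z by blast+
    then show "f w \<in> - ?C" using disjC by simp
  qed
  have inn: "f ` (inside C - {z0}) \<subseteq> - ?C"
  proof (rule image_subsetI)
    fix w assume "w \<in> inside C - {z0}"
    then have "w \<notin> C" "w \<noteq> z0" using J(10) by blast+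
    then show "f w \<in> - ?C" using disjC by simp
  qed
  have con_in: "connected (f ` (inside C - {z0}))"
    by (rule connected_continuous_image[OF continuous_on_subset[OF cont]])
       (use connected_open_delete[OF J(2,3)] in auto)
  have con_out: "connected (f ` outside C)"
    by (rule connected_continuous_image[OF continuous_on_subset[OF cont] J(6)])
       (use z J(9) in blast)
  have unb: "\<not> bounded (f ` (inside C - {z0}))"
  proof
    assume "bounded (f ` (inside C - {z0}))"
    then obtain B where B: "B > 0" "\<And>w. w \<in> inside C - {z0} \<Longrightarrow> norm (f w) \<le> B"
      unfolding bounded_pos by auto
    obtain e where e: "e > 0" "ball z0 e \<subseteq> inside C"
      using J(2) z open_contains_ball by blast
    \<comment> \<open>A point of the ball at distance \<open>r\<close> from \<open>z0\<close> is
      sent to norm \<open>inverse r\<close>, which is at least \<open>2*B\<close>.\<close>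
    define r where "r = min (e/2) (1/(2*B))"
    have r: "r > 0" "r < e" "r \<le> 1/(2*B)" using e B by (auto simp: r_def min_def)
    have "z0 + of_real r \<in> inside C - {z0}"
      using r e(2) by (auto simp: subset_eq dist_norm)
    from B(2)[OF this] have "inverse r \<le> B"
      unfolding f_def norm_inverse using r(1) by simp
    then have "1 \<le> B * r" using r(1) by (simp add: field_simps)
    moreover have "2 * (B * r) \<le> 1" using r(3) B(1) by (simp add: field_simps)
    ultimately show False by linarith
  qed
  have in_out: "f ` (inside C - {z0}) \<subseteq> outside ?C"
  proof -
    have "f ` (inside C - {z0}) \<subseteq> inside ?C \<or> f ` (inside C - {z0}) \<subseteq> outside ?C"
      using connected_subset_disjoint_open[OF con_in J'(2,5,9)] inn J'(10) by simp
    moreover have "\<not> f ` (inside C - {z0}) \<subseteq> inside ?C"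
      using unb J'(7) bounded_subset by blast
    ultimately show ?thesis by blast
  qed
  \<comment> \<open>The point must be nonzero: a nonzero \<open>w\<close> is the image of
    \<open>z0 + inverse w\<close>, whereas 0 is only the default value at \<open>z0\<close>
    itself.\<close>
  have meets: "\<exists>w\<in>inside ?C. w \<noteq> 0"
  proof (rule ccontr)
    assume "\<not> ?thesis"
    then have "inside ?C \<subseteq> {0}" by auto
    with J'(1) have "inside ?C = {0}" unfolding subset_singleton_iff by simp
    with J'(2) have "open {0::complex}" by simp
    then show False by (simp add: not_open_singleton)
  qed
  then obtain w where w: "w \<in> inside ?C" "w \<noteq> 0" by blast
  define t where "t = z0 + inverse w"
  have ft: "f t = w" by (simp add: f_def t_def)
  have "t \<notin> C" using ft w(1) inside_no_overlap[of ?C] by blast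
  moreover have "t \<noteq> z0" using w by (simp add: t_def)
  moreover have "t \<notin> inside C"
    using in_out ft w(1) J'(9) \<open>t \<noteq> z0\<close> by blast
  ultimately have "t \<in> outside C" using J(10) by blast
  then have "f ` outside C \<inter> inside ?C \<noteq> {}" using ft w by blast
  moreover have "f ` outside C \<subseteq> inside ?C \<or> f ` outside C \<subseteq> outside ?C"
    using connected_subset_disjoint_open[OF con_out J'(2,5,9)] out J'(10) by simp
  ultimately show ?thesis
    unfolding f_def[symmetric] using J'(9) by blast
qed

text \<open>Inversion about a point inside the closed curve carries the whole configuration to the
  inside of the image curve, where the previous theta argument applies.\<close>

lemma connected_touching_theta_outside:
  fixes c :: "real \<Rightarrow> complex"
  assumes c1: "arc c1" "pathstart c1 = a" "pathfinish c1 = b"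
    and c2: "arc c2" "pathstart c2 = a" "pathfinish c2 = b"
    and c: "arc c" "pathstart c = a" "pathfinish c = b"
    and i12: "path_image c1 \<inter> path_image c2 = {a,b}"
    and i1: "path_image c1 \<inter> path_image c = {a,b}"
    and i2: "path_image c2 \<inter> path_image c = {a,b}"
    and cin: "path_image c - {a,b} \<subseteq> outside (path_image c1 \<union> path_image c2)"
    and Q: "connected Q" "Q \<inter> path_image c = {}" "Q \<subseteq> outside (path_image c1 \<union> path_image c2)"
    and x: "x \<in> closure Q" "x \<in> path_image c1" "x \<notin> {a,b}"
    and y: "y \<in> closure Q" "y \<in> path_image c2" "y \<notin> {a,b}"
  shows False
proof -
  let ?C = "path_image c1 \<union> path_image c2"
  define g where "g = c1 +++ reversepath c2"
  have g: "simple_path g" "pathfinish g = pathstart g" "path_image g = ?C"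
    unfolding g_def using c1 c2 i12
    by (auto simp: simple_path_join_loop_eq arc_reversepath path_image_join)
  obtain z0 where z0: "z0 \<in> inside ?C"
    using Jordan_inside_outside[OF g(1,2)] g(3) by auto
  define f where "f = (\<lambda>z. inverse (z - z0))"
  have inv: "f ` outside ?C \<subseteq> inside (f ` ?C)"
    using inversion_outside_subset_inside[OF g z0] by (simp add: f_def)
  have z0n: "z0 \<notin> ?C" "z0 \<notin> outside ?C" 
    using z0 inside_no_overlap inside_Int_outside by blast+
  have cont: "continuous_on (-{z0}) f"
    unfolding f_def by (intro continuous_intros) auto
  have inj: "inj_on f (-{z0})"
    unfolding f_def by (auto simp: inj_on_def)
  have ab: "a \<in> path_image c1" "b \<in> path_image c1" 
    using c1 by (metis pathstart_in_path_image, metis pathfinish_in_path_image)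
  have z0c: "z0 \<notin> path_image c"
    using cin z0n ab by blast
  have arcs: "arc (f \<circ> k)" "pathstart (f \<circ> k) = f (pathstart k)"
      "pathfinish (f \<circ> k) = f (pathfinish k)" "path_image (f \<circ> k) = f ` path_image k"
    if "arc k" "z0 \<notin> path_image k" for k
  proof -
    have sub: "path_image k \<subseteq> - {z0}" using that by auto
    show "arc (f \<circ> k)"
      using that(1) path_continuous_image[of k f] continuous_on_subset[OF cont sub]
        inj_on_subset[OF inj sub] by (auto simp: arc_def comp_inj_on path_image_def)
  qed (auto simp: pathfinish_compose pathstart_compose path_image_compose)
  have int: "f ` S \<inter> f ` T = f ` (S \<inter> T)" if "z0 \<notin> S" "z0 \<notin> T" for S T
    using that inj_on_image_Int[OF inj, of S T] by auto
  have fin: "f w \<notin> {f a, f b}" if "w \<notin> {a,b}" "w \<in> ?C" for w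
    using that inj z0n ab by (auto simp: inj_on_def f_def)
  have fcl: "f w \<in> closure (f ` Q)" if "w \<in> closure Q" "w \<in> ?C" for w
  proof -
    from that(1) obtain s where s: "\<And>n. s n \<in> Q" "s \<longlonglongrightarrow> w"
      unfolding closure_sequential by auto
    have "isCont f w"
      using cont that(2) z0n(1) by (metis ComplI continuous_on_eq_continuous_at open_Compl closed_singleton singletonD)
    then have "(\<lambda>n. f (s n)) \<longlonglongrightarrow> f w"
      using s(2) isCont_tendsto_compose by blast
    then show ?thesis
      unfolding closure_sequential using s(1) by (intro exI[of _ "\<lambda>n. f (s n)"]) auto
  qed
  have z1: "z0 \<notin> path_image c1" "z0 \<notin> path_image c2" "z0 \<notin> Q"
    using z0n Q by auto
  show False
  proof (rule connected_touching_theta_inside[where ?c1.0 = "f \<circ> c1" and ?c2.0 = "f \<circ> c2"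
        and c = "f \<circ> c" and a = "f a" and b = "f b" and Q = "f ` Q" and x = "f x" and y = "f y"])
    show "path_image (f \<circ> c1) \<inter> path_image (f \<circ> c2) = {f a, f b}"
      "path_image (f \<circ> c1) \<inter> path_image (f \<circ> c) = {f a, f b}"
      "path_image (f \<circ> c2) \<inter> path_image (f \<circ> c) = {f a, f b}"
      using int z1 z0c i12 i1 i2 by (simp_all add: path_image_compose)
    have "path_image (f \<circ> c) - {f a, f b} \<subseteq> f ` (path_image c - {a,b})"
      by (auto simp: path_image_compose)
    also have "\<dots> \<subseteq> inside (f ` ?C)" using cin inv by blast
    finally show "path_image (f \<circ> c) - {f a, f b} \<subseteq> inside (path_image (f \<circ> c1) \<union> path_image (f \<circ> c2))"
      by (simp add: path_image_compose image_Un)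
    show "connected (f ` Q)"
      by (rule connected_continuous_image[OF continuous_on_subset[OF cont] Q(1)]) (use z1 in auto)
    show "f ` Q \<inter> path_image (f \<circ> c) = {}"
      using int z1 z0c Q(2) by (simp add: path_image_compose)
    have "f ` Q \<subseteq> inside (f ` ?C)" using Q inv by blast
    then show "f ` Q \<subseteq> inside (path_image (f \<circ> c1) \<union> path_image (f \<circ> c2))"
      by (simp add: path_image_compose image_Un)
    show "f x \<in> closure (f ` Q)" "f y \<in> closure (f ` Q)" using fcl x y by auto
    show "f x \<notin> {f a, f b}" "f y \<notin> {f a, f b}" using fin[of x] fin[of y] x y by auto
    show "f x \<in> path_image (f \<circ> c1)" "f y \<in> path_image (f \<circ> c2)"
      using x y by (auto simp: path_image_compose)
  qed (use c1 c2 c z1 z0c arcs in \<open>simp_all\<close>)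
qed

lemma arc_join_ends:
  assumes "arc g" "arc h" "pathfinish g = pathstart h" "path_image g \<inter> path_image h \<subseteq> {pathstart h}"
  shows "arc (g +++ h)" "path_image (g +++ h) = path_image g \<union> path_image h"
  using assms by (auto simp: arc_join path_image_join)

lemma arc_open_connected:
  assumes "arc g" 
  shows "connected (path_image g - {pathstart g, pathfinish g})"
    and "pathstart g \<in> closure (path_image g - {pathstart g, pathfinish g})"
    and "pathfinish g \<in> closure (path_image g - {pathstart g, pathfinish g})"
proof -
  let ?S = "path_image g - {pathstart g, pathfinish g}"
  have eq: "?S = g ` {0<..<1}"
    using assms unfolding arc_def inj_on_def path_image_def pathstart_def pathfinish_def
    by (force simp: less_le image_iff)
  have cont: "continuous_on {0..1} g" using assms by (simp add: arc_def path_def)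
  show "connected ?S"
    unfolding eq by (rule connected_continuous_image[OF continuous_on_subset[OF cont]]) auto
  have "g ` closure {0<..<1} \<subseteq> closure (g ` {0<..<1})"
    by (rule image_closure_subset) (use cont in \<open>auto intro: closure_subset[THEN subsetD]\<close>)
  moreover have "closure {0<..<1} = {0..1::real}" by (simp add: closure_greaterThanLessThan)
  ultimately have "g ` {0..1} \<subseteq> closure ?S" by (simp add: eq)
  then show "pathstart g \<in> closure ?S" "pathfinish g \<in> closure ?S"
    unfolding pathstart_def pathfinish_def by auto
qed

text \<open>The theta arguments exclude both sets being inside and both being outside.
  \<open>Q\<close> is any connected set reaching both arcs, not only a chord, so that a vertex
  together with its open edges may take its place.\<close>

lemma crossing_chords_opposite_sides:
  fixes c :: "real \<Rightarrow> complex"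
  assumes c1: "arc c1" "pathstart c1 = a" "pathfinish c1 = b"
    and c2: "arc c2" "pathstart c2 = a" "pathfinish c2 = b"
    and c: "arc c" "pathstart c = a" "pathfinish c = b"
    and i12: "path_image c1 \<inter> path_image c2 = {a,b}"
    and i1: "path_image c1 \<inter> path_image c = {a,b}"
    and i2: "path_image c2 \<inter> path_image c = {a,b}"
    and C: "path_image c1 \<union> path_image c2 = C"
    and P: "P = path_image c - {a,b}"
    and Q: "connected Q" "Q \<inter> C = {}" "Q \<inter> P = {}"
    and x: "x \<in> closure Q" "x \<in> path_image c1" "x \<notin> {a,b}"
    and y: "y \<in> closure Q" "y \<in> path_image c2" "y \<notin> {a,b}"
  shows "P \<subseteq> inside C \<and> Q \<subseteq> outside C \<or> P \<subseteq> outside C \<and> Q \<subseteq> inside C"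
proof -
  define g where "g = c1 +++ reversepath c2"
  have g: "simple_path g" "pathfinish g = pathstart g" "path_image g = C"
    unfolding g_def using c1 c2 i12 C
    by (auto simp: simple_path_join_loop_eq arc_reversepath path_image_join)
  have J: "open (inside C)" "open (outside C)" "inside C \<inter> outside C = {}"
      "inside C \<union> outside C = - C"
    using Jordan_inside_outside[OF g(1,2)] g(3) by auto
  have "connected P" using arc_open_connected(1)[OF c(1)] c P by simp
  moreover have "P \<subseteq> inside C \<union> outside C" using P i1 i2 C J(4) by blast
  ultimately have Ps: "P \<subseteq> inside C \<or> P \<subseteq> outside C"
    using connected_subset_disjoint_open[OF _ J(1-3)] by blast
  have "Q \<subseteq> inside C \<union> outside C" using Q J(4) by blast
  then have Qs: "Q \<subseteq> inside C \<or> Q \<subseteq> outside C"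
    using connected_subset_disjoint_open[OF Q(1) J(1-3)] by blast
  have ab: "a \<in> C" "b \<in> C" using i12 C by blast+
  have Qc: "Q \<inter> path_image c = {}" using Q P ab by blast
  have "\<not> (P \<subseteq> inside C \<and> Q \<subseteq> inside C)"
    using connected_touching_theta_inside[OF c1 c2 c i12 i1 i2 _ Q(1) Qc _ x y] C P by auto
  moreover have "\<not> (P \<subseteq> outside C \<and> Q \<subseteq> outside C)"
    using connected_touching_theta_outside[OF c1 c2 c i12 i1 i2 _ Q(1) Qc _ x y] C P by auto
  ultimately show ?thesis using Ps Qs by blast
qed

text \<open>The body of \<open>planar\<close> with the points and arcs as arguments, so that
  drawings can be transformed explicitly.\<close>

definition arc_drawing :: "'a set \<Rightarrow> ('a \<Rightarrow> 'a \<Rightarrow> bool) \<Rightarrow> ('a \<Rightarrow> complex) \<Rightarrow> ('a \<Rightarrow> 'a \<Rightarrow> real \<Rightarrow> complex) \<Rightarrow> bool" where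
  "arc_drawing V E p \<gamma> \<longleftrightarrow> inj_on p V \<and>
     (\<forall>u v. E u v \<longrightarrow> arc (\<gamma> u v) \<and> pathstart (\<gamma> u v) = p u \<and> pathfinish (\<gamma> u v) = p v) \<and>
     (\<forall>u v w. E u v \<and> w \<in> V \<and> p w \<in> path_image (\<gamma> u v) \<longrightarrow> w = u \<or> w = v) \<and>
     (\<forall>u v x y. E u v \<and> E x y \<and> {u, v} \<noteq> {x, y} \<longrightarrow>
        path_image (\<gamma> u v) \<inter> path_image (\<gamma> x y) \<subseteq> p ` ({u, v} \<inter> {x, y}))"

text \<open>Among the edge 0-2, the edge 1-3 and the star at 4, any two lie on opposite sides
  of the 4-cycle 0-1-2-3.\<close>

lemma no_arc_drawing_K5:
  fixes p :: "nat \<Rightarrow> complex"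
  shows "\<not> arc_drawing {..<5} (\<lambda>i j. i < 5 \<and> j < 5 \<and> i \<noteq> j) p \<gamma>"
proof
  assume D: "arc_drawing {..<5} (\<lambda>i j. i < 5 \<and> j < 5 \<and> i \<noteq> j) p \<gamma>"
  let ?E = "\<lambda>i j::nat. i < 5 \<and> j < 5 \<and> i \<noteq> j"
  \<comment> \<open>A drawing has two possibly different arcs for each edge, one per direction.
    Keeping the one that starts at the smaller end, reversed when needed, makes the images
    \<open>I\<close> symmetric.\<close>
  define \<delta> where "\<delta> i j = (if i < j then \<gamma> i j else reversepath (\<gamma> j i))" for i j
  define I where "I i j = path_image (\<delta> i j)" for i j
  have Isym: "I i j = I j i" if "i \<noteq> j" for i j
    using that by (auto simp: I_def \<delta>_def)
  have pinj: "p i = p j \<longleftrightarrow> i = j" if "i < 5" "j < 5" for i j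
    using D that unfolding arc_drawing_def inj_on_def by auto
  have ar: "arc (\<delta> i j)" "pathstart (\<delta> i j) = p i" "pathfinish (\<delta> i j) = p j" if "?E i j" for i j
    using D that unfolding arc_drawing_def \<delta>_def by (auto simp: arc_reversepath)
  have endI: "p i \<in> I i j" "p j \<in> I i j" if "?E i j" for i j
    using ar[OF that] unfolding I_def by (metis pathstart_in_path_image, metis pathfinish_in_path_image)
  have vI: "k = i \<or> k = j" if "?E i j" "k < 5" "p k \<in> I i j" for i j k
  proof -
    have "w = u \<or> w = v" if "?E u v" "w < 5" "p w \<in> path_image (\<gamma> u v)" for u v w
      using D that unfolding arc_drawing_def by blast
    from this[of i j k] this[of j i k] that show ?thesis
      unfolding I_def \<delta>_def by (auto split: if_splits)
  qed
  have II: "I i j \<inter> I k l \<subseteq> p ` ({i,j} \<inter> {k,l})" if "?E i j" "?E k l" "{i,j} \<noteq> {k,l}" for i j k l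
  proof -
    have *: "path_image (\<gamma> i j) \<inter> path_image (\<gamma> k l) \<subseteq> p ` ({i,j} \<inter> {k,l})"
      if "?E i j" "?E k l" "{i,j} \<noteq> {k,l}" for i j k l
      using D that unfolding arc_drawing_def by blast
    have im: "I i j = path_image (\<gamma> (min i j) (max i j))" if "i \<noteq> j" for i j
      using that by (auto simp: I_def \<delta>_def min_def max_def)
    have mm: "{min i j, max i j} = {i, j}" for i j :: nat
      by (auto simp: min_def max_def)
    have "path_image (\<gamma> (min i j) (max i j)) \<inter> path_image (\<gamma> (min k l) (max k l))
      \<subseteq> p ` ({min i j, max i j} \<inter> {min k l, max k l})"
      by (rule *) (use that in \<open>auto simp: mm\<close>)
    then show ?thesis using that by (simp add: im mm)
  qed
  have I1: "I i j \<inter> I j k = {p j}" if "?E i j" "?E j k" "i \<noteq> k" for i j k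
    using II[OF that(1,2)] that endI[OF that(1)] endI[OF that(2)] by (auto simp: doubleton_eq_iff)
  have I0: "I i j \<inter> I k l = {}" if "?E i j" "?E k l" "{i,j} \<inter> {k,l} = {}" for i j k l
    using II[OF that(1,2)] that by auto
  let ?o = "\<lambda>i j. I i j - {p i, p j}"
  have oc: "connected (?o i j)" "p i \<in> closure (?o i j)" "p j \<in> closure (?o i j)" if "?E i j" for i j
    using arc_open_connected[OF ar(1)[OF that]] ar[OF that] unfolding I_def by auto
  define J where "J i j k = \<delta> i j +++ \<delta> j k" for i j k
  have J: "arc (J i j k)" "pathstart (J i j k) = p i" "pathfinish (J i j k) = p k"
      "path_image (J i j k) = I i j \<union> I j k"
    if "i < 5" "j < 5" "k < 5" "i \<noteq> j" "j \<noteq> k" "i \<noteq> k" for i j k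
  proof -
    have "?E i j" "?E j k" using that by auto
    note a = ar[OF this(1)] ar[OF this(2)]
    have "path_image (\<delta> i j) \<inter> path_image (\<delta> j k) \<subseteq> {pathstart (\<delta> j k)}"
      using I1[OF \<open>?E i j\<close> \<open>?E j k\<close> \<open>i \<noteq> k\<close>] a unfolding I_def by auto
    from arc_join_ends[OF a(1,4) _ this] a
    show "arc (J i j k)" "path_image (J i j k) = I i j \<union> I j k"
      unfolding J_def I_def by auto
    show "pathstart (J i j k) = p i" "pathfinish (J i j k) = p k"
      using a unfolding J_def by auto
  qed
  have X: "?o i k \<subseteq> inside C \<and> S \<subseteq> outside C \<or> ?o i k \<subseteq> outside C \<and> S \<subseteq> inside C"
    if ijkl: "i < 5" "j < 5" "k < 5" "l < 5" "i \<noteq> j" "i \<noteq> k" "i \<noteq> l" "j \<noteq> k" "j \<noteq> l" "k \<noteq> l"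
      and C: "I i j \<union> I j k \<union> (I i l \<union> I l k) = C"
      and S: "connected S" "S \<inter> C = {}" "S \<inter> I i k = {}" "p j \<in> closure S" "p l \<in> closure S"
    for i j k l C S
  proof (rule crossing_chords_opposite_sides[where ?c1.0 = "J i j k" and ?c2.0 = "J i l k" and c = "\<delta> i k"
        and a = "p i" and b = "p k" and x = "p j" and y = "p l"])
    have "I i j \<inter> I i l = {p i}" "I j k \<inter> I l k = {p k}" "I i j \<inter> I l k = {}" "I j k \<inter> I i l = {}"
      using I1[of j i l] I1[of j k l] I0[of i j l k] I0[of j k i l] ijkl Isym by auto
    then show "path_image (J i j k) \<inter> path_image (J i l k) = {p i, p k}"
      using J[of i j k] J[of i l k] ijkl by auto
    have A: "path_image (J i j k) \<inter> path_image (\<delta> i k) = {p i, p k}"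
      if "i < 5" "j < 5" "k < 5" "i \<noteq> j" "i \<noteq> k" "j \<noteq> k" for j
    proof -
      have "I i j \<inter> I i k = {p i}" "I j k \<inter> I i k = {p k}"
        using I1[of j i k] I1[of j k i] that Isym by auto
      then show ?thesis using J[of i j k] that by (auto simp: I_def)
    qed
    show "path_image (J i j k) \<inter> path_image (\<delta> i k) = {p i, p k}"
      "path_image (J i l k) \<inter> path_image (\<delta> i k) = {p i, p k}"
      using A ijkl by auto
    show "path_image (J i j k) \<union> path_image (J i l k) = C"
      using J[of i j k] J[of i l k] ijkl C by auto
    show "p j \<in> path_image (J i j k)" "p l \<in> path_image (J i l k)"
      using J(4)[of i j k] J(4)[of i l k] endI[of i j] endI[of i l] ijkl by auto
  qed (use ijkl S J ar pinj in \<open>auto simp: I_def\<close>)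
  define C where "C = I 0 1 \<union> I 1 2 \<union> (I 0 3 \<union> I 3 2)"
  \<comment> \<open>The same cycle, read as two arcs from 1 to 3, so that the edge 1-3 can serve as
    the chord.\<close>
  have C': "I 1 0 \<union> I 0 3 \<union> (I 1 2 \<union> I 2 3) = C"
    unfolding C_def using Isym[of 0 1] Isym[of 2 3] by auto
  \<comment> \<open>The star at 4 without its four tips: disjoint from the cycle, with the tips in
    its closure.\<close>
  define Z where "Z = (\<Union>i\<in>{..<4}. insert (p 4) (?o 4 i))"
  have Zi: "connected (insert (p 4) (?o 4 i))" if "i < 4" for i
  proof (rule connected_intermediate_closure[of "?o 4 i"])
    show "connected (?o 4 i)" using oc(1)[of 4 i] that by simp
    show "insert (p 4) (?o 4 i) \<subseteq> closure (?o 4 i)"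
      using oc(2)[of 4 i] that closure_subset[of "?o 4 i"] by auto
  qed auto
  have conZ: "connected Z"
    unfolding Z_def by (rule connected_Union) (use Zi in auto)
  have od: "?o i j \<inter> I k l = {}" if "?E i j" "?E k l" "{i,j} \<noteq> {k,l}" for i j k l
  proof -
    have "p ` ({i,j} \<inter> {k,l}) \<subseteq> {p i, p j}" by auto
    then show ?thesis using II[OF that] by blast
  qed
  have Zd: "Z \<inter> I k l = {}" if "k < 4" "l < 4" "k \<noteq> l" for k l
  proof -
    have "p 4 \<notin> I k l" using vI[of k l 4] that by auto
    moreover have "?o 4 i \<inter> I k l = {}" if "i < 4" for i
      using \<open>k < 4\<close> \<open>l < 4\<close> \<open>k \<noteq> l\<close> that by (intro od) (auto simp: doubleton_eq_iff)
    ultimately show ?thesis unfolding Z_def by blast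
  qed
  have Zc: "p i \<in> closure Z" if "i < 4" for i
  proof -
    have "?o 4 i \<subseteq> Z" unfolding Z_def using that by blast
    then show ?thesis using oc(3)[of 4 i] that closure_mono[THEN subsetD] by simp
  qed
  have ZC: "Z \<inter> C = {}" unfolding C_def using Zd by (simp add: Int_Un_distrib)
  have QC: "?o 1 3 \<inter> C = {}"
    unfolding C_def Int_Un_distrib Un_empty by (intro conjI od) (auto simp: doubleton_eq_iff)
  have Q2: "?o 1 3 \<inter> I 0 2 = {}"
    by (rule od) (auto simp: doubleton_eq_iff)
  have 1: "?o 0 2 \<subseteq> inside C \<and> ?o 1 3 \<subseteq> outside C \<or> ?o 0 2 \<subseteq> outside C \<and> ?o 1 3 \<subseteq> inside C"
    by (rule X[OF _ _ _ _ _ _ _ _ _ _ C_def[symmetric] oc(1) QC Q2 oc(2,3)]) simp_all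
  have 2: "?o 0 2 \<subseteq> inside C \<and> Z \<subseteq> outside C \<or> ?o 0 2 \<subseteq> outside C \<and> Z \<subseteq> inside C"
    by (rule X[OF _ _ _ _ _ _ _ _ _ _ C_def[symmetric] conZ ZC Zd Zc Zc]) simp_all
  have 3: "?o 1 3 \<subseteq> inside C \<and> Z \<subseteq> outside C \<or> ?o 1 3 \<subseteq> outside C \<and> Z \<subseteq> inside C"
    by (rule X[OF _ _ _ _ _ _ _ _ _ _ C' conZ ZC Zd Zc Zc]) simp_all
  have ne: "S \<noteq> {}" if "x \<in> closure S" for x :: complex and S
    using that by auto
  have "?o 0 2 \<noteq> {}" by (rule ne[OF oc(2)]) simp
  moreover have "?o 1 3 \<noteq> {}" by (rule ne[OF oc(2)]) simp
  moreover have "Z \<noteq> {}" by (rule ne[OF Zc[of 0]]) simp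
  moreover have "inside C \<inter> outside C = {}" by simp
  \<comment> \<open>Three nonempty sets cannot be pairwise on opposite sides when there are only two
    sides.\<close>
  ultimately show False using 1 2 3 by (metis Int_greatest subset_empty)
qed

section \<open>Contractions of plane drawings\<close>

lemma isCont_avoid_closed:
  fixes f :: "complex \<Rightarrow> complex"
  assumes "isCont f z" "closed B" "f z \<notin> B"
  shows "\<exists>d>0. \<forall>y. dist z y < d \<longrightarrow> f y \<notin> B"
proof -
  obtain e where e: "e > 0" "ball (f z) e \<subseteq> - B"
    using assms(2,3) open_contains_ball[of "-B"] by (auto simp: open_Compl)
  then obtain d where "d > 0" "\<And>y. dist y z < d \<Longrightarrow> dist (f y) (f z) < e"
    using assms(1) unfolding continuous_at_eps_delta dist_norm by meson
  then show ?thesis using e(2) by (intro exI[of _ d]) (auto simp: dist_commute subset_eq)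
qed

text \<open>The complement of an arc in the Riemann sphere is simply connected, so by the Riemann
  mapping theorem it is homeomorphic to the sphere minus a point; the homeomorphism extends
  to the arc as a constant.\<close>

lemma arc_collapse:
  fixes g :: "real \<Rightarrow> complex"
  assumes g: "arc g"
  obtains q :: "complex \<Rightarrow> complex" where "continuous_on UNIV q"
    "\<And>z. q z = 0 \<longleftrightarrow> z \<in> path_image g" "inj_on q (- path_image g)"
proof -
  define K where "K = path_image g"
  define k0 where "k0 = pathstart g"
  have K: "compact K" "closed K" "bounded K" "k0 \<in> K"
    using g by (auto simp: K_def k0_def arc_def compact_path_image closed_path_image bounded_path_image)
  \<comment> \<open>The image of the arc under inversion about its starting point \<open>k0\<close>,
    which itself goes to infinity. The complement \<open>W\<close> contains 0, the image of
    infinity.\<close>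
  define N where "N = {w. w \<noteq> 0 \<and> k0 + inverse w \<in> K}"
  define f where "f = (\<lambda>z. inverse (z - k0))"
  obtain M where M: "M > 0" "\<And>z. z \<in> K \<Longrightarrow> norm (z - k0) \<le> M"
    using K(3) bounded_iff[of "(\<lambda>z. z - k0) ` K"] bounded_translation[of K "-k0"]
    unfolding bounded_pos by (auto simp: bounded_pos)
  have Nbig: "norm w \<ge> 1/M" if "w \<in> N" for w
  proof -
    have "norm (inverse w) \<le> M" using M(2)[of "k0 + inverse w"] that by (simp add: N_def)
    then show ?thesis using that M(1) by (simp add: N_def norm_divide field_simps)
  qed
  \<comment> \<open>Staying at distance at least \<open>1/M\<close> from 0 keeps
    \<open>inverse\<close> continuous, so that closedness can be pulled back from
    \<open>K\<close>.\<close>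
  have Neq: "N = {w \<in> {w. norm w \<ge> 1/M}. k0 + inverse w \<in> K}"
    using Nbig M(1) by (auto simp: N_def)
  have "closed N"
    unfolding Neq
  proof (rule continuous_closed_preimage[unfolded vimage_def Int_def, simplified])
    show "continuous_on {w. 1/M \<le> norm w} (\<lambda>w. k0 + inverse w)"
      using M(1) by (intro continuous_intros) auto
    show "closed {w::complex. 1/M \<le> norm w}"
      by (intro closed_Collect_le continuous_intros)
    show "closed K" by (fact K)
  qed
  define W where "W = - N"
  have opW: "open W" using \<open>closed N\<close> by (simp add: W_def open_Compl)
  have fW: "f z \<in> W" if "z \<notin> K" for z
    using that by (auto simp: W_def N_def f_def)
  have fN: "f z \<notin> W" if "z \<in> K" "z \<noteq> k0" for z
    using that by (auto simp: W_def N_def f_def)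
  have contf: "continuous_on (-{k0}) f"
    unfolding f_def by (intro continuous_intros) auto
  have injf: "inj_on f (-{k0})"
    unfolding f_def by (auto simp: inj_on_def)
  have conW: "connected W"
  proof -
    have "W = f ` (- K) \<union> ball 0 (1/M)"
    proof (intro equalityI subsetI)
      fix w assume w: "w \<in> W"
      show "w \<in> f ` (- K) \<union> ball 0 (1/M)"
      proof (cases "w = 0")
        case False
        then have "k0 + inverse w \<in> - K" "w = f (k0 + inverse w)"
          using w by (auto simp: W_def N_def f_def)
        then show ?thesis by blast
      qed (use M in auto)
    next
      fix w assume "w \<in> f ` (- K) \<union> ball 0 (1/M)"
      then show "w \<in> W" using fW Nbig by (fastforce simp: W_def)
    qed
    moreover have "connected (f ` (- K))"
      using connected_arc_complement[OF g] K(4)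
      by (intro connected_continuous_image[OF continuous_on_subset[OF contf]]) (auto simp: K_def)
    moreover have "f ` (- K) \<inter> ball 0 (1/M) \<noteq> {}"
    proof -
      define z where "z = k0 + of_real (2*M)"
      have "norm (z - k0) = 2*M" using M(1) by (simp add: z_def)
      then have "z \<notin> K" "f z \<in> ball 0 (1/M)"
        using M(1) M(2)[of z] by (auto simp: f_def norm_divide field_simps)
      then show ?thesis by blast
    qed
    ultimately show ?thesis by (simp add: connected_Un)
  qed
  have Nimg: "N = (f \<circ> g) ` {0<..1}"
  proof (intro equalityI subsetI)
    fix w assume w: "w \<in> N"
    then obtain t where t: "t \<in> {0..1}" "k0 + inverse w = g t"
      by (auto simp: N_def K_def path_image_def)
    have "t \<noteq> 0" using t w by (auto simp: N_def k0_def pathstart_def)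
    then show "w \<in> (f \<circ> g) ` {0<..1}"
      using t by (intro image_eqI[of _ _ t]) (auto simp: f_def simp flip: t(2))
  next
    fix w assume "w \<in> (f \<circ> g) ` {0<..1}"
    then obtain t where t: "0 < t" "t \<le> 1" "w = f (g t)" by auto
    have "g t \<noteq> k0"
      using g t unfolding arc_def inj_on_def k0_def pathstart_def
      by (metis atLeastAtMost_iff less_eq_real_def less_irrefl zero_le_one)
    then show "w \<in> N" using t by (auto simp: N_def f_def K_def path_image_def)
  qed
  have gne: "g t \<noteq> k0" if "0 < t" "t \<le> 1" for t
      using g that unfolding arc_def inj_on_def k0_def pathstart_def
      by (metis atLeastAtMost_iff less_eq_real_def less_irrefl zero_le_one)
  have contg: "continuous_on {0..1} g" using g by (simp add: arc_def path_def)
  have conN: "connected N"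
    unfolding Nimg
  proof (rule connected_continuous_image)
    show "continuous_on {0<..1} (f \<circ> g)"
    proof (intro continuous_on_compose continuous_on_subset[OF contf] continuous_on_subset[OF contg])
      show "g ` {0<..1} \<subseteq> - {k0}" using gne by force
    qed auto
  qed auto
  have unbN: "\<not> bounded N"
  proof
    assume "bounded N"
    then obtain B where B: "B > 0" "\<And>w. w \<in> N \<Longrightarrow> norm w \<le> B" by (auto simp: bounded_pos)
    obtain e where e: "e > 0" "\<And>t. t \<in> {0..1} \<Longrightarrow> dist t 0 < e \<Longrightarrow> dist (g t) (g 0) < 1/B"
      using contg B(1) unfolding continuous_on_iff
      by (metis atLeastAtMost_iff order_refl zero_le_one zero_less_divide_1_iff)
    define t where "t = min (e/2) 1"
    have t: "0 < t" "t \<le> 1" "t < e" using e by (auto simp: t_def)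
    have "dist (g t) (g 0) < 1/B" using e(2)[of t] t by auto
    then have 1: "norm (g t - k0) < 1/B" by (simp add: dist_norm k0_def pathstart_def)
    have "f (g t) \<in> N" using Nimg t by auto
    then have "norm (f (g t)) \<le> B" using B by blast
    then have "1 \<le> B * norm (g t - k0)"
      using gne[OF t(1,2)] by (simp add: f_def norm_divide field_simps)
    then show False using 1 B(1) by (simp add: field_simps)
  qed
  \<comment> \<open>The complement \<open>N\<close> of \<open>W\<close> is connected and unbounded,
    so it has no bounded component.\<close>
  have "simply_connected W"
    unfolding simply_connected_eq_unbounded_complement_components[OF opW]
  proof (intro conjI ballI)
    fix C assume "C \<in> components (- W)"
    then show "\<not> bounded C"
      using unbN conN components_eq_sing_iff[of N] by (cases "N = {}") (auto simp: W_def)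
  qed (fact conW)
  then have "W homeomorphic ball (0::complex) 1"
    using simply_connected_eq_homeomorphic_to_disc[OF opW] by (auto simp: W_def N_def)
  also have "ball (0::complex) 1 homeomorphic (UNIV::complex set)"
    by (rule homeomorphic_ball01_UNIV)
  finally obtain h h' :: "complex \<Rightarrow> complex" where h: "homeomorphism W UNIV h h'"
    unfolding homeomorphic_def by blast
  have hW: "continuous_on W h" "continuous_on UNIV h'" "\<And>w. w \<in> W \<Longrightarrow> h' (h w) = w"
    "\<And>y. h' y \<in> W" "\<And>y. h (h' y) = y"
    using h by (auto simp: homeomorphism_def)
  have injh: "inj_on h W" by (rule inj_on_inverseI[of _ h']) (rule hW(3))
  have "0 \<in> W" by (simp add: W_def N_def)
  have hne: "h (f z) \<noteq> h 0" if "z \<notin> K" for z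
  proof -
    have "f z \<noteq> 0" using that K(4) by (auto simp: f_def)
    then show ?thesis using inj_onD[OF injh _ fW[OF that] \<open>0 \<in> W\<close>] by blast
  qed
  \<comment> \<open>\<open>f\<close> sends infinity to 0, so subtracting \<open>h 0\<close> and
    inverting sends infinity back to infinity. When \<open>z\<close> approaches the arc,
    \<open>f z\<close> leaves every compact subset of \<open>W\<close>, hence \<open>h (f z)\<close>
    is unbounded and the quotient tends to 0, the value chosen on the arc.\<close>
  define q where "q z = (if z \<in> K then 0 else inverse (h (f z) - h 0))" for z
  have q0: "q z = 0 \<longleftrightarrow> z \<in> K" for z
    using hne by (auto simp: q_def)
  have cont_out: "continuous_on (-K) q"
  proof -
    have "continuous_on (-K) (\<lambda>z. inverse (h (f z) - h 0))"
    proof (intro continuous_intros)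
      show "continuous_on (-K) (\<lambda>z. h (f z))"
        by (rule continuous_on_compose2[OF hW(1)])
           (use fW K(4) in \<open>auto intro: continuous_on_subset[OF contf]\<close>)
    qed (use hne in auto)
    then show ?thesis
      by (rule continuous_on_eq) (auto simp: q_def)
  qed
  have cont_in: "isCont q z" if z: "z \<in> K" for z
    unfolding continuous_at_eps_delta
  proof (intro allI impI)
    fix e :: real assume e: "e > 0"
    \<comment> \<open>Compactness of \<open>B\<close> is the point: at points of \<open>W\<close>
      outside \<open>B\<close>, \<open>h\<close> is farther than \<open>1/e\<close> from
      \<open>h 0\<close>, which makes \<open>q\<close> smaller than \<open>e\<close>.\<close>
    define B where "B = h' ` cball (h 0) (1/e)"
    have cB: "compact B"
      unfolding B_def by (intro compact_continuous_image continuous_on_subset[OF hW(2)]) auto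
    obtain R where R: "R > 0" "\<And>w. w \<in> B \<Longrightarrow> norm w \<le> R"
      using compact_imp_bounded[OF cB] by (auto simp: bounded_pos)
    \<comment> \<open>\<open>k0\<close> is listed separately because \<open>f k0\<close> is
      \<open>inverse 0 = 0\<close>, a point of \<open>W\<close>, although \<open>k0\<close> belongs
      to the arc.\<close>
    have small: "norm (q y) < e" if "y = k0 \<or> f y \<notin> B" for y
    proof (cases "y \<in> K")
      case True
      then show ?thesis using e by (simp add: q_def)
    next
      case False
      then have "f y \<notin> B" using that K(4) by auto
      moreover have "f y = h' (h (f y))" using hW(3) fW[OF False] by simp
      ultimately have "h (f y) \<notin> cball (h 0) (1/e)" unfolding B_def by (metis imageI)
      then have "norm (h (f y) - h 0) > 1/e" by (simp add: dist_norm norm_minus_commute)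
      then have "inverse (norm (h (f y) - h 0)) < e"
        using e by (metis inverse_eq_divide inverse_less_imp_less inverse_inverse_eq inverse_positive_iff_positive less_trans positive_imp_inverse_positive)
      then show ?thesis using False by (simp add: q_def norm_inverse)
    qed
    have "\<exists>d>0. \<forall>y. dist y z < d \<longrightarrow> y = k0 \<or> f y \<notin> B"
    proof (cases "z = k0")
      case True
      have "f y \<notin> B" if "dist y z < 1/R" "y \<noteq> k0" for y
      proof
        assume "f y \<in> B"
        then have "norm (f y) \<le> R" by (rule R(2))
        then have "1 \<le> R * norm (y - k0)"
          using that(2) by (simp add: f_def norm_divide field_simps)
        then show False using that(1) True R(1) by (simp add: dist_norm field_simps)
      qed
      then show ?thesis using R(1) by (intro exI[of _ "1/R"]) auto
    next
      case False
      have "f z \<notin> B" using fN[OF z False] hW(4) by (auto simp: B_def)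
      moreover have "isCont f z"
        using False unfolding f_def by (intro continuous_intros) auto
      ultimately obtain d where "d > 0" "\<And>y. dist z y < d \<Longrightarrow> f y \<notin> B"
        using isCont_avoid_closed[of z f B] compact_imp_closed[OF cB] by metis
      then show ?thesis by (metis dist_commute)
    qed
    then obtain d where d: "d > 0" "\<And>y. dist y z < d \<Longrightarrow> y = k0 \<or> f y \<notin> B" by blast
    show "\<exists>d>0. \<forall>y. dist y z < d \<longrightarrow> dist (q y) (q z) < e"
    proof (intro exI[of _ d] conjI allI impI)
      fix y assume "dist y z < d"
      then have "norm (q y) < e" using small d(2) by simp
      then show "dist (q y) (q z) < e" using z by (simp add: q_def dist_norm)
    qed (fact d(1))
  qed
  show thesis
  proof (rule that)
    show "continuous_on UNIV q"
      unfolding continuous_on_eq_continuous_at[OF open_UNIV]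
      using cont_in cont_out K(2) by (metis ComplI continuous_on_eq_continuous_at open_Compl)
    show "\<And>z. (q z = 0) = (z \<in> path_image g)" using q0 by (simp add: K_def)
    show "inj_on q (- path_image g)"
    proof (rule inj_onI)
      fix y z assume "y \<in> - path_image g" "z \<in> - path_image g" and eq: "q y = q z"
      then have yz: "y \<notin> K" "z \<notin> K" by (auto simp: K_def)
      then have "h (f y) = h (f z)" using eq by (simp add: q_def)
      then have "f y = f z" using inj_onD[OF injh] fW yz by blast
      then show "y = z" using inj_onD[OF injf] yz K(4) by blast
    qed
  qed
qed

section \<open>Planarity of quotients by connected classes\<close>

lemma planar_iff_arc_drawing: "planar V E \<longleftrightarrow> (\<exists>p \<gamma>. arc_drawing V E p \<gamma>)"
  unfolding planar_def arc_drawing_def ..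

lemma planar_subgraph:
  assumes "planar V E" "V' \<subseteq> V" "\<And>u v. E' u v \<Longrightarrow> E u v"
  shows "planar V' E'"
proof -
  obtain p \<gamma> where "arc_drawing V E p \<gamma>"
    using assms(1) planar_iff_arc_drawing by blast
  then have "arc_drawing V' E' p \<gamma>"
    using assms(2,3) unfolding arc_drawing_def by (meson inj_on_subset subsetD)
  then show ?thesis using planar_iff_arc_drawing by blast
qed

definition quotient_graph :: "('a \<Rightarrow> 'b) \<Rightarrow> ('a \<Rightarrow> 'a \<Rightarrow> bool) \<Rightarrow> 'b \<Rightarrow> 'b \<Rightarrow> bool" where
  "quotient_graph f E x y \<longleftrightarrow> x \<noteq> y \<and> (\<exists>s t. E s t \<and> f s = x \<and> f t = y)"

text \<open>This is what makes the quotient a contraction. The class need not be named: every step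
  of the path preserves \<open>f\<close>, so the path stays in one class.\<close>

definition connected_fibres :: "'a set \<Rightarrow> ('a \<Rightarrow> 'a \<Rightarrow> bool) \<Rightarrow> ('a \<Rightarrow> 'b) \<Rightarrow> bool" where
  "connected_fibres V E f \<longleftrightarrow>
     (\<forall>x\<in>V. \<forall>y\<in>V. f x = f y \<longrightarrow> (\<lambda>s t. E s t \<and> f s = f t)\<^sup>*\<^sup>* x y)"

text \<open>Collapse the arc of \<open>u v\<close> to a point. Every representative of a surviving
  edge shares at most one end with that arc and no other point, so the collapsing map remains
  injective on it and distinct edges acquire no common point except the merged vertex.\<close>

lemma planar_contract_edge:
  assumes pl: "planar V E" and uv: "E u v"
  defines "r \<equiv> (\<lambda>w. if w = v then u else w)"
  shows "planar (V - {v}) (quotient_graph r E)"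
proof -
  obtain p \<gamma> where D: "arc_drawing V E p \<gamma>"
    using pl planar_iff_arc_drawing by blast
  have pinj: "p s = p t \<Longrightarrow> s = t" if "s \<in> V" "t \<in> V" for s t
    using D that unfolding arc_drawing_def inj_on_def by auto
  have ar: "arc (\<gamma> s t)" "pathstart (\<gamma> s t) = p s" "pathfinish (\<gamma> s t) = p t" if "E s t" for s t
    using D that unfolding arc_drawing_def by auto
  define I where "I s t = path_image (\<gamma> s t)" for s t
  have vI: "k = s \<or> k = t" if "E s t" "k \<in> V" "p k \<in> I s t" for s t k
    using D that unfolding arc_drawing_def I_def by blast
  have II: "z \<in> p ` ({s,t} \<inter> {s',t'})" if "E s t" "E s' t'" "{s,t} \<noteq> {s',t'}" "z \<in> I s t" "z \<in> I s' t'" for s t s' t' z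
  proof -
    have "I s t \<inter> I s' t' \<subseteq> p ` ({s,t} \<inter> {s',t'})"
      using D that(1-3) unfolding arc_drawing_def I_def by blast
    then show ?thesis using that(4,5) by blast
  qed
  define K where "K = I u v"
  obtain q :: "complex \<Rightarrow> complex" where q: "continuous_on UNIV q" "\<And>z. q z = 0 \<longleftrightarrow> z \<in> K" "inj_on q (- K)"
    by (rule arc_collapse[OF ar(1)[OF uv], folded I_def, folded K_def]) (rule that)
  have puv: "p u \<in> K" "p v \<in> K"
    using ar[OF uv] unfolding K_def I_def by (metis pathstart_in_path_image, metis pathfinish_in_path_image)
  have vK: "k = u \<or> k = v" if "k \<in> V" "p k \<in> K" for k
    using vI[OF uv] that unfolding K_def by blast
  have qeq: "z = z' \<or> z \<in> K \<and> z' \<in> K" if "q z = q z'" for z z'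
    using that q(2)[of z] q(2)[of z'] inj_onD[OF q(3), of z z'] by auto
  \<comment> \<open>Several edges may become the same quotient edge; one representative is chosen
    for each ordered pair.\<close>
  define s t where "s x y = fst (SOME e. E (fst e) (snd e) \<and> r (fst e) = x \<and> r (snd e) = y)"
    and "t x y = snd (SOME e. E (fst e) (snd e) \<and> r (fst e) = x \<and> r (snd e) = y)" for x y
  have st: "E (s x y) (t x y)" "r (s x y) = x" "r (t x y) = y" "x \<noteq> y"
    if xy: "quotient_graph r E x y" for x y
  proof -
    have "\<exists>e. E (fst e) (snd e) \<and> r (fst e) = x \<and> r (snd e) = y"
      using xy unfolding quotient_graph_def by auto
    from someI_ex[OF this] show "E (s x y) (t x y)" "r (s x y) = x" "r (t x y) = y"
      unfolding s_def t_def by auto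
    show "x \<noteq> y" using xy unfolding quotient_graph_def by blast
  qed
  define \<gamma>' where "\<gamma>' x y = q \<circ> \<gamma> (s x y) (t x y)" for x y
  have meetK: "\<exists>m\<in>{s x y, t x y} \<inter> {u, v}. z = p m" if "quotient_graph r E x y" "z \<in> I (s x y) (t x y)" "z \<in> K" for x y z
  proof -
    have "{s x y, t x y} \<noteq> {u, v}"
      using st[OF that(1)] by (auto simp: r_def doubleton_eq_iff split: if_splits)
    from II[OF st(1)[OF that(1)] uv this that(2)] that(3) show ?thesis
      unfolding K_def by blast
  qed
  have inj: "inj_on q (I (s x y) (t x y))" if xy: "quotient_graph r E x y" for x y
  proof (rule inj_onI)
    fix z z' assume z: "z \<in> I (s x y) (t x y)" "z' \<in> I (s x y) (t x y)" "q z = q z'"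
    show "z = z'"
    proof (rule ccontr)
      assume "z \<noteq> z'"
      then have "z \<in> K" "z' \<in> K" using qeq z(3) by blast+
      then obtain m m' where "m \<in> {s x y, t x y} \<inter> {u, v}" "m' \<in> {s x y, t x y} \<inter> {u, v}" "z = p m" "z' = p m'"
        using meetK[OF xy] z by meson
      then show False using \<open>z \<noteq> z'\<close> st[OF xy] by (auto simp: r_def split: if_splits)
    qed
  qed
  have rq: "q (p (r k)) = q (p k)" for k
    using q(2)[of "p u"] q(2)[of "p v"] puv by (auto simp: r_def)
  have Kr: "r m = u" if "m \<in> {u,v}" for m using that by (auto simp: r_def)
  have "arc_drawing (V - {v}) (quotient_graph r E) (q \<circ> p) \<gamma>'"
    unfolding arc_drawing_def
  proof (intro conjI allI impI)
    show "inj_on (q \<circ> p) (V - {v})"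
    proof (rule inj_onI)
      fix k l assume "k \<in> V - {v}" "l \<in> V - {v}" "(q \<circ> p) k = (q \<circ> p) l"
      then show "k = l" using qeq[of "p k" "p l"] pinj vK by auto
    qed
  next
    fix x y assume xy: "quotient_graph r E x y"
    note a = ar[OF st(1)[OF xy]]
    show "arc (\<gamma>' x y)"
      unfolding \<gamma>'_def using a(1) inj[OF xy] path_continuous_image[of "\<gamma> (s x y) (t x y)" q]
        continuous_on_subset[OF q(1)] by (auto simp: arc_def I_def comp_inj_on path_image_def)
    show "pathstart (\<gamma>' x y) = (q \<circ> p) x" "pathfinish (\<gamma>' x y) = (q \<circ> p) y"
      using a st[OF xy] rq[of "s x y"] rq[of "t x y"] by (auto simp: \<gamma>'_def pathstart_compose pathfinish_compose)
  next
    fix x y w assume "quotient_graph r E x y \<and> w \<in> V - {v} \<and> (q \<circ> p) w \<in> path_image (\<gamma>' x y)"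
    then have xy: "quotient_graph r E x y" and w: "w \<in> V" "w \<noteq> v"
      and "q (p w) \<in> q ` I (s x y) (t x y)"
      by (auto simp: \<gamma>'_def path_image_compose I_def)
    then obtain z where z: "z \<in> I (s x y) (t x y)" "q (p w) = q z" by auto
    show "w = x \<or> w = y"
    proof (cases "z \<in> K")
      case True
      then have "p w \<in> K" using z(2) q(2) by metis
      then have "w = u" using vK w by blast
      moreover obtain m where "m \<in> {s x y, t x y} \<inter> {u, v}" using meetK[OF xy z(1) True] by blast
      ultimately show ?thesis using st[OF xy] Kr[of m] by auto
    next
      case False
      then have "p w = z" using qeq[OF z(2)] by blast
      then have "w = s x y \<or> w = t x y" using vI[OF st(1)[OF xy] w(1)] z(1) by blast
      moreover have "r w = w" using w by (simp add: r_def)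
      ultimately show ?thesis using st[OF xy] by metis
    qed
  next
    fix x y x' y' assume "quotient_graph r E x y \<and> quotient_graph r E x' y' \<and> {x, y} \<noteq> {x', y'}"
    then have xy: "quotient_graph r E x y" and xy': "quotient_graph r E x' y'" and ne: "{x, y} \<noteq> {x', y'}"
      by auto
    show "path_image (\<gamma>' x y) \<inter> path_image (\<gamma>' x' y') \<subseteq> (q \<circ> p) ` ({x, y} \<inter> {x', y'})"
    proof
      fix e assume "e \<in> path_image (\<gamma>' x y) \<inter> path_image (\<gamma>' x' y')"
      then obtain z z' where z: "z \<in> I (s x y) (t x y)" "z' \<in> I (s x' y') (t x' y')" "e = q z" "e = q z'"
        by (auto simp: \<gamma>'_def path_image_compose I_def)
      have ne': "{s x y, t x y} \<noteq> {s x' y', t x' y'}"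
        using ne st[OF xy] st[OF xy'] by (metis doubleton_eq_iff)
      show "e \<in> (q \<circ> p) ` ({x, y} \<inter> {x', y'})"
      proof (cases "z \<in> K")
        case True
        then have "z' \<in> K" using z q(2) by metis
        obtain m where "m \<in> {s x y, t x y} \<inter> {u, v}" using meetK[OF xy z(1) True] by blast
        moreover obtain m' where "m' \<in> {s x' y', t x' y'} \<inter> {u, v}" using meetK[OF xy' z(2) \<open>z' \<in> K\<close>] by blast
        ultimately have "u \<in> {x, y} \<inter> {x', y'}"
          using st[OF xy] st[OF xy'] Kr[of m] Kr[of m'] by auto
        moreover have "e = q (p u)" using True z puv q(2) by metis
        ultimately show ?thesis by auto
      next
        case False
        then have "z = z'" using qeq[of z z'] z by auto
        then obtain m where m: "m \<in> {s x y, t x y} \<inter> {s x' y', t x' y'}" "z = p m"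
          using II[OF st(1)[OF xy] st(1)[OF xy'] ne' z(1)] z(2) by blast
        then have "r m \<in> {x, y} \<inter> {x', y'}" using st[OF xy] st[OF xy'] by auto
        moreover have "e = q (p (r m))" using m z rq by simp
        ultimately show ?thesis by auto
      qed
    qed
  qed
  then show ?thesis using planar_iff_arc_drawing by blast
qed

lemma planar_quotient_inj:
  assumes G: "simple_graph V E" and pl: "planar V E" and f: "inj_on f V"
  shows "planar (f ` V) (quotient_graph f E)"
proof -
  obtain p \<gamma> where D: "arc_drawing V E p \<gamma>"
    using pl planar_iff_arc_drawing by blast
  define h where "h = inv_into V f"
  have h: "h (f x) = x" if "x \<in> V" for x using f that by (simp add: h_def)
  have Q: "\<exists>s t. E s t \<and> s \<in> V \<and> t \<in> V \<and> x = f s \<and> y = f t" if "quotient_graph f E x y" for x y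
    using that G unfolding quotient_graph_def simple_graph_def by blast
  have "arc_drawing (f ` V) (quotient_graph f E) (p \<circ> h) (\<lambda>x y. \<gamma> (h x) (h y))"
    unfolding arc_drawing_def
  proof (intro conjI allI impI)
    show "inj_on (p \<circ> h) (f ` V)"
      using D h unfolding arc_drawing_def inj_on_def by auto
  next
    fix x y assume "quotient_graph f E x y"
    from Q[OF this] show "arc (\<gamma> (h x) (h y))" "pathstart (\<gamma> (h x) (h y)) = (p \<circ> h) x"
      "pathfinish (\<gamma> (h x) (h y)) = (p \<circ> h) y"
      using D h unfolding arc_drawing_def by auto
  next
    fix x y w assume "quotient_graph f E x y \<and> w \<in> f ` V \<and> (p \<circ> h) w \<in> path_image (\<gamma> (h x) (h y))"
    with Q[of x y] obtain s t k where st: "E s t" "s \<in> V" "t \<in> V" "k \<in> V" "x = f s" "y = f t" "w = f k"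
      "p k \<in> path_image (\<gamma> s t)" using h by auto
    then have "k = s \<or> k = t" using D unfolding arc_drawing_def by blast
    then show "w = x \<or> w = y" using st by auto
  next
    fix x y x' y' assume A: "quotient_graph f E x y \<and> quotient_graph f E x' y' \<and> {x, y} \<noteq> {x', y'}"
    with Q[of x y] Q[of x' y'] obtain s t s' t' where st: "E s t" "s \<in> V" "t \<in> V" "x = f s" "y = f t"
       "E s' t'" "s' \<in> V" "t' \<in> V" "x' = f s'" "y' = f t'" by blast
    then have "{s, t} \<noteq> {s', t'}" using A by (auto simp: doubleton_eq_iff)
    then have "path_image (\<gamma> s t) \<inter> path_image (\<gamma> s' t') \<subseteq> p ` ({s, t} \<inter> {s', t'})"
      using D st unfolding arc_drawing_def by blast
    also have "\<dots> \<subseteq> (p \<circ> h) ` ({x, y} \<inter> {x', y'})"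
    proof
      fix z assume "z \<in> p ` ({s, t} \<inter> {s', t'})"
      then obtain m where m: "m \<in> {s, t}" "m \<in> {s', t'}" "z = p m" by blast
      then have "f m \<in> {x, y} \<inter> {x', y'}" "h (f m) = m" using st h by auto
      then show "z \<in> (p \<circ> h) ` ({x, y} \<inter> {x', y'})" using m(3) by (metis comp_apply imageI)
    qed
    finally show "path_image (\<gamma> (h x) (h y)) \<inter> path_image (\<gamma> (h x') (h y')) \<subseteq> (p \<circ> h) ` ({x, y} \<inter> {x', y'})"
      using st h by simp
  qed
  then show ?thesis using planar_iff_arc_drawing by blast
qed

text \<open>Induction on the number of vertices: a class with two elements contains an edge, which
  can be contracted without changing the final quotient. Once \<open>f\<close> is injective, only a
  renaming remains.\<close>

lemma planar_quotient:
  fixes f :: "'a \<Rightarrow> 'b"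
  assumes "simple_graph V E" "planar V E" "connected_fibres V E f"
  shows "planar (f ` V) (quotient_graph f E)"
  using assms
proof (induction "card V" arbitrary: V E rule: less_induct)
  case less
  note G = \<open>simple_graph V E\<close>
  show ?case
  proof (cases "inj_on f V")
    case True
    then show ?thesis using planar_quotient_inj less.prems by blast
  next
    case False
    then obtain u y where "u \<in> V" "y \<in> V" "u \<noteq> y" "f u = f y" unfolding inj_on_def by blast
    then have "(\<lambda>s t. E s t \<and> f s = f t)\<^sup>*\<^sup>* u y"
      using less.prems(3) unfolding connected_fibres_def by blast
    then obtain v where v: "E u v" "f u = f v"
      using \<open>u \<noteq> y\<close> by (cases rule: converse_rtranclpE) auto
    have V: "finite V" "\<And>s t. E s t \<Longrightarrow> s \<in> V \<and> t \<in> V \<and> s \<noteq> t" "\<And>s t. E s t \<Longrightarrow> E t s"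
      using G unfolding simple_graph_def by auto
    define r where "r = (\<lambda>w. if w = v then u else w)"
    define E1 where "E1 = quotient_graph r E"
    have fr: "f (r w) = f w" for w using v by (simp add: r_def)
    have uv: "u \<in> V - {v}" "v \<in> V" using V(2)[OF v(1)] by auto
    have rV: "r w \<in> V - {v}" if "w \<in> V" for w using that uv by (simp add: r_def)
    have "simple_graph (V - {v}) E1"
      unfolding simple_graph_def E1_def quotient_graph_def using V rV by blast
    moreover have "planar (V - {v}) E1"
      unfolding E1_def r_def using planar_contract_edge[OF less.prems(2) v(1)] .
    moreover have "connected_fibres (V - {v}) E1 f"
      unfolding connected_fibres_def
    proof (intro ballI impI)
      fix x y assume xy: "x \<in> V - {v}" "y \<in> V - {v}" "f x = f y"
      then have "(\<lambda>s t. E s t \<and> f s = f t)\<^sup>*\<^sup>* x y"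
        using less.prems(3) unfolding connected_fibres_def by blast
      \<comment> \<open>Project the path by \<open>r\<close>: a step whose ends are merged
        disappears, any other becomes a step of \<open>E1\<close>.\<close>
      then have "(\<lambda>s t. E1 s t \<and> f s = f t)\<^sup>*\<^sup>* (r x) (r y)"
      proof (induction rule: rtranclp_induct)
        case (step y z)
        show ?case
        proof (cases "r y = r z")
          case False
          then have "E1 (r y) (r z) \<and> f (r y) = f (r z)"
            using step.hyps(2) fr unfolding E1_def quotient_graph_def by metis
          then show ?thesis using step.IH by (rule rtranclp.rtrancl_into_rtrancl[rotated])
        qed (use step.IH in simp)
      qed simp
      then show "(\<lambda>s t. E1 s t \<and> f s = f t)\<^sup>*\<^sup>* x y"
        using xy by (simp add: r_def)
    qed
    moreover have "card (V - {v}) < card V"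
      using V(1) uv by (meson card_Diff1_less)
    ultimately have "planar (f ` (V - {v})) (quotient_graph f E1)"
      using less.hyps by blast
    moreover have "f ` (V - {v}) = f ` V"
      using uv v(2) by (metis (no_types, lifting) image_insert insertI1 insert_Diff insert_absorb image_eqI insert_iff)
    moreover have "quotient_graph f E1 = quotient_graph f E"
    proof (intro ext iffI)
      fix a b assume "quotient_graph f E1 a b"
      then show "quotient_graph f E a b" unfolding E1_def quotient_graph_def using fr by metis
    next
      fix a b assume "quotient_graph f E a b"
      then show "quotient_graph f E1 a b" unfolding E1_def quotient_graph_def using fr by metis
    qed
    ultimately show ?thesis by simp
  qed
qed

definition connected_on :: "('a \<Rightarrow> 'a \<Rightarrow> bool) \<Rightarrow> 'a set \<Rightarrow> bool" where
  "connected_on E S \<longleftrightarrow> (\<forall>x\<in>S. \<forall>y\<in>S. (\<lambda>s t. E s t \<and> s \<in> S \<and> t \<in> S)\<^sup>*\<^sup>* x y)"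

text \<open>Delete all vertices outside the branch sets and contract by the index of the branch set;
  the quotient is the complete graph on the numbers below 5. Nonemptiness of the sets follows from
  their adjacencies.\<close>

lemma no_K5_minor:
  fixes S :: "nat \<Rightarrow> 'a set"
  assumes G: "simple_graph V E" and pl: "planar V E"
    and S: "\<And>i. i < 5 \<Longrightarrow> S i \<subseteq> V \<and> connected_on E (S i)"
    and disj: "\<And>i j. i < 5 \<Longrightarrow> j < 5 \<Longrightarrow> i \<noteq> j \<Longrightarrow> S i \<inter> S j = {}"
    and adj: "\<And>i j. i < j \<Longrightarrow> j < 5 \<Longrightarrow> \<exists>x\<in>S i. \<exists>y\<in>S j. E x y"
  shows False
proof -
  define U where "U = (\<Union>i<5. S i)"
  define E0 where "E0 s t \<longleftrightarrow> E s t \<and> s \<in> U \<and> t \<in> U" for s t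
  have UV: "U \<subseteq> V" unfolding U_def using S by blast
  define f where "f x = (SOME i. i < 5 \<and> x \<in> S i)" for x
  have fS: "f x = i" if "i < 5" "x \<in> S i" for i x
  proof -
    have "f x < 5 \<and> x \<in> S (f x)" unfolding f_def by (rule someI[of _ i]) (use that in auto)
    then show ?thesis using disj[of "f x" i] that by blast
  qed
  have symE: "E s t \<Longrightarrow> E t s" for s t using G unfolding simple_graph_def by blast
  have ne: "S i \<noteq> {}" if "i < 5" for i
    using adj[of i 4] adj[of 0 i] that by (cases "i = 4") fastforce+
  have "simple_graph U E0"
    using G UV unfolding simple_graph_def E0_def by (auto intro: finite_subset)
  moreover have "planar U E0"
    by (rule planar_subgraph[OF pl UV]) (simp add: E0_def)
  moreover have "connected_fibres U E0 f"
    unfolding connected_fibres_def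
  proof (intro ballI impI)
    fix x y assume "x \<in> U" "y \<in> U" and f: "f x = f y"
    then obtain i where i: "i < 5" "x \<in> S i" "y \<in> S i" unfolding U_def using fS by (metis UN_E lessThan_iff)
    then have "(\<lambda>s t. E s t \<and> s \<in> S i \<and> t \<in> S i)\<^sup>*\<^sup>* x y"
      using S unfolding connected_on_def by blast
    then show "(\<lambda>s t. E0 s t \<and> f s = f t)\<^sup>*\<^sup>* x y"
      by (rule rtranclp_mono[THEN predicate2D, rotated])
         (use i(1) fS in \<open>auto simp: E0_def U_def\<close>)
  qed
  ultimately have "planar (f ` U) (quotient_graph f E0)"
    by (rule planar_quotient)
  moreover have "f ` U = {..<5}"
    unfolding U_def using fS ne by (fastforce simp: image_iff)
  moreover have "quotient_graph f E0 = (\<lambda>i j. i < 5 \<and> j < 5 \<and> i \<noteq> j)"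
  proof (intro ext iffI)
    fix i j assume "quotient_graph f E0 i j"
    then show "i < 5 \<and> j < 5 \<and> i \<noteq> j"
      using fS unfolding quotient_graph_def E0_def U_def by auto
  next
    fix i j :: nat assume ij: "i < 5 \<and> j < 5 \<and> i \<noteq> j"
    then obtain x y where xy: "x \<in> S i" "y \<in> S j" "E x y"
      using adj[of i j] adj[of j i] symE by (metis linorder_neqE_nat)
    then have "E0 x y" using ij unfolding E0_def U_def by blast
    then show "quotient_graph f E0 i j"
      unfolding quotient_graph_def using fS xy ij by blast
  qed
  ultimately show False
    using no_arc_drawing_K5 planar_iff_arc_drawing by metis
qed

section \<open>Minimal counterexamples\<close>

lemma connected_on_singleton [simp]: "connected_on E {x}"
  by (simp add: connected_on_def)

lemma connected_on_Un:
  assumes "connected_on E S" "connected_on E T" "x \<in> S" "y \<in> T" "E x y" "\<And>s t. E s t \<Longrightarrow> E t s"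
  shows "connected_on E (S \<union> T)"
proof -
  let ?R = "\<lambda>s t. E s t \<and> s \<in> S \<union> T \<and> t \<in> S \<union> T"
  have "?R\<^sup>*\<^sup>* s t" if "s \<in> S" "t \<in> S" for s t
  proof -
    have "(\<lambda>s t. E s t \<and> s \<in> S \<and> t \<in> S)\<^sup>*\<^sup>* s t" using assms(1) that by (simp add: connected_on_def)
    then show ?thesis by (rule rtranclp_mono[THEN predicate2D, rotated]) auto
  qed
  moreover have "?R\<^sup>*\<^sup>* s t" if "s \<in> T" "t \<in> T" for s t
  proof -
    have "(\<lambda>s t. E s t \<and> s \<in> T \<and> t \<in> T)\<^sup>*\<^sup>* s t" using assms(2) that by (simp add: connected_on_def)
    then show ?thesis by (rule rtranclp_mono[THEN predicate2D, rotated]) auto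
  qed
  moreover have "?R x y" "?R y x" using assms by auto
  ultimately show ?thesis
    unfolding connected_on_def using assms(3,4)
    by (metis (no_types, lifting) Un_iff rtranclp.rtrancl_into_rtrancl rtranclp_trans)
qed

lemma connected_on_insert:
  assumes "connected_on E S" "y \<in> S" "E x y" "\<And>s t. E s t \<Longrightarrow> E t s"
  shows "connected_on E (insert x S)"
  using connected_on_Un[OF connected_on_singleton[of E x] assms(1) _ assms(2,3,4)] by simp

lemma connected_on_component:
  assumes sym: "\<And>s t. E s t \<Longrightarrow> E t s" and R: "\<And>s t. R s t \<Longrightarrow> E s t" "\<And>s t. R s t \<Longrightarrow> R t s"
  shows "connected_on E {z. R\<^sup>*\<^sup>* w z}"
proof -
  let ?X = "{z. R\<^sup>*\<^sup>* w z}"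
  let ?Q = "\<lambda>s t. E s t \<and> s \<in> ?X \<and> t \<in> ?X"
  have 1: "?Q\<^sup>*\<^sup>* w z" if "R\<^sup>*\<^sup>* w z" for z
    using that
  proof (induction rule: rtranclp_induct)
    case (step y z)
    then have "?Q y z" using R(1) by (auto intro: rtranclp.rtrancl_into_rtrancl)
    then show ?case using step.IH by (rule rtranclp.rtrancl_into_rtrancl[rotated])
  qed simp
  have "symp ?Q" using sym by (auto intro!: sympI)
  from sympD[OF symp_rtranclp[OF this] 1] have 2: "?Q\<^sup>*\<^sup>* z w" if "R\<^sup>*\<^sup>* w z" for z
    using that by simp
  show ?thesis
    unfolding connected_on_def
  proof (intro ballI)
    fix y z assume "y \<in> ?X" "z \<in> ?X"
    then have "?Q\<^sup>*\<^sup>* y w" "?Q\<^sup>*\<^sup>* w z" using 1 2 by simp_all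
    then show "?Q\<^sup>*\<^sup>* y z" by (rule rtranclp_trans)
  qed
qed

text \<open>Frees \<open>u\<close> to be a branch set of its own while the rest of the chain stays
  connected, contains \<open>w\<close> and is adjacent to \<open>u\<close>. \<open>P'\<close> is the
  component of \<open>w\<close> after removing \<open>u\<close>; a path from \<open>w\<close> to
  \<open>u\<close> must enter \<open>u\<close> from it.\<close>

lemma connected_on_split:
  assumes "connected_on E P" "u \<in> P" "w \<in> P" "u \<noteq> w" and sym: "\<And>s t. E s t \<Longrightarrow> E t s"
  obtains P' y where "connected_on E P'" "P' \<subseteq> P - {u}" "w \<in> P'" "y \<in> P'" "E u y"
proof -
  define R where "R s t \<longleftrightarrow> E s t \<and> s \<in> P - {u} \<and> t \<in> P - {u}" for s t
  define P' where "P' = {z. R\<^sup>*\<^sup>* w z}"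
  have "connected_on E P'"
    unfolding P'_def by (rule connected_on_component) (auto simp: R_def sym)
  moreover have sub: "P' \<subseteq> P - {u}"
  proof
    fix z assume "z \<in> P'"
    then have "R\<^sup>*\<^sup>* w z" by (simp add: P'_def)
    then show "z \<in> P - {u}"
      by (cases rule: rtranclp.cases) (use assms(3,4) in \<open>auto simp: R_def\<close>)
  qed
  moreover have "w \<in> P'" by (simp add: P'_def)
  moreover have "\<exists>y\<in>P'. E u y"
  proof -
    have "z \<in> P' \<or> (\<exists>y\<in>P'. E u y)" if "(\<lambda>s t. E s t \<and> s \<in> P \<and> t \<in> P)\<^sup>*\<^sup>* w z" for z
      using that
    proof (induction rule: rtranclp_induct)
      case (step y z)
      then show ?case
      proof (elim disjE)
        assume "y \<in> P'"
        show ?thesis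
        proof (cases "z = u")
          case True
          then show ?thesis using step.hyps(2) \<open>y \<in> P'\<close> sym by blast
        next
          case False
          then have "R y z" using step.hyps(2) \<open>y \<in> P'\<close> sub by (auto simp: R_def)
          then show ?thesis using \<open>y \<in> P'\<close> by (auto simp: P'_def intro: rtranclp.rtrancl_into_rtrancl)
        qed
      qed simp
    qed (simp add: P'_def)
    from this[of u] have "u \<in> P' \<or> (\<exists>y\<in>P'. E u y)"
      using assms unfolding connected_on_def by blast
    then show ?thesis using sub by blast
  qed
  ultimately show thesis using that by blast
qed

section \<open>Colourings obtained from proper contractions\<close>

lemma fourth_colour: "\<exists>k<4. k \<noteq> x \<and> k \<noteq> y \<and> k \<noteq> (z::nat)"
proof -
  have "card {x,y,z} \<le> 3" by (simp add: card_insert_if)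
  then have "\<not> {..<4} \<subseteq> {x,y,z}" using card_mono[of "{x,y,z}" "{..<4}"] by auto
  then show ?thesis by auto
qed

text \<open>The fourth colour is sent to the fourth colour; values at arguments from 4 on are
  immaterial. This serves to glue two colourings along a triangle and to rename colours.\<close>

lemma colour_permutation:
  fixes p1 p2 p3 q1 q2 q3 :: nat
  assumes "p1 < 4" "p2 < 4" "p3 < 4" "q1 < 4" "q2 < 4" "q3 < 4"
    and "p1 \<noteq> p2" "p1 \<noteq> p3" "p2 \<noteq> p3" "q1 \<noteq> q2" "q1 \<noteq> q3" "q2 \<noteq> q3"
  shows "\<exists>\<pi> :: nat \<Rightarrow> nat. \<pi> p1 = q1 \<and> \<pi> p2 = q2 \<and> \<pi> p3 = q3 \<and>
    (\<forall>i<4. \<pi> i < 4) \<and> (\<forall>i<4. \<forall>j<4. i \<noteq> j \<longrightarrow> \<pi> i \<noteq> \<pi> j)"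
proof -
  have ex: "\<exists>r<4. r \<noteq> a \<and> r \<noteq> b \<and> r \<noteq> c \<and> (\<forall>i<4. i = a \<or> i = b \<or> i = c \<or> i = r)"
    if "a < 4" "b < 4" "c < 4" "a \<noteq> b" "a \<noteq> c" "b \<noteq> c" for a b c :: nat
  proof -
    have "card ({..<4} - {a,b,c}) = 1"
      using that by (subst card_Diff_subset) auto
    then obtain r where "{..<4} - {a,b,c} = {r}" by (auto simp: card_1_singleton_iff)
    then show ?thesis by (intro exI[of _ r]) blast
  qed
  obtain p4 where p4: "p4 < 4" "p4 \<noteq> p1" "p4 \<noteq> p2" "p4 \<noteq> p3"
      "\<And>i. i < 4 \<Longrightarrow> i = p1 \<or> i = p2 \<or> i = p3 \<or> i = p4"
    using ex[of p1 p2 p3] assms by auto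
  obtain q4 where q4: "q4 < 4" "q4 \<noteq> q1" "q4 \<noteq> q2" "q4 \<noteq> q3"
    using ex[of q1 q2 q3] assms by auto
  define \<pi> where "\<pi> i = (if i = p1 then q1 else if i = p2 then q2 else if i = p3 then q3 else q4)" for i
  show ?thesis
  proof (intro exI[of _ \<pi>] conjI allI impI)
    fix i j :: nat assume "i < 4" "j < 4" "i \<noteq> j"
    then show "\<pi> i \<noteq> \<pi> j"
      using p4(5)[of i] p4(5)[of j] assms p4 q4 unfolding \<pi>_def by auto
  qed (use assms q4 in \<open>auto simp: \<pi>_def\<close>)
qed

locale minimal_counterexample =
  fixes V :: "'a set" and E :: "'a \<Rightarrow> 'a \<Rightarrow> bool"
  assumes EP: "eMPGN4 V E"
begin

lemma graph: "simple_graph V E" and planarV: "planar V E"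
  using EP by (auto simp: eMPGN4_def N4_def)

lemma finV: "finite V" and EV: "E s t \<Longrightarrow> s \<in> V" "E s t \<Longrightarrow> t \<in> V" "E s t \<Longrightarrow> s \<noteq> t"
  and Esym: "E s t \<Longrightarrow> E t s"
  using graph by (auto simp: simple_graph_def)

lemma connectedV: "connected_on E V"
proof -
  have "E = (\<lambda>s t. E s t \<and> s \<in> V \<and> t \<in> V)" using EV by blast
  then show ?thesis
    using EP unfolding eMPGN4_def N4_def connected_graph_def connected_on_def by metis
qed

lemma not_4_colourable:
  assumes "\<And>v. v \<in> V \<Longrightarrow> h v < (4::nat)" "\<And>u v. E u v \<Longrightarrow> h u \<noteq> h v"
  shows False
  using EP assms unfolding eMPGN4_def N4_def colorable_def by blast

text \<open>Minimality compares only with graphs on \<open>nat\<close>; a finite graph on any type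
  is carried there by an injection, and its colouring is pulled back.\<close>

lemma smaller_colourable:
  fixes V' :: "'b set"
  assumes "simple_graph V' E'" "connected_graph V' E'" "planar V' E'" "card V' < card V"
  shows "colorable 4 V' E'"
proof (rule ccontr)
  assume nc: "\<not> colorable 4 V' E'"
  obtain f :: "'b \<Rightarrow> nat" where f: "inj_on f V'"
    using assms(1) finite_imp_inj_to_nat_seg unfolding simple_graph_def by metis
  let ?E = "quotient_graph f E'"
  have E': "s \<in> V'" "t \<in> V'" "s \<noteq> t" "E' t s" if "E' s t" for s t
    using assms(1) that by (auto simp: simple_graph_def)
  have lift: "?E (f s) (f t)" if "E' s t" for s t
    using that E'[OF that] f unfolding quotient_graph_def inj_on_def by blast
  have "simple_graph (f ` V') ?E"
    using assms(1) E' unfolding simple_graph_def quotient_graph_def by blast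
  moreover have "connected_graph (f ` V') ?E"
  proof -
    have "?E\<^sup>*\<^sup>* (f s) (f t)" if "E'\<^sup>*\<^sup>* s t" for s t
      using that by (induction rule: rtranclp_induct) (auto dest: lift intro: rtranclp.rtrancl_into_rtrancl)
    then show ?thesis using assms(2) unfolding connected_graph_def by auto
  qed
  moreover have "planar (f ` V') ?E" by (rule planar_quotient_inj[OF assms(1,3) f])
  moreover have "\<not> colorable 4 (f ` V') ?E"
  proof
    assume "colorable 4 (f ` V') ?E"
    then obtain c :: "nat \<Rightarrow> nat" where "\<And>v. v \<in> f ` V' \<Longrightarrow> c v < 4" "\<And>u v. ?E u v \<Longrightarrow> c u \<noteq> c v"
      unfolding colorable_def by blast
    then have "colorable 4 V' E'"
      unfolding colorable_def using lift by (intro exI[of _ "c \<circ> f"]) auto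
    then show False using nc by blast
  qed
  ultimately have "card V \<le> card (f ` V')"
    using EP unfolding eMPGN4_def N4_def by blast
  then show False using assms(4) card_image[OF f] by simp
qed

text \<open>The colouring of the smaller quotient is pulled back along \<open>f\<close>. With the
  identity for \<open>f\<close> and a proper connected subset \<open>U\<close> it also covers plain
  deletion of vertices.\<close>

lemma contraction_colouring:
  fixes f :: "'a \<Rightarrow> 'b"
  assumes U: "U \<subseteq> V" "U \<noteq> {}" "connected_on E U"
    and f: "connected_fibres U (\<lambda>s t. E s t \<and> s \<in> U \<and> t \<in> U) f" and card: "card (f ` U) < card V"
  shows "\<exists>g :: 'a \<Rightarrow> nat. (\<forall>x\<in>U. g x < 4) \<and> (\<forall>x y. f x = f y \<longrightarrow> g x = g y) \<and>
    (\<forall>x\<in>U. \<forall>y\<in>U. E x y \<and> f x \<noteq> f y \<longrightarrow> g x \<noteq> g y)"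
proof -
  let ?F = "\<lambda>s t. E s t \<and> s \<in> U \<and> t \<in> U"
  let ?Q = "quotient_graph f ?F"
  have G: "simple_graph U ?F"
    using finite_subset[OF U(1) finV] EV Esym by (auto simp: simple_graph_def)
  have pl: "planar U ?F" by (rule planar_subgraph[OF planarV U(1)]) auto
  have "simple_graph (f ` U) ?Q"
    using G unfolding simple_graph_def quotient_graph_def by blast
  moreover have "connected_graph (f ` U) ?Q"
  proof -
    have "?Q\<^sup>*\<^sup>* (f s) (f t)" if "?F\<^sup>*\<^sup>* s t" for s t
      using that
    proof (induction rule: rtranclp_induct)
      case (step y z)
      then have "f y = f z \<or> ?Q (f y) (f z)" unfolding quotient_graph_def by blast
      then show ?case using step.IH by (auto intro: rtranclp.rtrancl_into_rtrancl)
    qed simp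
    then show ?thesis using U(2,3) unfolding connected_graph_def connected_on_def by auto
  qed
  ultimately have "colorable 4 (f ` U) ?Q"
    using smaller_colourable planar_quotient[OF G pl f] card by blast
  then obtain c :: "'b \<Rightarrow> nat" where c: "\<And>v. v \<in> f ` U \<Longrightarrow> c v < 4" "\<And>u v. ?Q u v \<Longrightarrow> c u \<noteq> c v"
    unfolding colorable_def by blast
  show ?thesis
  proof (intro exI[of _ "c \<circ> f"] conjI ballI allI impI)
    fix x y assume "x \<in> U" "y \<in> U" "E x y \<and> f x \<noteq> f y"
    then show "(c \<circ> f) x \<noteq> (c \<circ> f) y"
      using c(2)[of "f x" "f y"] unfolding quotient_graph_def by auto
  qed (use c in auto)
qed

text \<open>All blocks are contracted at once. The two distinct elements of \<open>B0\<close>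
  guarantee that the number of vertices drops.\<close>

lemma contract_blocks:
  assumes B: "\<And>B. B \<in> \<B> \<Longrightarrow> B \<subseteq> V \<and> connected_on E B"
    and disj: "\<And>B C. B \<in> \<B> \<Longrightarrow> C \<in> \<B> \<Longrightarrow> B \<noteq> C \<Longrightarrow> B \<inter> C = {}"
    and big: "B0 \<in> \<B>" "s0 \<in> B0" "t0 \<in> B0" "s0 \<noteq> t0"
  shows "\<exists>g :: 'a \<Rightarrow> nat. (\<forall>x\<in>V. g x < 4) \<and> (\<forall>B\<in>\<B>. \<forall>x\<in>B. \<forall>y\<in>B. g x = g y) \<and>
    (\<forall>x y. E x y \<and> (\<forall>B\<in>\<B>. x \<in> B \<longrightarrow> y \<notin> B) \<longrightarrow> g x \<noteq> g y)"
proof -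
  \<comment> \<open>A vertex goes to its block or to its own singleton; since \<open>x\<close>
    always belongs to \<open>f x\<close>, equal values force equality or a common block.\<close>
  define f where "f x = (if \<exists>B\<in>\<B>. x \<in> B then (THE B. B \<in> \<B> \<and> x \<in> B) else {x})" for x
  have fB: "f x = B" if "B \<in> \<B>" "x \<in> B" for x B
  proof -
    have "(THE B. B \<in> \<B> \<and> x \<in> B) = B"
    proof (rule the_equality)
      fix C assume "C \<in> \<B> \<and> x \<in> C"
      then show "C = B" using disj[of C B] that by blast
    qed (use that in simp)
    then show ?thesis using that by (auto simp: f_def)
  qed
  have fx: "f x = {x}" if "\<not> (\<exists>B\<in>\<B>. x \<in> B)" for x
    unfolding f_def using that by (rule if_not_P)
  have fin: "x \<in> f x" for x using fB[of _ x] fx[of x] by (cases "\<exists>B\<in>\<B>. x \<in> B") auto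
  have feq: "x = y \<or> (\<exists>B\<in>\<B>. x \<in> B \<and> y \<in> B)" if "f x = f y" for x y
  proof (cases "\<exists>B\<in>\<B>. x \<in> B")
    case True
    then obtain C where "C \<in> \<B>" "x \<in> C" by blast
    moreover from this have "y \<in> C" using that fB fin[of y] by metis
    ultimately show ?thesis by blast
  next
    case False
    then have "y \<in> {x}" using that fx[OF False] fin[of y] by simp
    then show ?thesis by simp
  qed
  have "connected_fibres V (\<lambda>s t. E s t \<and> s \<in> V \<and> t \<in> V) f"
    unfolding connected_fibres_def
  proof (intro ballI impI)
    fix x y assume "f x = f y"
    from feq[OF this] consider "x = y" | C where "C \<in> \<B>" "x \<in> C" "y \<in> C" by blast
    then show "(\<lambda>s t. (E s t \<and> s \<in> V \<and> t \<in> V) \<and> f s = f t)\<^sup>*\<^sup>* x y"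
    proof cases
      case (2 C)
      then have "(\<lambda>s t. E s t \<and> s \<in> C \<and> t \<in> C)\<^sup>*\<^sup>* x y"
        using B unfolding connected_on_def by blast
      then show ?thesis
      proof (rule rtranclp_mono[THEN predicate2D, rotated], intro predicate2I)
        fix s t assume "E s t \<and> s \<in> C \<and> t \<in> C"
        then show "(E s t \<and> s \<in> V \<and> t \<in> V) \<and> f s = f t"
          using B[OF 2(1)] fB[OF 2(1)] by auto
      qed
    qed simp
  qed
  moreover have "V \<noteq> {}" using B[OF big(1)] big(2) by blast
  moreover have "card (f ` V) < card V"
  proof -
    have "f s0 = f t0" using fB big by simp
    then have "\<not> inj_on f V" using big B[OF big(1)] by (meson inj_on_def subsetD)
    then show ?thesis
      using finV by (meson card_image_le eq_card_imp_inj_on le_neq_implies_less)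
  qed
  ultimately have "\<exists>g :: 'a \<Rightarrow> nat. (\<forall>x\<in>V. g x < 4) \<and> (\<forall>x y. f x = f y \<longrightarrow> g x = g y) \<and>
    (\<forall>x\<in>V. \<forall>y\<in>V. E x y \<and> f x \<noteq> f y \<longrightarrow> g x \<noteq> g y)"
    by (intro contraction_colouring connectedV subset_refl)
  then obtain g :: "'a \<Rightarrow> nat" where g0: "\<forall>x\<in>V. g x < 4" and g1: "\<forall>x y. f x = f y \<longrightarrow> g x = g y"
    and g2: "\<forall>x\<in>V. \<forall>y\<in>V. E x y \<and> f x \<noteq> f y \<longrightarrow> g x \<noteq> g y"
    by (elim exE conjE)
  show ?thesis
  proof (intro exI[of _ g] conjI ballI allI impI)
    show "g x < 4" if "x \<in> V" for x using g0 that by simp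
    show "g x = g y" if "C \<in> \<B>" "x \<in> C" "y \<in> C" for C x y
      using g1 by (simp add: fB[OF that(1)] that(2,3))
    show "g x \<noteq> g y" if xy: "E x y \<and> (\<forall>B\<in>\<B>. x \<in> B \<longrightarrow> y \<notin> B)" for x y
    proof -
      have "f x \<noteq> f y" using feq[of x y] xy EV(3)[of x y] by blast
      then show ?thesis using g2 xy EV(1,2)[of x y] by simp
    qed
  qed
qed

lemma contract_block:
  assumes "B \<subseteq> V" "connected_on E B" "s \<in> B" "t \<in> B" "s \<noteq> t"
  shows "\<exists>g :: 'a \<Rightarrow> nat. (\<forall>x\<in>V. g x < 4) \<and> (\<forall>x\<in>B. \<forall>y\<in>B. g x = g y) \<and>
    (\<forall>x y. E x y \<and> (x \<in> B \<longrightarrow> y \<notin> B) \<longrightarrow> g x \<noteq> g y)"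
proof -
  have "\<exists>g :: 'a \<Rightarrow> nat. (\<forall>x\<in>V. g x < 4) \<and> (\<forall>B\<in>{B}. \<forall>x\<in>B. \<forall>y\<in>B. g x = g y) \<and>
    (\<forall>x y. E x y \<and> (\<forall>B\<in>{B}. x \<in> B \<longrightarrow> y \<notin> B) \<longrightarrow> g x \<noteq> g y)"
    by (rule contract_blocks[of _ B s t]) (use assms in simp_all)
  then show ?thesis by simp
qed

lemma no_K5_minor5:
  assumes sub: "A0 \<subseteq> V" "A1 \<subseteq> V" "A2 \<subseteq> V" "A3 \<subseteq> V" "A4 \<subseteq> V"
    and con: "connected_on E A0" "connected_on E A1" "connected_on E A2" "connected_on E A3" "connected_on E A4"
    and disj: "A0 \<inter> A1 = {}" "A0 \<inter> A2 = {}" "A0 \<inter> A3 = {}" "A0 \<inter> A4 = {}" "A1 \<inter> A2 = {}"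
      "A1 \<inter> A3 = {}" "A1 \<inter> A4 = {}" "A2 \<inter> A3 = {}" "A2 \<inter> A4 = {}" "A3 \<inter> A4 = {}"
    and adj: "\<exists>x\<in>A0. \<exists>y\<in>A1. E x y" "\<exists>x\<in>A0. \<exists>y\<in>A2. E x y" "\<exists>x\<in>A0. \<exists>y\<in>A3. E x y"
      "\<exists>x\<in>A0. \<exists>y\<in>A4. E x y" "\<exists>x\<in>A1. \<exists>y\<in>A2. E x y" "\<exists>x\<in>A1. \<exists>y\<in>A3. E x y"
      "\<exists>x\<in>A1. \<exists>y\<in>A4. E x y" "\<exists>x\<in>A2. \<exists>y\<in>A3. E x y" "\<exists>x\<in>A2. \<exists>y\<in>A4. E x y" "\<exists>x\<in>A3. \<exists>y\<in>A4. E x y"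
  shows False
proof (rule no_K5_minor[OF graph planarV])
  let ?S = "\<lambda>i::nat. [A0,A1,A2,A3,A4] ! i"
  have lt: "i < 5 \<longleftrightarrow> i = 0 \<or> i = 1 \<or> i = 2 \<or> i = 3 \<or> i = 4" for i :: nat by auto
  show "?S i \<subseteq> V \<and> connected_on E (?S i)" if "i < 5" for i
    using that sub con unfolding lt by (elim disjE) simp_all
  show "?S i \<inter> ?S j = {}" if "i < 5" "j < 5" "i \<noteq> j" for i j
    using that disj unfolding lt by (elim disjE) (simp_all add: Int_commute)
  show "\<exists>x\<in>?S i. \<exists>y\<in>?S j. E x y" if "i < j" "j < 5" for i j
  proof -
    have "i = 0 \<and> j = 1 \<or> i = 0 \<and> j = 2 \<or> i = 0 \<and> j = 3 \<or> i = 0 \<and> j = 4 \<or> i = 1 \<and> j = 2 \<or>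
      i = 1 \<and> j = 3 \<or> i = 1 \<and> j = 4 \<or> i = 2 \<and> j = 3 \<or> i = 2 \<and> j = 4 \<or> i = 3 \<and> j = 4"
      using that by presburger
    then show ?thesis using adj by (elim disjE conjE; simp)
  qed
qed

text \<open>If the component \<open>A\<close> of \<open>x\<close> off the triangle missed
  \<open>y\<close>, both \<open>A\<close> with the triangle and the graph without \<open>A\<close>
  could be 4-coloured. The three triangle colours are distinct in each colouring, so a permutation
  of colours makes them agree and the union colours everything.\<close>

lemma no_separating_triangle:
  assumes T: "E t1 t2" "E t1 t3" "E t2 t3" and x: "x \<in> V" "E x t1" "x \<notin> {t1,t2,t3}" and y: "y \<in> V" "y \<notin> {t1,t2,t3}"
  obtains P where "connected_on E P" "P \<subseteq> V - {t1,t2,t3}" "x \<in> P" "y \<in> P"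
proof -
  define T where "T = {t1,t2,t3}"
  define R where "R s t \<longleftrightarrow> E s t \<and> s \<notin> T \<and> t \<notin> T" for s t
  define A where "A = {z. R\<^sup>*\<^sup>* x z}"
  have Acon: "connected_on E A"
    unfolding A_def by (rule connected_on_component) (auto simp: R_def Esym)
  have AV: "A \<subseteq> V - T"
  proof
    fix z assume "z \<in> A"
    then have "R\<^sup>*\<^sup>* x z" by (simp add: A_def)
    then show "z \<in> V - T"
      by (cases rule: rtranclp.cases) (use x EV in \<open>auto simp: R_def T_def\<close>)
  qed
  have xA: "x \<in> A" by (simp add: A_def)
  have cl: "t \<in> A \<union> T" if "s \<in> A" "E s t" for s t
  proof (cases "t \<in> T")
    case False
    then have "R s t" using that AV by (auto simp: R_def)
    then show ?thesis using that(1) by (auto simp: A_def intro: rtranclp.rtrancl_into_rtrancl)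
  qed simp
  have TV: "T \<subseteq> V" using T EV by (auto simp: T_def)
  have "y \<in> A"
  proof (rule ccontr)
    assume yA: "y \<notin> A"
    \<comment> \<open>Merging \<open>A\<close> into \<open>t1\<close>, instead of deleting it, keeps
      the graph connected; the vertex count drops because \<open>x\<close> and \<open>t1\<close>
      become one.\<close>
    have At: "connected_on E (insert t1 A)"
      by (rule connected_on_insert[OF Acon xA]) (use x Esym in auto)
    have "\<exists>g :: 'a \<Rightarrow> nat. (\<forall>z\<in>V. g z < 4) \<and> (\<forall>x\<in>insert t1 A. \<forall>y\<in>insert t1 A. g x = g y) \<and>
      (\<forall>x y. E x y \<and> (x \<in> insert t1 A \<longrightarrow> y \<notin> insert t1 A) \<longrightarrow> g x \<noteq> g y)"
      by (rule contract_block[of _ t1 x]) (use At TV AV xA x in \<open>auto simp: T_def\<close>)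
    then obtain g1 :: "'a \<Rightarrow> nat" where "\<forall>z\<in>V. g1 z < 4"
      and g1p: "\<forall>x y. E x y \<and> (x \<in> insert t1 A \<longrightarrow> y \<notin> insert t1 A) \<longrightarrow> g1 x \<noteq> g1 y"
      by (elim exE conjE)
    then have g1: "g1 z < 4" if "z \<in> V" for z using that by simp
    have g1': "g1 u \<noteq> g1 v" if "E u v" "u \<notin> A" "v \<notin> A" for u v
    proof -
      have "E u v \<and> (u \<in> insert t1 A \<longrightarrow> v \<notin> insert t1 A)"
        using that EV(3)[OF that(1)] by auto
      then show ?thesis using g1p[rule_format, of u v] by iprover
    qed
    \<comment> \<open>Since \<open>y\<close> is missing from \<open>A\<close> and the triangle,
      their union spans a smaller graph; connectedness is needed to colour it by minimality.\<close>
    have AT: "connected_on E (insert t3 (insert t2 (insert t1 A)))"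
      using connected_on_insert[OF connected_on_insert[OF At, of t1 t2], of t1 t3] T Esym by auto
    have "\<exists>g :: 'a \<Rightarrow> nat. (\<forall>x\<in>A \<union> T. g x < 4) \<and> (\<forall>x y. x = y \<longrightarrow> g x = g y) \<and>
      (\<forall>x\<in>A \<union> T. \<forall>y\<in>A \<union> T. E x y \<and> x \<noteq> y \<longrightarrow> g x \<noteq> g y)"
    proof (rule contraction_colouring[of "A \<union> T" "\<lambda>x. x"])
      show "A \<union> T \<subseteq> V" using AV TV by auto
      show "connected_on E (A \<union> T)"
        using AT by (simp add: T_def insert_commute Un_commute)
      show "connected_fibres (A \<union> T) (\<lambda>s t. E s t \<and> s \<in> A \<union> T \<and> t \<in> A \<union> T) (\<lambda>x. x)"
        by (simp add: connected_fibres_def)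
      have "A \<union> T \<subset> V" using AV TV yA y by (auto simp: T_def)
      then show "card ((\<lambda>x. x) ` (A \<union> T)) < card V"
        using finV by (simp add: psubset_card_mono)
    qed (use xA in auto)
    then obtain g2 :: "'a \<Rightarrow> nat" where g2a: "\<forall>x\<in>A \<union> T. g2 x < 4"
      and g2b: "\<forall>x\<in>A \<union> T. \<forall>y\<in>A \<union> T. E x y \<and> x \<noteq> y \<longrightarrow> g2 x \<noteq> g2 y"
      by (elim exE conjE)
    have g2: "g2 z < 4" if "z \<in> A \<union> T" for z
      using g2a that by blast
    have g2': "g2 u \<noteq> g2 v" if "u \<in> A \<union> T" "v \<in> A \<union> T" "E u v" for u v
      using g2b that EV(3)[OF that(3)] by blast
    have tT: "t1 \<in> T" "t2 \<in> T" "t3 \<in> T" by (auto simp: T_def)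
    have tA: "t1 \<notin> A" "t2 \<notin> A" "t3 \<notin> A" using AV tT by auto
    have "\<exists>\<pi> :: nat \<Rightarrow> nat. \<pi> (g2 t1) = g1 t1 \<and> \<pi> (g2 t2) = g1 t2 \<and> \<pi> (g2 t3) = g1 t3 \<and>
      (\<forall>i<4. \<pi> i < 4) \<and> (\<forall>i<4. \<forall>j<4. i \<noteq> j \<longrightarrow> \<pi> i \<noteq> \<pi> j)"
    proof (rule colour_permutation[of "g2 t1" "g2 t2" "g2 t3" "g1 t1" "g1 t2" "g1 t3"])
      show "g2 t1 \<noteq> g2 t2" "g2 t1 \<noteq> g2 t3" "g2 t2 \<noteq> g2 t3"
        using g2'[OF _ _ T(1)] g2'[OF _ _ T(2)] g2'[OF _ _ T(3)] tT by blast+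
      show "g1 t1 \<noteq> g1 t2" "g1 t1 \<noteq> g1 t3" "g1 t2 \<noteq> g1 t3"
        using g1'[OF T(1)] g1'[OF T(2)] g1'[OF T(3)] tA by blast+
      show "g2 t1 < 4" "g2 t2 < 4" "g2 t3 < 4" using g2 tT by blast+
      show "g1 t1 < 4" "g1 t2 < 4" "g1 t3 < 4" using g1 tT TV by blast+
    qed
    then obtain \<pi> :: "nat \<Rightarrow> nat" where \<pi>: "\<pi> (g2 t1) = g1 t1" "\<pi> (g2 t2) = g1 t2" "\<pi> (g2 t3) = g1 t3"
      and \<pi>4: "\<forall>i<4. \<pi> i < 4" and \<pi>5: "\<forall>i<4. \<forall>j<4. i \<noteq> j \<longrightarrow> \<pi> i \<noteq> \<pi> j"
      by (elim exE conjE)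
    define h where "h z = (if z \<in> A then \<pi> (g2 z) else g1 z)" for z
    have hT: "h z = \<pi> (g2 z)" if "z \<in> A \<union> T" for z
      using that \<pi> by (auto simp: h_def T_def)
    show False
    proof (rule not_4_colourable[of h])
      show "h v < 4" if "v \<in> V" for v
        using that g1 g2 \<pi>4 by (simp add: h_def)
      fix u v assume uv: "E u v"
      show "h u \<noteq> h v"
      proof (cases "u \<in> A \<or> v \<in> A")
        case True
        then have "u \<in> A \<union> T" "v \<in> A \<union> T" using cl uv Esym by blast+
        then show ?thesis
          using \<pi>5[rule_format, OF g2 g2 g2'[OF _ _ uv]] by (simp add: hT)
      next
        case False
        then show ?thesis using g1'[OF uv] by (simp add: h_def)
      qed
    qed
  qed
  then show thesis using that[OF Acon _ xA] AV by (simp add: T_def)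
qed

text \<open>Contract \<open>v\<close> with three independent neighbours: the only edges inside the
  block are those at \<open>v\<close>, so the colouring is proper away from \<open>v\<close>. The
  three share a colour, hence the five neighbours show at most three colours and one is free for
  \<open>v\<close>. In contrapositive form this produces edges between neighbours.\<close>

lemma no_independent_triple:
  assumes N: "nbrs V E v = {p,q,r,s,t}" and ne: "\<not> E p q" "\<not> E p r" "\<not> E q r" 
  shows False
proof -
  have Ev: "E v z \<longleftrightarrow> z \<in> {p,q,r,s,t}" for z
    using N EV unfolding nbrs_def by blast
  have con: "connected_on E {r,q,p,v}"
    by (intro connected_on_insert[of _ _ v] connected_on_singleton) (use Ev Esym in auto)
  have inV: "{r,q,p,v} \<subseteq> V" "v \<noteq> p"
    using EV(1)[of v p] EV(2)[of v p] EV(2)[of v q] EV(2)[of v r] EV(3)[of v p] Ev by auto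
  have "\<exists>g :: 'a \<Rightarrow> nat. (\<forall>x\<in>V. g x < 4) \<and> (\<forall>x\<in>{r,q,p,v}. \<forall>y\<in>{r,q,p,v}. g x = g y) \<and>
      (\<forall>x y. E x y \<and> (x \<in> {r,q,p,v} \<longrightarrow> y \<notin> {r,q,p,v}) \<longrightarrow> g x \<noteq> g y)"
    by (rule contract_block[of _ v p]) (use con inV in simp_all)
  then obtain g :: "'a \<Rightarrow> nat" where g1: "\<forall>x\<in>V. g x < 4"
     and g2: "\<forall>x\<in>{r,q,p,v}. \<forall>y\<in>{r,q,p,v}. g x = g y"
     and g3: "\<forall>x y. E x y \<and> (x \<in> {r,q,p,v} \<longrightarrow> y \<notin> {r,q,p,v}) \<longrightarrow> g x \<noteq> g y"
    by (elim exE conjE)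
  have eq: "g q = g p" "g r = g p" by (rule g2[rule_format]; simp)+
  obtain k where k: "k < 4" "k \<noteq> g p" "k \<noteq> g s" "k \<noteq> g t"
    using fourth_colour by blast
  show False
  proof (rule not_4_colourable[of "g(v := k)"])
    fix x y assume xy: "E x y"
    consider "x = v" | "y = v" | "x \<noteq> v" "y \<noteq> v" by blast
    then show "(g(v := k)) x \<noteq> (g(v := k)) y"
    proof cases
      case 1
      then show ?thesis using xy Ev k eq EV(3)[OF xy] by auto
    next
      case 2
      then show ?thesis using Esym[OF xy] Ev k eq EV(3)[OF xy] by auto
    next
      case 3
      then have "x \<in> {r,q,p,v} \<longrightarrow> y \<notin> {r,q,p,v}"
        using ne xy Esym[OF xy] EV(3)[OF xy] by auto
      then have "g x \<noteq> g y" using g3 xy by blast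
      then show ?thesis using 3 by simp
    qed
  qed (use g1 k in auto)
qed

section \<open>Kempe chains and switches\<close>

definition partial_colouring :: "'a set \<Rightarrow> ('a \<Rightarrow> nat) \<Rightarrow> bool" where
  "partial_colouring C g \<longleftrightarrow> (\<forall>v\<in>V. g v < 4) \<and> (\<forall>u v. E u v \<and> u \<notin> C \<and> v \<notin> C \<longrightarrow> g u \<noteq> g v)"

definition kempe_chain :: "'a set \<Rightarrow> ('a \<Rightarrow> nat) \<Rightarrow> nat \<Rightarrow> nat \<Rightarrow> 'a \<Rightarrow> 'a set" where
  "kempe_chain C g i j w =
     {z. (\<lambda>s t. E s t \<and> s \<notin> C \<and> t \<notin> C \<and> g s \<in> {i,j} \<and> g t \<in> {i,j})\<^sup>*\<^sup>* w z}"

definition kempe_switch :: "'a set \<Rightarrow> ('a \<Rightarrow> nat) \<Rightarrow> nat \<Rightarrow> nat \<Rightarrow> 'a \<Rightarrow> 'a \<Rightarrow> nat" where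
  "kempe_switch C g i j w z = (if z \<in> kempe_chain C g i j w then (if g z = i then j else i) else g z)"

lemma kempe_chain_props:
  assumes "w \<in> V - C" "g w \<in> {i,j}"
  shows "w \<in> kempe_chain C g i j w" "connected_on E (kempe_chain C g i j w)"
    "kempe_chain C g i j w \<subseteq> V - C" "\<And>z. z \<in> kempe_chain C g i j w \<Longrightarrow> g z = i \<or> g z = j"
    "\<And>s t. s \<in> kempe_chain C g i j w \<Longrightarrow> E s t \<Longrightarrow> t \<notin> C \<Longrightarrow> g t \<in> {i,j} \<Longrightarrow> t \<in> kempe_chain C g i j w"
proof -
  let ?R = "\<lambda>s t. E s t \<and> s \<notin> C \<and> t \<notin> C \<and> g s \<in> {i,j} \<and> g t \<in> {i,j}"
  show "w \<in> kempe_chain C g i j w" by (simp add: kempe_chain_def)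
  show "connected_on E (kempe_chain C g i j w)"
    unfolding kempe_chain_def by (rule connected_on_component) (auto simp: Esym)
  have *: "z \<in> V - C \<and> g z \<in> {i,j}" if "z \<in> kempe_chain C g i j w" for z
  proof -
    have "?R\<^sup>*\<^sup>* w z" using that by (simp add: kempe_chain_def)
    then show ?thesis
      by (cases rule: rtranclp.cases) (use assms EV in auto)
  qed
  then show "kempe_chain C g i j w \<subseteq> V - C" "\<And>z. z \<in> kempe_chain C g i j w \<Longrightarrow> g z = i \<or> g z = j"
    by auto
  fix s t assume s: "s \<in> kempe_chain C g i j w" "E s t" "t \<notin> C" "g t \<in> {i,j}"
  then have "?R s t" using *[OF s(1)] by auto
  then show "t \<in> kempe_chain C g i j w"
    using s(1) by (auto simp: kempe_chain_def intro: rtranclp.rtrancl_into_rtrancl)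
qed

lemma partial_colouring_kempe_switch:
  assumes g: "partial_colouring C g" and w: "w \<in> V - C" "g w \<in> {i,j}" and ij: "i < 4" "j < 4" "i \<noteq> j"
  shows "partial_colouring C (kempe_switch C g i j w)"
proof -
  let ?X = "kempe_chain C g i j w"
  note X = kempe_chain_props[of w C g i j, OF w]
  have 1: "kempe_switch C g i j w u \<noteq> kempe_switch C g i j w v" if "E u v" "u \<notin> C" "v \<notin> C" "u \<in> ?X" for u v
  proof (cases "v \<in> ?X")
    case True
    have "g u \<noteq> g v" using g that unfolding partial_colouring_def by blast
    then show ?thesis using X(4)[OF True] X(4)[OF that(4)] True that(4) ij(3)
      unfolding kempe_switch_def by auto
  next
    case False
    then have "g v \<notin> {i,j}" using X(5)[OF that(4,1,3)] by blast
    then show ?thesis using False that(4) unfolding kempe_switch_def by auto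
  qed
  show ?thesis
    unfolding partial_colouring_def
  proof (intro conjI ballI allI impI)
    fix v assume "v \<in> V" then show "kempe_switch C g i j w v < 4"
      using g ij unfolding partial_colouring_def kempe_switch_def by auto
  next
    fix u v assume uv: "E u v \<and> u \<notin> C \<and> v \<notin> C"
    show "kempe_switch C g i j w u \<noteq> kempe_switch C g i j w v"
    proof (cases "u \<in> ?X \<or> v \<in> ?X")
      case True
      then show ?thesis using 1[of u v] 1[of v u] uv Esym by metis
    next
      case False
      then show ?thesis using uv g unfolding partial_colouring_def kempe_switch_def by auto
    qed
  qed
qed

end

context minimal_counterexample
begin

text \<open>Renaming colours fixes them along a path \<open>p\<close>, \<open>q\<close>,
  \<open>r\<close>, which keeps the later tables small. Since \<open>q\<close> lies in no block,
  both edges of the path join differently coloured vertices.\<close>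

lemma contract_blocks_normalised:
  assumes B: "\<And>B. B \<in> \<B> \<Longrightarrow> B \<subseteq> V \<and> connected_on E B"
    and disj: "\<And>B C. B \<in> \<B> \<Longrightarrow> C \<in> \<B> \<Longrightarrow> B \<noteq> C \<Longrightarrow> B \<inter> C = {}"
    and big: "B0 \<in> \<B>" "s0 \<in> B0" "t0 \<in> B0" "s0 \<noteq> t0"
    and pqr: "E p q" "E q r" "\<And>B. B \<in> \<B> \<Longrightarrow> q \<notin> B"
  shows "\<exists>g :: 'a \<Rightarrow> nat. (\<forall>x\<in>V. g x < 4) \<and> (\<forall>B\<in>\<B>. \<forall>x\<in>B. \<forall>y\<in>B. g x = g y) \<and>
    (\<forall>x y. E x y \<and> (\<forall>B\<in>\<B>. x \<in> B \<longrightarrow> y \<notin> B) \<longrightarrow> g x \<noteq> g y) \<and> g p = 0 \<and> g q = 1 \<and> g r \<in> {0,2}"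
proof -
  have "\<exists>g :: 'a \<Rightarrow> nat. (\<forall>x\<in>V. g x < 4) \<and> (\<forall>B\<in>\<B>. \<forall>x\<in>B. \<forall>y\<in>B. g x = g y) \<and>
    (\<forall>x y. E x y \<and> (\<forall>B\<in>\<B>. x \<in> B \<longrightarrow> y \<notin> B) \<longrightarrow> g x \<noteq> g y)"
    by (rule contract_blocks[OF B disj big])
  then obtain g :: "'a \<Rightarrow> nat" where g1: "\<forall>x\<in>V. g x < 4" and g2: "\<forall>B\<in>\<B>. \<forall>x\<in>B. \<forall>y\<in>B. g x = g y"
    and g3: "\<forall>x y. E x y \<and> (\<forall>B\<in>\<B>. x \<in> B \<longrightarrow> y \<notin> B) \<longrightarrow> g x \<noteq> g y"
    by (elim exE conjE)
  have V: "g p < 4" "g q < 4" "g r < 4" using g1 EV pqr(1,2) by blast+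
  have pq: "g p \<noteq> g q" and qr: "g q \<noteq> g r" using g3 pqr by blast+
  have "\<exists>k<4. k \<noteq> g p \<and> k \<noteq> g q \<and> (g r = g p \<or> k = g r)"
  proof (cases "g r = g p")
    case True
    then show ?thesis using fourth_colour[of "g p" "g q" "g q"] by blast
  next
    case False
    then show ?thesis using V qr by (intro exI[of _ "g r"]) simp
  qed
  then obtain k where k: "k < 4" "k \<noteq> g p" "k \<noteq> g q" "g r = g p \<or> k = g r" by blast
  have "\<exists>\<pi> :: nat \<Rightarrow> nat. \<pi> (g p) = 0 \<and> \<pi> (g q) = 1 \<and> \<pi> k = 2 \<and>
    (\<forall>i<4. \<pi> i < 4) \<and> (\<forall>i<4. \<forall>j<4. i \<noteq> j \<longrightarrow> \<pi> i \<noteq> \<pi> j)"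
    by (rule colour_permutation) (use V k pq in simp_all)
  then obtain \<pi> :: "nat \<Rightarrow> nat" where "\<pi> (g p) = 0 \<and> \<pi> (g q) = 1 \<and> \<pi> k = 2 \<and>
    (\<forall>i<4. \<pi> i < 4) \<and> (\<forall>i<4. \<forall>j<4. i \<noteq> j \<longrightarrow> \<pi> i \<noteq> \<pi> j)" ..
  then have \<pi>: "\<pi> (g p) = 0" "\<pi> (g q) = 1" "\<pi> k = 2"
    and \<pi>4: "\<forall>i<4. \<pi> i < 4" and \<pi>5: "\<forall>i<4. \<forall>j<4. i \<noteq> j \<longrightarrow> \<pi> i \<noteq> \<pi> j"
    by - (elim conjE, assumption)+
  show ?thesis
  proof (intro exI[of _ "\<pi> \<circ> g"] conjI ballI allI impI)
    fix x y assume xy: "E x y \<and> (\<forall>B\<in>\<B>. x \<in> B \<longrightarrow> y \<notin> B)"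
    then have "g x \<noteq> g y" "g x < 4" "g y < 4" using g1 g3 EV[of x y] by blast+
    then show "(\<pi> \<circ> g) x \<noteq> (\<pi> \<circ> g) y" using \<pi>5 by simp
  next
    fix B x y assume "B \<in> \<B>" "x \<in> B" "y \<in> B"
    then have "g x = g y" using g2 by blast
    then show "(\<pi> \<circ> g) x = (\<pi> \<circ> g) y" by simp
  next
    fix x assume "x \<in> V"
    then show "(\<pi> \<circ> g) x < 4" using g1 \<pi>4 by simp
  next
    show "(\<pi> \<circ> g) r \<in> {0,2}" using k(4) \<pi> by auto
  qed (use \<pi> in simp_all)
qed

lemma kempe_chain_eq:
  assumes "z \<in> kempe_chain C g i j w"
  shows "kempe_chain C g i j z = kempe_chain C g i j w"
proof -
  let ?R = "\<lambda>s t. E s t \<and> s \<notin> C \<and> t \<notin> C \<and> g s \<in> {i,j} \<and> g t \<in> {i,j}"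
  have wz: "?R\<^sup>*\<^sup>* w z" using assms by (simp add: kempe_chain_def)
  have "symp ?R" using Esym by (auto intro!: sympI)
  from sympD[OF symp_rtranclp[OF this] wz] have zw: "?R\<^sup>*\<^sup>* z w" .
  show ?thesis
    unfolding kempe_chain_def using rtranclp_trans[OF wz] rtranclp_trans[OF zw] by blast
qed

lemma connected_insert: "connected_on E S \<Longrightarrow> y \<in> S \<Longrightarrow> E x y \<Longrightarrow> connected_on E (insert x S)"
  by (rule connected_on_insert) (auto intro: Esym)

lemma connected_split:
  assumes "connected_on E P" "u \<in> P" "w \<in> P" "u \<noteq> w"
  obtains P' y where "connected_on E P'" "P' \<subseteq> P - {u}" "w \<in> P'" "y \<in> P'" "E u y"
  by (rule connected_on_split[OF assms]) (auto intro: Esym)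

lemma adjacent_setsI: "x \<in> A \<Longrightarrow> y \<in> B \<Longrightarrow> E x y \<Longrightarrow> \<exists>x\<in>A. \<exists>y\<in>B. E x y"
  by blast

end

section \<open>The dumbbell\<close>

locale dumbbell = minimal_counterexample V E for V :: "'a set" and E +
  fixes a b v1 v2 v4 v5 c d u1 u2 u3 u4 u5 u6 :: 'a
  assumes dist: "distinct [a, b, v1, v2, v4, v5, c, d, u1, u2, u3, u4, u5, u6]"
    and Na: "nbrs V E a = {b, c, d, v1, v2}"
    and Nb: "nbrs V E b = {a, c, d, v4, v5}"
    and Nv1: "nbrs V E v1 = {a, v2, d, u1, u2}"
    and Nv2: "nbrs V E v2 = {a, v1, c, u2, u3}"
    and Nv4: "nbrs V E v4 = {b, v5, c, u4, u5}"
    and Nv5: "nbrs V E v5 = {b, v4, d, u5, u6}"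
begin

text \<open>The reflection exchanging the two triangles and fixing \<open>c\<close> and
  \<open>d\<close>; statements about one half are transferred to the other by it.\<close>

lemma mirror: "dumbbell V E b a v5 v4 v2 v1 c d u6 u5 u4 u3 u2 u1"
proof (unfold_locales, goal_cases)
  case 1 then show ?case using dist by (simp add: eq_commute)
qed (use Na Nb Nv1 Nv2 Nv4 Nv5 in \<open>simp_all add: insert_commute\<close>)

text \<open>The reflection in the axis through \<open>a\<close> and \<open>b\<close>; it turns the
  bound for \<open>c\<close> into the one for \<open>d\<close>.\<close>

lemma swap_cd: "dumbbell V E a b v2 v1 v5 v4 d c u3 u2 u1 u6 u5 u4"
proof (unfold_locales, goal_cases)
  case 1 then show ?case using dist by (simp add: eq_commute)
qed (use Na Nb Nv1 Nv2 Nv4 Nv5 in \<open>simp_all add: insert_commute\<close>)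

lemma Enbrs: "E s t \<longleftrightarrow> t \<in> nbrs V E s"
  using EV by (auto simp: nbrs_def)

lemma Ea: "E a t \<longleftrightarrow> t \<in> {b, c, d, v1, v2}" and Eb: "E b t \<longleftrightarrow> t \<in> {a, c, d, v4, v5}"
  and Ev1: "E v1 t \<longleftrightarrow> t \<in> {a, v2, d, u1, u2}" and Ev2: "E v2 t \<longleftrightarrow> t \<in> {a, v1, c, u2, u3}"
  and Ev4: "E v4 t \<longleftrightarrow> t \<in> {b, v5, c, u4, u5}" and Ev5: "E v5 t \<longleftrightarrow> t \<in> {b, v4, d, u5, u6}"
  by (simp_all only: Enbrs Na Nb Nv1 Nv2 Nv4 Nv5)

lemmas Ecore = Ea Eb Ev1 Ev2 Ev4 Ev5

lemma Esym_iff: "E s t \<longleftrightarrow> E t s"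
  using Esym[of s t] Esym[of t s] by iprover

lemma Ecore': "E t a \<longleftrightarrow> t \<in> {b, c, d, v1, v2}" "E t b \<longleftrightarrow> t \<in> {a, c, d, v4, v5}"
  "E t v1 \<longleftrightarrow> t \<in> {a, v2, d, u1, u2}" "E t v2 \<longleftrightarrow> t \<in> {a, v1, c, u2, u3}"
  "E t v4 \<longleftrightarrow> t \<in> {b, v5, c, u4, u5}" "E t v5 \<longleftrightarrow> t \<in> {b, v4, d, u5, u6}"
  by (subst Esym_iff, rule Ecore)+

lemma dist_rev: "distinct [u6, u5, u4, u3, u2, u1, d, c, v5, v4, v2, v1, b, a]"
  using dist by (subst distinct_rev[symmetric]) simp

lemmas neq [simp] = dist[simplified] dist_rev[simplified]

declare Ecore [simp] Ecore' [simp]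

text \<open>Each edge joins two neighbours of \<open>v1\<close> or \<open>v2\<close> that are both
  nonadjacent to a third one, namely \<open>a\<close>, \<open>v1\<close> or \<open>v2\<close>, whose
  neighbourhood is known completely. Independence of the triple is excluded, so the two are
  adjacent.\<close>

lemma ring_edges: "E u1 u2" "E u1 d" "E u2 u3" "E u3 c"
proof -
  have nbr: "\<not> E a u1" "\<not> E a u2" "\<not> E a u3" "\<not> E v2 u1" "\<not> E v2 d" "\<not> E v1 u3" "\<not> E v1 c"
    by auto
  show "E u1 u2"
    using no_independent_triple[of v1 a u1 u2 v2 d] nbr Nv1 by (auto simp: insert_commute)
  show "E u1 d"
    using no_independent_triple[of v1 v2 u1 d a u2] nbr Nv1 by (auto simp: insert_commute)
  show "E u2 u3"
    using no_independent_triple[of v2 a u2 u3 v1 c] nbr Nv2 by (auto simp: insert_commute)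
  show "E u3 c"
    using no_independent_triple[of v2 v1 u3 c a u2] nbr Nv2 by (auto simp: insert_commute)
qed

lemma ring_edges': "E u6 u5" "E u6 d" "E u5 u4" "E u4 c"
  using dumbbell.ring_edges[OF mirror] by auto

lemma inV: "{a, b, v1, v2, v4, v5, c, d, u1, u2, u3, u4, u5, u6} \<subseteq> V"
proof -
  have "E a b" "E b a" "E a v1" "E a v2" "E b v4" "E b v5" "E a c" "E a d" "E v1 u1" "E v1 u2" "E v2 u3"
    "E v4 u4" "E v4 u5" "E v5 u6" by simp_all
  then show ?thesis using EV(2) by blast
qed

text \<open>The edge would make \<open>a\<close>, \<open>b\<close>, \<open>c\<close>,
  \<open>d\<close> pairwise adjacent. The triangle \<open>a\<close>, \<open>c\<close>,
  \<open>d\<close> does not separate \<open>b\<close> from \<open>v2\<close>; a connection between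
  these, cut at \<open>b\<close> and enlarged by \<open>v1\<close> to reach \<open>d\<close>, is a
  fifth branch set.\<close>

lemma not_E_c_d: "\<not> E c d"
proof
  assume cd: "E c d"
  obtain P where P: "connected_on E P" "P \<subseteq> V - {a,c,d}" "b \<in> P" "v2 \<in> P"
  proof (rule no_separating_triangle[of a c d b v2])
    show "b \<in> V" "v2 \<in> V" using inV by auto
  qed (use cd in simp_all)
  have "b \<noteq> v2" by simp
  obtain P' y where P': "connected_on E P'" "P' \<subseteq> P - {b}" "v2 \<in> P'" "y \<in> P'" "E b y"
    using connected_on_split[OF P(1,3,4) \<open>b \<noteq> v2\<close> Esym] by metis
  have con: "connected_on E (insert v1 P')"
    by (rule connected_on_insert[OF P'(1,3)]) (use Esym in auto)
  have sub: "P' \<subseteq> V" "a \<notin> P'" "c \<notin> P'" "d \<notin> P'" "b \<notin> P'" using P P' by auto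
  show False
  proof (rule no_K5_minor5[of "{a}" "{c}" "{d}" "{b}" "insert v1 P'"])
    show "\<exists>x\<in>{c}. \<exists>y\<in>insert v1 P'. E x y"
      by (rule adjacent_setsI[of c _ v2]) (use P' in auto)
    show "\<exists>x\<in>{d}. \<exists>y\<in>insert v1 P'. E x y"
      by (rule adjacent_setsI[of d _ v1]) auto
    show "\<exists>x\<in>{b}. \<exists>y\<in>insert v1 P'. E x y"
      by (rule adjacent_setsI[of b _ y]) (use P' in auto)
    show "\<exists>x\<in>{a}. \<exists>y\<in>insert v1 P'. E x y"
      by (rule adjacent_setsI[of a _ v1]) auto
  qed (use con sub inV cd in auto)
qed

text \<open>Here \<open>v2\<close>, \<open>c\<close>, \<open>u2\<close>, \<open>u3\<close> would be
  pairwise adjacent, and the fifth branch set comes from a connection between \<open>u3\<close> and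
  \<open>a\<close>. Together with the reflected statement and the one for \<open>d\<close>, this
  keeps a further neighbour of \<open>c\<close> away from \<open>d\<close>, \<open>u2\<close> and
  \<open>u5\<close>.\<close>

lemma not_E_c_u2: "\<not> E c u2"
proof
  assume cu: "E c u2"
  obtain P where P: "connected_on E P" "P \<subseteq> V - {v2,c,u2}" "u3 \<in> P" "a \<in> P"
  proof (rule no_separating_triangle[of v2 c u2 u3 a])
    show "u3 \<in> V" "a \<in> V" using inV by auto
  qed (use cu in simp_all)
  have "u3 \<noteq> a" by simp
  obtain P' y where P': "connected_on E P'" "P' \<subseteq> P - {u3}" "a \<in> P'" "y \<in> P'" "E u3 y"
    using connected_on_split[OF P(1,3,4) \<open>u3 \<noteq> a\<close> Esym] by metis
  have con: "connected_on E (insert v1 P')"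
    by (rule connected_on_insert[OF P'(1,3)]) (use Esym in auto)
  have sub: "P' \<subseteq> V" "v2 \<notin> P'" "c \<notin> P'" "u2 \<notin> P'" "u3 \<notin> P'" using P P' by auto
  show False
  proof (rule no_K5_minor5[of "{v2}" "{c}" "{u2}" "{u3}" "insert v1 P'"])
    show "\<exists>x\<in>{c}. \<exists>y\<in>insert v1 P'. E x y"
      by (rule adjacent_setsI[of c _ a]) (use P' in auto)
    show "\<exists>x\<in>{u2}. \<exists>y\<in>insert v1 P'. E x y"
      by (rule adjacent_setsI[of u2 _ v1]) auto
    show "\<exists>x\<in>{u3}. \<exists>y\<in>insert v1 P'. E x y"
      by (rule adjacent_setsI[of u3 _ y]) (use P' in auto)
    show "\<exists>x\<in>{v2}. \<exists>y\<in>insert v1 P'. E x y"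
      by (rule adjacent_setsI[of v2 _ v1]) auto
  qed (use con sub inV cu ring_edges Esym in auto)
qed

lemma not_E_c_u5: "\<not> E c u5"
  using dumbbell.not_E_c_u2[OF mirror] .

end

section \<open>Impossible pairs of crossing chains\<close>

context dumbbell
begin

abbreviation core :: "'a set" where "core \<equiv> {a, b, v1, v2, v4, v5, c}"

text \<open>Crossing Kempe chains \<open>P\<close> and \<open>Q\<close> would give a \<open>K5\<close> minor: each chain is cut at one end, which
  then serves as, or joins, a branch set of its own.\<close>

lemma crossing_at_d:
  assumes P: "connected_on E P" "P \<subseteq> V - core" "u1 \<in> P" "u6 \<in> P"
    and Q: "connected_on E Q" "Q \<subseteq> V - core" "d \<in> Q" "u2 \<in> Q" and PQ: "P \<inter> Q = {}"
  shows False
proof -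
  \<comment> \<open>The end \<open>u1\<close> becomes a branch set alone, while the end
    \<open>u2\<close> of \<open>Q\<close> is cut off to join \<open>v2\<close>.\<close>
  obtain P' y where P': "connected_on E P'" "P' \<subseteq> P - {u1}" "u6 \<in> P'" "y \<in> P'" "E u1 y"
    by (rule connected_split[OF P(1,3,4)]) simp_all
  obtain Q' z where Q': "connected_on E Q'" "Q' \<subseteq> Q - {u2}" "d \<in> Q'" "z \<in> Q'" "E u2 z"
    by (rule connected_split[OF Q(1,4,3)]) simp_all
  have con: "connected_on E (insert a (insert b (insert v5 P')))"
    by (rule connected_insert[of _ b], rule connected_insert[of _ v5], rule connected_insert[of _ u6])
       (use P' in simp_all)
  have con': "connected_on E {u2, v2}"
    by (rule connected_insert[of _ v2]) simp_all
  have sub: "P' \<subseteq> V" "Q' \<subseteq> V" "core \<inter> P' = {}" "core \<inter> Q' = {}" "P' \<inter> Q' = {}"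
      "u1 \<notin> P'" "u1 \<notin> Q'" "u2 \<notin> P'" "u2 \<notin> Q'"
    using P P' Q Q' PQ by blast+
  show False
  proof (rule no_K5_minor5[of "{v1}" "{u1}" "insert a (insert b (insert v5 P'))" "Q'" "{u2,v2}"])
    show "\<exists>p\<in>{v1}. \<exists>q\<in>insert a (insert b (insert v5 P')). E p q" by (rule adjacent_setsI[of v1 _ a]) auto
    show "\<exists>p\<in>{v1}. \<exists>q\<in>Q'. E p q" by (rule adjacent_setsI[of v1 _ d]) (use Q'(3) in auto)
    show "\<exists>p\<in>{u1}. \<exists>q\<in>insert a (insert b (insert v5 P')). E p q" by (rule adjacent_setsI[of u1 _ y]) (use P'(4,5) in auto)
    show "\<exists>p\<in>{u1}. \<exists>q\<in>Q'. E p q" by (rule adjacent_setsI[of u1 _ d]) (use Q'(3) ring_edges in auto)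
    show "\<exists>p\<in>{u1}. \<exists>q\<in>{u2,v2}. E p q" by (rule adjacent_setsI[of u1 _ u2]) (use ring_edges in auto)
    show "\<exists>p\<in>insert a (insert b (insert v5 P')). \<exists>q\<in>Q'. E p q" by (rule adjacent_setsI[of a _ d]) (use Q'(3) in auto)
    show "\<exists>p\<in>insert a (insert b (insert v5 P')). \<exists>q\<in>{u2,v2}. E p q" by (rule adjacent_setsI[of a _ v2]) auto
    show "\<exists>p\<in>Q'. \<exists>q\<in>{u2,v2}. E p q" by (rule adjacent_setsI[of z _ u2]) (use Q'(4,5) Esym in auto)
  qed (use con con' sub inV P'(1) Q'(1) in auto)
qed

end

text \<open>Degree at most 7 for \<open>c\<close>: there is at most one neighbour \<open>x\<close> besides the six known ones;
  degree 6 is the case \<open>x = u3\<close>.\<close>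

locale dumbbell_hub = dumbbell V E a b v1 v2 v4 v5 c d u1 u2 u3 u4 u5 u6
  for V :: "'a set" and E a b v1 v2 v4 v5 c d u1 u2 u3 u4 u5 u6 +
  fixes x :: 'a
  assumes Nc: "nbrs V E c = {a, b, v2, v4, u3, u4, x}" and xcore: "x \<notin> {a, b, v1, v2, v4, v5, c}"
begin

lemma mirror_hub: "dumbbell_hub V E b a v5 v4 v2 v1 c d u6 u5 u4 u3 u2 u1 x"
proof -
  interpret m: dumbbell V E b a v5 v4 v2 v1 c d u6 u5 u4 u3 u2 u1 by (rule mirror)
  show ?thesis
    by unfold_locales (use Nc xcore in \<open>simp_all add: insert_commute\<close>)
qed

lemma Ec [simp]: "E c t \<longleftrightarrow> t \<in> {a, b, v2, v4, u3, u4, x}" "E t c \<longleftrightarrow> t \<in> {a, b, v2, v4, u3, u4, x}"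
  by (simp_all only: Esym_iff[of t c] Enbrs[of c t] Nc)

lemma neqx [simp]: "x \<noteq> a" "x \<noteq> b" "x \<noteq> v1" "x \<noteq> v2" "x \<noteq> v4" "x \<noteq> v5" "x \<noteq> c" "x \<noteq> d" "x \<noteq> u2" "x \<noteq> u5"
proof -
  have "E c x" by simp
  then show "x \<noteq> d" "x \<noteq> u2" "x \<noteq> u5"
    using not_E_c_d not_E_c_u2 not_E_c_u5 by metis+
qed (use xcore in simp_all)

lemmas neqx' [simp] = neqx[symmetric]

lemma xV: "x \<in> V"
  using EV(2)[of c x] by simp

text \<open>The hub \<open>c\<close> is a branch set alone, being adjacent to \<open>u3\<close>,
  \<open>u4\<close>, \<open>x\<close>. The other six core vertices form a connected set adjacent to
  both chains' ends, and this set absorbs the far end \<open>t\<close> of \<open>Q\<close>.\<close>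

lemma crossing_at_x:
  assumes x: "E x u3" "E x u4"
    and P: "connected_on E P" "P \<subseteq> V - core" "u3 \<in> P" "u4 \<in> P"
    and Q: "connected_on E Q" "Q \<subseteq> V - core" "x \<in> Q" "t \<in> Q" "t \<in> {d, u2, u5}" and PQ: "P \<inter> Q = {}"
  shows False
proof -
  obtain P' y where P': "connected_on E P'" "P' \<subseteq> P - {u3}" "u4 \<in> P'" "y \<in> P'" "E u3 y"
    by (rule connected_split[OF P(1,3,4)]) simp_all
  obtain Q' z where Q': "connected_on E Q'" "Q' \<subseteq> Q - {t}" "x \<in> Q'" "z \<in> Q'" "E t z"
    by (rule connected_split[OF Q(1,4,3)]) (use Q(5) in auto)
  have "connected_on E {v2, v1, a, v5, v4, b}"
    by (rule connected_insert[of _ a], rule connected_insert[of _ a], rule connected_insert[of _ b],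
        rule connected_insert[of _ b], rule connected_insert[of _ b]) simp_all
  then have con: "connected_on E {t, v2, v1, a, v5, v4, b}"
    \<comment> \<open>\<open>d\<close> and \<open>u2\<close> are attached to the core through
      \<open>v1\<close>, \<open>u5\<close> through \<open>v5\<close>.\<close>
    by (rule connected_insert[of _ "if t = u5 then v5 else v1"]) (use Q(5) in auto)
  have sub: "P' \<subseteq> V" "Q' \<subseteq> V" "core \<inter> P' = {}" "core \<inter> Q' = {}" "P' \<inter> Q' = {}"
      "u3 \<notin> P'" "u3 \<notin> Q'" "t \<notin> P'" "t \<notin> Q'" "t \<noteq> u3" "t \<notin> core" "t \<in> V"
    using P P' Q Q' PQ by blast+
  show False
  proof (rule no_K5_minor5[of "{c}" "{u3}" "P'" "Q'" "{t, v2, v1, a, v5, v4, b}"])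
    show "\<exists>p\<in>{c}. \<exists>q\<in>P'. E p q" by (rule adjacent_setsI[of c _ u4]) (use P'(3) in auto)
    show "\<exists>p\<in>{c}. \<exists>q\<in>Q'. E p q" by (rule adjacent_setsI[of c _ x]) (use Q'(3) in auto)
    show "\<exists>p\<in>{c}. \<exists>q\<in>{t, v2, v1, a, v5, v4, b}. E p q" by (rule adjacent_setsI[of c _ a]) auto
    show "\<exists>p\<in>{u3}. \<exists>q\<in>P'. E p q" by (rule adjacent_setsI[of u3 _ y]) (use P'(4,5) in auto)
    show "\<exists>p\<in>{u3}. \<exists>q\<in>Q'. E p q" by (rule adjacent_setsI[of u3 _ x]) (use Q'(3) x Esym in auto)
    show "\<exists>p\<in>{u3}. \<exists>q\<in>{t, v2, v1, a, v5, v4, b}. E p q" by (rule adjacent_setsI[of u3 _ v2]) auto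
    show "\<exists>p\<in>P'. \<exists>q\<in>Q'. E p q" by (rule adjacent_setsI[of u4 _ x]) (use P'(3) Q'(3) x Esym in auto)
    show "\<exists>p\<in>P'. \<exists>q\<in>{t, v2, v1, a, v5, v4, b}. E p q" by (rule adjacent_setsI[of u4 _ v4]) (use P'(3) in auto)
    show "\<exists>p\<in>Q'. \<exists>q\<in>{t, v2, v1, a, v5, v4, b}. E p q" by (rule adjacent_setsI[of z _ t]) (use Q'(4,5) Esym in auto)
  qed (use con sub inV P'(1) Q'(1) in auto)
qed

text \<open>The pair \<open>v4\<close>, \<open>v5\<close> sees \<open>u4\<close>, \<open>u5\<close>
  and \<open>u6\<close>. The rest of the core together with \<open>d\<close> is the last branch set:
  it meets \<open>u4\<close> at \<open>c\<close>, \<open>u6\<close> at \<open>d\<close>, and absorbs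
  the far end of \<open>Q\<close>.\<close>

lemma crossing_at_u5:
  assumes P: "connected_on E P" "P \<subseteq> V - core" "u4 \<in> P" "u6 \<in> P" "d \<notin> P"
    and Q: "connected_on E Q" "Q \<subseteq> V - core" "u5 \<in> Q" "t \<in> Q" "t \<in> {d, u2, x}" and PQ: "P \<inter> Q = {}"
  shows False
proof -
  \<comment> \<open>When \<open>d\<close> lies on \<open>Q\<close>, the chain is cut exactly there,
    because \<open>d\<close> belongs to the last branch set and must not remain in
    \<open>Q'\<close>.\<close>
  obtain t' where t': "t' \<in> Q" "t' \<in> {d, u2, x}" "d \<in> Q \<Longrightarrow> t' = d"
    using Q(4,5) by (cases "d \<in> Q") auto
  obtain P' y where P': "connected_on E P'" "P' \<subseteq> P - {u4}" "u6 \<in> P'" "y \<in> P'" "E u4 y"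
    by (rule connected_split[OF P(1,3,4)]) simp_all
  obtain Q' z where Q': "connected_on E Q'" "Q' \<subseteq> Q - {t'}" "u5 \<in> Q'" "z \<in> Q'" "E t' z"
    by (rule connected_split[OF Q(1) t'(1) Q(3)]) (use t'(2) in auto)
  have "connected_on E {v2, v1, d, a, c, b}"
    by (rule connected_insert[of _ a], rule connected_insert[of _ a], rule connected_insert[of _ b],
        rule connected_insert[of _ b], rule connected_insert[of _ b]) simp_all
  then have con: "connected_on E {t', v2, v1, d, a, c, b}"
    by (rule connected_insert[of _ "if t' = x then c else if t' = d then a else v1"]) (use t'(2) in auto)
  have con': "connected_on E {v4, v5}"
    by (rule connected_insert[of _ v5]) simp_all
  have sub: "P' \<subseteq> V" "Q' \<subseteq> V" "core \<inter> P' = {}" "core \<inter> Q' = {}" "P' \<inter> Q' = {}"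
      "u4 \<notin> P'" "u4 \<notin> Q'" "t' \<notin> P'" "t' \<notin> Q'" "t' \<noteq> u4" "t' \<notin> core" "t' \<in> V" "d \<notin> P'" "d \<notin> Q'"
    using P P' Q Q' PQ t' by blast+
  show False
  proof (rule no_K5_minor5[of "{v4,v5}" "{u4}" "P'" "Q'" "{t', v2, v1, d, a, c, b}"])
    show "\<exists>p\<in>{v4,v5}. \<exists>q\<in>{u4}. E p q" by (rule adjacent_setsI[of v4 _ u4]) auto
    show "\<exists>p\<in>{v4,v5}. \<exists>q\<in>P'. E p q" by (rule adjacent_setsI[of v5 _ u6]) (use P'(3) in auto)
    show "\<exists>p\<in>{v4,v5}. \<exists>q\<in>Q'. E p q" by (rule adjacent_setsI[of v4 _ u5]) (use Q'(3) in auto)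
    show "\<exists>p\<in>{v4,v5}. \<exists>q\<in>{t', v2, v1, d, a, c, b}. E p q" by (rule adjacent_setsI[of v4 _ b]) auto
    show "\<exists>p\<in>{u4}. \<exists>q\<in>P'. E p q" by (rule adjacent_setsI[of u4 _ y]) (use P'(4,5) in auto)
    show "\<exists>p\<in>{u4}. \<exists>q\<in>Q'. E p q" by (rule adjacent_setsI[of u4 _ u5]) (use Q'(3) ring_edges' Esym in auto)
    show "\<exists>p\<in>{u4}. \<exists>q\<in>{t', v2, v1, d, a, c, b}. E p q" by (rule adjacent_setsI[of u4 _ c]) auto
    show "\<exists>p\<in>P'. \<exists>q\<in>Q'. E p q" by (rule adjacent_setsI[of u6 _ u5]) (use P'(3) Q'(3) ring_edges' in auto)
    show "\<exists>p\<in>P'. \<exists>q\<in>{t', v2, v1, d, a, c, b}. E p q" by (rule adjacent_setsI[of u6 _ d]) (use P'(3) ring_edges' in auto)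
    show "\<exists>p\<in>Q'. \<exists>q\<in>{t', v2, v1, d, a, c, b}. E p q" by (rule adjacent_setsI[of z _ t']) (use Q'(4,5) Esym in auto)
  qed (use con con' sub inV P'(1) Q'(1) in auto)
qed

text \<open>A wheel with two crossing diagonals. The hub is the whole core and the rim passes
  \<open>u1\<close>, \<open>u3\<close>, \<open>u4\<close>, \<open>u6\<close>; the rim links are
  supplied by \<open>u2\<close>, \<open>x\<close>, \<open>u5\<close>, \<open>d\<close> in this
  order, which is why the chains must avoid them. The chains themselves are the diagonals.\<close>

lemma crossing_at_core:
  assumes x: "E x u3" "E x u4"
    and P: "connected_on E P" "P \<subseteq> V - core" "u1 \<in> P" "u4 \<in> P"
    and Q: "connected_on E Q" "Q \<subseteq> V - core" "u3 \<in> Q" "u6 \<in> Q" and PQ: "P \<inter> Q = {}"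
    and out: "{u2, x, u5, d} \<inter> (P \<union> Q) = {}"
  shows False
proof -
  obtain P' y where P': "connected_on E P'" "P' \<subseteq> P - {u1}" "u4 \<in> P'" "y \<in> P'" "E u1 y"
    by (rule connected_split[OF P(1,3,4)]) simp_all
  obtain Q' z where Q': "connected_on E Q'" "Q' \<subseteq> Q - {u3}" "u6 \<in> Q'" "z \<in> Q'" "E u3 z"
    by (rule connected_split[OF Q(1,3,4)]) simp_all
  have con: "connected_on E {v2, v1, c, v5, v4, a, b}"
    by (rule connected_insert[of _ a], rule connected_insert[of _ a], rule connected_insert[of _ a],
        rule connected_insert[of _ b], rule connected_insert[of _ b], rule connected_insert[of _ b]) simp_all
  have con2: "connected_on E {u1, u2}"
    by (rule connected_insert[of _ u2]) (use ring_edges in simp_all)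
  have con3: "connected_on E {u3, x}"
    by (rule connected_insert[of _ x]) (use x Esym in simp_all)
  have con4: "connected_on E (insert u5 P')"
    by (rule connected_insert[of _ u4]) (use P' ring_edges' in simp_all)
  have con5: "connected_on E (insert d Q')"
    by (rule connected_insert[of _ u6]) (use Q' ring_edges' Esym in simp_all)
  have sub: "P' \<subseteq> V" "Q' \<subseteq> V" "core \<inter> P' = {}" "core \<inter> Q' = {}" "P' \<inter> Q' = {}"
      "u1 \<notin> P'" "u1 \<notin> Q'" "u3 \<notin> P'" "u3 \<notin> Q'" "{u2, x, u5, d} \<inter> P' = {}" "{u2, x, u5, d} \<inter> Q' = {}"
      "x \<noteq> u1"
    using P P' Q Q' PQ out by blast+
  show False
  proof (rule no_K5_minor5[of "{v2, v1, c, v5, v4, a, b}" "{u1,u2}" "{u3,x}" "insert u5 P'" "insert d Q'"])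
    show "\<exists>p\<in>{v2, v1, c, v5, v4, a, b}. \<exists>q\<in>{u1,u2}. E p q" by (rule adjacent_setsI[of v1 _ u1]) auto
    show "\<exists>p\<in>{v2, v1, c, v5, v4, a, b}. \<exists>q\<in>{u3,x}. E p q" by (rule adjacent_setsI[of c _ u3]) auto
    show "\<exists>p\<in>{v2, v1, c, v5, v4, a, b}. \<exists>q\<in>insert u5 P'. E p q" by (rule adjacent_setsI[of v4 _ u5]) auto
    show "\<exists>p\<in>{v2, v1, c, v5, v4, a, b}. \<exists>q\<in>insert d Q'. E p q" by (rule adjacent_setsI[of a _ d]) auto
    show "\<exists>p\<in>{u1,u2}. \<exists>q\<in>{u3,x}. E p q" by (rule adjacent_setsI[of u2 _ u3]) (use ring_edges in auto)
    show "\<exists>p\<in>{u1,u2}. \<exists>q\<in>insert u5 P'. E p q" by (rule adjacent_setsI[of u1 _ y]) (use P'(4,5) in auto)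
    show "\<exists>p\<in>{u1,u2}. \<exists>q\<in>insert d Q'. E p q" by (rule adjacent_setsI[of u1 _ d]) (use ring_edges in auto)
    show "\<exists>p\<in>{u3,x}. \<exists>q\<in>insert u5 P'. E p q" by (rule adjacent_setsI[of x _ u4]) (use P'(3) x in auto)
    show "\<exists>p\<in>{u3,x}. \<exists>q\<in>insert d Q'. E p q" by (rule adjacent_setsI[of u3 _ z]) (use Q'(4,5) in auto)
    show "\<exists>p\<in>insert u5 P'. \<exists>q\<in>insert d Q'. E p q" by (rule adjacent_setsI[of u5 _ u6]) (use Q'(3) ring_edges' Esym in auto)
  qed (use con con2 con3 con4 con5 sub inV xV x EV(3) in auto)
qed

end

section \<open>Extending colourings to the core\<close>

definition cols :: "nat list" where "cols = [0,1,2,3]"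
text \<open>The arguments are the colours of the boundary vertices; the bound variables are the colours
  of the seven core vertices \<open>c\<close>, \<open>v2\<close>, \<open>v1\<close>, \<open>v4\<close>, \<open>v5\<close>, \<open>a\<close>, \<open>b\<close>.\<close>

definition core_ext :: "nat \<Rightarrow> nat \<Rightarrow> nat \<Rightarrow> nat \<Rightarrow> nat \<Rightarrow> nat \<Rightarrow> nat \<Rightarrow> nat \<Rightarrow> bool" where
  "core_ext d u1 u2 u3 x u4 u5 u6 \<longleftrightarrow>
    list_ex (\<lambda>c. c \<noteq> u3 \<and> c \<noteq> x \<and> c \<noteq> u4 \<and>
     list_ex (\<lambda>v2. v2 \<noteq> c \<and> v2 \<noteq> u2 \<and> v2 \<noteq> u3 \<and>
      list_ex (\<lambda>v1. v1 \<noteq> v2 \<and> v1 \<noteq> d \<and> v1 \<noteq> u1 \<and> v1 \<noteq> u2 \<and>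
       list_ex (\<lambda>v4. v4 \<noteq> c \<and> v4 \<noteq> u4 \<and> v4 \<noteq> u5 \<and>
        list_ex (\<lambda>v5. v5 \<noteq> v4 \<and> v5 \<noteq> d \<and> v5 \<noteq> u5 \<and> v5 \<noteq> u6 \<and>
         list_ex (\<lambda>a. a \<noteq> c \<and> a \<noteq> d \<and> a \<noteq> v1 \<and> a \<noteq> v2 \<and>
          list_ex (\<lambda>b. b \<noteq> a \<and> b \<noteq> c \<and> b \<noteq> d \<and> b \<noteq> v4 \<and> b \<noteq> v5) cols) cols) cols) cols) cols) cols) cols"
text \<open>Colours are named so that \<open>d\<close> has 0 and \<open>u1\<close> has 1; then
  \<open>u2\<close> repeats 0 or may be called 2. The side conditions are the boundary edges
  together with what the blocks force: \<open>u3\<close> avoids \<open>d\<close> and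
  \<open>u1\<close> through \<open>v1\<close> and \<open>u4\<close> through \<open>c\<close>, while
  \<open>u4\<close> avoids \<open>d\<close> and \<open>u6\<close> through \<open>v5\<close>.\<close>

lemma core_ext_table1: "list_all (\<lambda>u2. list_all (\<lambda>u3. u3 \<noteq> 0 \<and> u3 \<noteq> 1 \<and> u3 \<noteq> u2 \<longrightarrow> list_all (\<lambda>u4. u4 \<noteq> u3 \<and> u4 \<noteq> 0 \<longrightarrow>
  list_all (\<lambda>u6. u6 \<noteq> 0 \<and> u6 \<noteq> u4 \<longrightarrow> list_all (\<lambda>u5. u5 \<noteq> u4 \<and> u5 \<noteq> u6 \<longrightarrow>
    list_all (\<lambda>x. core_ext 0 1 u2 u3 x u4 u5 u6) [u3,1,u6]) cols) cols) cols) cols) [0,2]"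
  by code_simp

text \<open>Now \<open>c\<close> is not in the block of \<open>u3\<close>, so \<open>u3\<close> and
  \<open>u4\<close> may agree. In exchange \<open>x\<close> differs from \<open>u3\<close> and
  \<open>u4\<close> by adjacency and from \<open>d\<close> because it shares a block with
  \<open>a\<close>.\<close>

lemma core_ext_table2: "list_all (\<lambda>u2. list_all (\<lambda>u3. u3 \<noteq> 0 \<and> u3 \<noteq> 1 \<and> u3 \<noteq> u2 \<longrightarrow> list_all (\<lambda>u4. u4 \<noteq> 0 \<longrightarrow>
  list_all (\<lambda>x. x \<noteq> 0 \<and> x \<noteq> u3 \<and> x \<noteq> u4 \<longrightarrow>
  list_all (\<lambda>u6. u6 \<noteq> 0 \<and> u6 \<noteq> u4 \<longrightarrow> list_all (\<lambda>u5. u5 \<noteq> u4 \<and> u5 \<noteq> u6 \<longrightarrow> core_ext 0 1 u2 u3 x u4 u5 u6 \<or>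
    (u2,u3,x,u4,u5,u6) = (2,3,1,3,2,1) \<or> (u2,u3,x,u4,u5,u6) = (2,3,2,1,2,3) \<or>
    (u2,u3,x,u4,u5,u6) = (2,3,2,3,2,1)) cols) cols) cols) cols) cols) [0,2]"
  by code_simp

lemma set_cols: "i \<in> set cols \<longleftrightarrow> i < 4"
  by (auto simp: cols_def)

lemma core_extD:
  assumes "core_ext d u1 u2 u3 x u4 u5 u6"
  obtains c v2 v1 v4 v5 a b :: nat where
    "c < 4" "c \<noteq> u3" "c \<noteq> x" "c \<noteq> u4"
    "v2 < 4" "v2 \<noteq> c" "v2 \<noteq> u2" "v2 \<noteq> u3"
    "v1 < 4" "v1 \<noteq> v2" "v1 \<noteq> d" "v1 \<noteq> u1" "v1 \<noteq> u2"
    "v4 < 4" "v4 \<noteq> c" "v4 \<noteq> u4" "v4 \<noteq> u5"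
    "v5 < 4" "v5 \<noteq> v4" "v5 \<noteq> d" "v5 \<noteq> u5" "v5 \<noteq> u6"
    "a < 4" "a \<noteq> c" "a \<noteq> d" "a \<noteq> v1" "a \<noteq> v2"
    "b < 4" "b \<noteq> a" "b \<noteq> c" "b \<noteq> d" "b \<noteq> v4" "b \<noteq> v5"
proof -
  show thesis
    using assms unfolding core_ext_def list_ex_iff Bex_def set_cols
  proof (elim exE conjE, goal_cases)
    case (1 c v2 v1 v4 v5 a b)
    then show thesis by (intro that[of c v2 v1 v4 v5 a b])
  qed
qed

lemma core_ext_contraction1:
  assumes "u2 \<in> {0,2}" "u3 < 4" "u4 < 4" "u5 < 4" "u6 < 4" "u3 \<noteq> 0 \<and> u3 \<noteq> 1 \<and> u3 \<noteq> u2"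
    "u4 \<noteq> u3 \<and> u4 \<noteq> 0" "u6 \<noteq> 0 \<and> u6 \<noteq> u4" "u5 \<noteq> u4 \<and> u5 \<noteq> u6" "x \<in> {u3,1,u6}"
  shows "core_ext 0 1 u2 u3 x u4 u5 u6"
  by (rule core_ext_table1[unfolded list_all_iff, rule_format, of u2 u3 u4 u6 u5 x])
     (simp_all only: set_cols assms(2-9), use assms in simp_all)

lemma core_ext_contraction2:
  assumes "u2 \<in> {0,2}" "u3 < 4" "x < 4" "u4 < 4" "u5 < 4" "u6 < 4" "u3 \<noteq> 0 \<and> u3 \<noteq> 1 \<and> u3 \<noteq> u2"
    "u4 \<noteq> 0" "x \<noteq> 0 \<and> x \<noteq> u3 \<and> x \<noteq> u4" "u6 \<noteq> 0 \<and> u6 \<noteq> u4" "u5 \<noteq> u4 \<and> u5 \<noteq> u6"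
  shows "core_ext 0 1 u2 u3 x u4 u5 u6 \<or> (u2,u3,x,u4,u5,u6) = (2,3,1,3,2,1) \<or>
    (u2,u3,x,u4,u5,u6) = (2,3,2,1,2,3) \<or> (u2,u3,x,u4,u5,u6) = (2,3,2,3,2,1)"
  by (rule core_ext_table2[unfolded list_all_iff, rule_format, of u2 u3 u4 x u6 u5])
     (simp_all only: set_cols assms(2-11), use assms in simp_all)

text \<open>The boundary colourings reached from the three exceptional ones by Kempe switches, in
  the order \<open>d\<close>, \<open>u1\<close>, \<open>u2\<close>, \<open>u3\<close>,
  \<open>x\<close>, \<open>u4\<close>, \<open>u5\<close>, \<open>u6\<close>. The sixth and seventh
  arise from two of the exceptions.\<close>

lemma core_ext_switched:
  "core_ext 2 1 2 3 1 3 2 1" "core_ext 0 1 2 3 1 3 2 3" "core_ext 0 1 2 1 3 1 2 3"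
  "core_ext 0 1 2 3 0 1 2 3" "core_ext 0 1 2 3 2 1 0 3" "core_ext 0 1 2 3 2 3 2 3" "core_ext 0 3 2 3 2 3 2 3"
  "core_ext 0 1 2 3 2 3 0 1" "core_ext 0 1 0 3 2 3 2 1" "core_ext 0 3 2 3 2 3 2 1"
  by code_simp+

section \<open>Boundary colourings produced by contractions\<close>

context dumbbell_hub
begin

text \<open>Every neighbour of a core vertex is a core vertex or one of the eight listed boundary
  vertices, so \<open>core_ext\<close> controls all edges meeting the core and \<open>g\<close> all
  the others.\<close>

lemma not_core_ext:
  assumes g: "partial_colouring core g"
    and ext: "core_ext (g d) (g u1) (g u2) (g u3) (g x) (g u4) (g u5) (g u6)"
  shows False
proof -
  obtain kc k2 k1 k4 k5 ka kb :: nat where k: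
    "kc < 4" "kc \<noteq> g u3" "kc \<noteq> g x" "kc \<noteq> g u4"
    "k2 < 4" "k2 \<noteq> kc" "k2 \<noteq> g u2" "k2 \<noteq> g u3"
    "k1 < 4" "k1 \<noteq> k2" "k1 \<noteq> g d" "k1 \<noteq> g u1" "k1 \<noteq> g u2"
    "k4 < 4" "k4 \<noteq> kc" "k4 \<noteq> g u4" "k4 \<noteq> g u5"
    "k5 < 4" "k5 \<noteq> k4" "k5 \<noteq> g d" "k5 \<noteq> g u5" "k5 \<noteq> g u6"
    "ka < 4" "ka \<noteq> kc" "ka \<noteq> g d" "ka \<noteq> k1" "ka \<noteq> k2"
    "kb < 4" "kb \<noteq> ka" "kb \<noteq> kc" "kb \<noteq> g d" "kb \<noteq> k4" "kb \<noteq> k5"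
    by (rule core_extD[OF ext])
  define h where "h = g(a := ka, b := kb, v1 := k1, v2 := k2, v4 := k4, v5 := k5, c := kc)"
  have hc [simp]: "h a = ka" "h b = kb" "h v1 = k1" "h v2 = k2" "h v4 = k4" "h v5 = k5" "h c = kc"
    by (simp_all add: h_def)
  have hg: "h z = g z" if "z \<notin> core" for z using that by (simp add: h_def)
  have hr [simp]: "h d = g d" "h u1 = g u1" "h u2 = g u2" "h u3 = g u3" "h u4 = g u4" "h u5 = g u5" "h u6 = g u6" "h x = g x"
    by (rule hg; simp)+
  have hn: "h s \<noteq> h t" if "s \<in> core" "E s t" for s t
    using that k by (elim insertE emptyE) auto
  show False
  proof (rule not_4_colourable[of h])
    show "h v < 4" if "v \<in> V" for v
    proof (cases "v \<in> core")
      case True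
      then show ?thesis using k by auto
    next
      case False
      then show ?thesis using g that by (simp add: hg partial_colouring_def)
    qed
    fix s t assume st: "E s t"
    consider "s \<in> core" | "t \<in> core" | "s \<notin> core" "t \<notin> core" by blast
    then show "h s \<noteq> h t"
    proof cases
      case 1 then show ?thesis using hn st by blast
    next
      case 2 then show ?thesis using hn[OF _ Esym[OF st]] by metis
    next
      case 3
      then have "g s \<noteq> g t" using g st unfolding partial_colouring_def by blast
      then show ?thesis by (simp only: hg[OF 3(1)] hg[OF 3(2)] not_False_eq_True)
    qed
  qed
qed

text \<open>Contracting \<open>{v1, v2, u3, c}\<close> and \<open>{v5, v4, u4}\<close> forces \<open>u3\<close> and \<open>u4\<close> to receive colours different
  from those of all boundary neighbours of the contracted sets. If \<open>x\<close> can be given one of the colours of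
  \<open>u3\<close>, \<open>u1\<close>, \<open>u6\<close>, this already makes the colouring extend.\<close>

lemma hub_contraction1:
  assumes S: "S = {} \<and> x \<in> {u3, u1, u6} \<or> S = {x} \<and> \<not> E x u3 \<and> x \<notin> {u1, u3, u4, u6}"
  shows False
proof -
  \<comment> \<open>\<open>S\<close> covers two situations: \<open>x\<close> already coincides with
    a vertex of suitable colour, or \<open>x\<close> is put into the block of \<open>u3\<close>,
    through the common neighbour \<open>c\<close>, to take its colour. The latter requires
    \<open>x\<close> and \<open>u3\<close> to be nonadjacent.\<close>
  define B1 where "B1 = S \<union> {v1, v2, u3, c}"
  define B2 where "B2 = {v5, v4, u4}"
  have con: "connected_on E {v1, v2, u3, c}"
    by (rule connected_insert[of _ v2], rule connected_insert[of _ c], rule connected_insert[of _ c]) simp_all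
  then have con1: "connected_on E B1"
    using S connected_insert[OF con, of c x] by (auto simp: B1_def insert_commute)
  have con2: "connected_on E B2"
    unfolding B2_def by (rule connected_insert[of _ v4], rule connected_insert[of _ u4]) simp_all
  have S': "S \<subseteq> {x}" "x \<in> S \<Longrightarrow> x \<notin> {u1, u3, u4, u6}" "x \<in> S \<Longrightarrow> \<not> E x u3" using S by auto
  have disj: "B1 \<inter> B2 = {}" using S' by (auto simp: B1_def B2_def)
  have "\<exists>g :: 'a \<Rightarrow> nat. (\<forall>x\<in>V. g x < 4) \<and> (\<forall>B\<in>{B1,B2}. \<forall>x\<in>B. \<forall>y\<in>B. g x = g y) \<and>
    (\<forall>x y. E x y \<and> (\<forall>B\<in>{B1,B2}. x \<in> B \<longrightarrow> y \<notin> B) \<longrightarrow> g x \<noteq> g y) \<and> g d = 0 \<and> g u1 = 1 \<and> g u2 \<in> {0,2}"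
  proof (rule contract_blocks_normalised[of _ B2 v4 v5])
    show "B \<subseteq> V \<and> connected_on E B" if "B \<in> {B1, B2}" for B
      using that con1 con2 inV xV S'(1) by (auto simp: B1_def B2_def)
    show "B \<inter> C = {}" if "B \<in> {B1, B2}" "C \<in> {B1, B2}" "B \<noteq> C" for B C
      using that disj by auto
    show "u1 \<notin> B" if "B \<in> {B1, B2}" for B using that S' by (auto simp: B1_def B2_def)
    show "E d u1" "E u1 u2" using ring_edges Esym by auto
  qed (auto simp: B2_def)
  then obtain g :: "'a \<Rightarrow> nat" where "(\<forall>x\<in>V. g x < 4) \<and> (\<forall>B\<in>{B1,B2}. \<forall>x\<in>B. \<forall>y\<in>B. g x = g y) \<and>
    (\<forall>x y. E x y \<and> (\<forall>B\<in>{B1,B2}. x \<in> B \<longrightarrow> y \<notin> B) \<longrightarrow> g x \<noteq> g y) \<and> g d = 0 \<and> g u1 = 1 \<and> g u2 \<in> {0,2}" ..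
  then have g1: "\<forall>x\<in>V. g x < 4" and g2: "\<forall>B\<in>{B1,B2}. \<forall>x\<in>B. \<forall>y\<in>B. g x = g y"
    and g3: "\<forall>x y. E x y \<and> (\<forall>B\<in>{B1,B2}. x \<in> B \<longrightarrow> y \<notin> B) \<longrightarrow> g x \<noteq> g y"
    and g4: "g d = 0" "g u1 = 1" "g u2 \<in> {0,2}"
    by - (elim conjE, assumption)+
  have sep: "g s \<noteq> g t" if "E s t" "s \<in> B1 \<Longrightarrow> t \<notin> B1" "s \<in> B2 \<Longrightarrow> t \<notin> B2" for s t
    using g3[rule_format, of s t] that by simp
  have eq1: "g s = g t" if "s \<in> B1" "t \<in> B1" for s t
    by (rule g2[rule_format, of B1]) (use that in simp_all)
  have eq2: "g s = g t" if "s \<in> B2" "t \<in> B2" for s t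
    by (rule g2[rule_format, of B2]) (use that in simp_all)
  have m: "v1 \<in> B1" "v2 \<in> B1" "u3 \<in> B1" "c \<in> B1" "v4 \<in> B2" "v5 \<in> B2" "u4 \<in> B2"
    "d \<notin> B1" "u1 \<notin> B1" "u2 \<notin> B1" "u4 \<notin> B1" "u6 \<notin> B1" "d \<notin> B2" "u5 \<notin> B1" "u5 \<notin> B2" "u6 \<notin> B2"
    using S' by (auto simp: B1_def B2_def)
  have mB2: "\<And>z. z \<in> B1 \<Longrightarrow> z \<notin> B2" using disj by blast
  have e: "g v1 = g u3" "g c = g u3" "g v5 = g u4" "g v4 = g u4" by (rule eq1, rule m, rule m, rule eq1, rule m, rule m, rule eq2, rule m, rule m, rule eq2, rule m, rule m)
  have pc: "partial_colouring core g"
    unfolding partial_colouring_def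
  proof (intro conjI allI impI)
    show "\<forall>v\<in>V. g v < 4" by (fact g1)
    fix s t assume st: "E s t \<and> s \<notin> core \<and> t \<notin> core"
    \<comment> \<open>Off the core the blocks contain only \<open>u4\<close>, respectively
      \<open>u3\<close> and possibly \<open>x\<close>, so no edge off the core was
      contracted.\<close>
    then have "\<not> (s \<in> B2 \<and> t \<in> B2)" using EV(3)[of s t] by (auto simp: B2_def)
    moreover have "\<not> (s \<in> B1 \<and> t \<in> B1)"
    proof
      assume "s \<in> B1 \<and> t \<in> B1"
      then have "s \<in> {x, u3}" "t \<in> {x, u3}" "x \<in> S \<or> s = t" using st S'(1) by (auto simp: B1_def)
      then show False using EV(3)[of s t] st S'(3) Esym_iff[of u3 x] by auto
    qed
    ultimately show "g s \<noteq> g t" using sep[of s t] st by blast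
  qed
  have n: "g u3 \<noteq> g d" "g u3 \<noteq> g u1" "g u3 \<noteq> g u4" "g u4 \<noteq> g d" "g u4 \<noteq> g u6"
  proof -
    have "g v1 \<noteq> g d" "g v1 \<noteq> g u1" "g c \<noteq> g u4" "g v5 \<noteq> g d" "g v5 \<noteq> g u6"
      by (rule sep; use m mB2 in simp)+
    then show "g u3 \<noteq> g d" "g u3 \<noteq> g u1" "g u3 \<noteq> g u4" "g u4 \<noteq> g d" "g u4 \<noteq> g u6" by (simp_all add: e)
  qed
  have pr: "g s \<noteq> g t" if "E s t" "s \<notin> core" "t \<notin> core" for s t
    using pc that unfolding partial_colouring_def by blast
  have r: "g u2 \<noteq> g u3" "g u5 \<noteq> g u4" "g u6 \<noteq> g u5" "g u6 \<noteq> g d"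
    by (rule pr; use ring_edges ring_edges' in simp)+
  have lt: "g u3 < 4" "g u4 < 4" "g u5 < 4" "g u6 < 4" using g1 inV by auto
  have gx: "g x \<in> {g u3, g u1, g u6}"
    using S
  proof
    assume "S = {x} \<and> \<not> E x u3 \<and> x \<notin> {u1, u3, u4, u6}"
    then have "x \<in> B1" by (simp add: B1_def)
    then show ?thesis using eq1[OF _ m(3)] by simp
  qed auto
  have "core_ext (g d) (g u1) (g u2) (g u3) (g x) (g u4) (g u5) (g u6)"
    unfolding g4(1,2)
    by (rule core_ext_contraction1) (use g4 n r lt gx in simp_all)
  then show False by (rule not_core_ext[OF pc])
qed

end

context dumbbell
begin

lemma core_mirror: "{b, a, v5, v4, v2, v1, c} = core" by auto

lemmas crossing_at_d' = dumbbell.crossing_at_d[OF mirror, unfolded core_mirror]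

end

context dumbbell_hub
begin

lemmas crossing_at_u2 = dumbbell_hub.crossing_at_u5[OF mirror_hub, unfolded core_mirror]

text \<open>If \<open>x\<close> is a seventh neighbour of \<open>c\<close> adjacent to \<open>u3\<close> and \<open>u4\<close>, contracting also \<open>{x, a, c}\<close>
  leaves only three colourings of the boundary, up to permuting colours, that do not extend.\<close>

lemma hub_contraction2:
  assumes x: "E x u3" "E x u4" "x \<noteq> u1" "x \<noteq> u6"
  obtains g where "partial_colouring core g" "g d = 0" "g u1 = 1"
    "(g u2, g u3, g x, g u4, g u5, g u6) = (2,3,1,3,2,1) \<or> (g u2, g u3, g x, g u4, g u5, g u6) = (2,3,2,1,2,3) \<or>
     (g u2, g u3, g x, g u4, g u5, g u6) = (2,3,2,3,2,1)"
proof -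
  \<comment> \<open>\<open>a\<close> passes on to \<open>x\<close> the inequality with
    \<open>d\<close>; \<open>c\<close> only links the two.\<close>
  define B0 where "B0 = {x, a, c}"
  define B1 where "B1 = {v1, v2, u3}"
  define B2 where "B2 = {v5, v4, u4}"
  have x' [simp]: "x \<noteq> u3" "x \<noteq> u4" "u3 \<noteq> x" "u4 \<noteq> x" "u1 \<noteq> x" "u6 \<noteq> x" "x \<noteq> u1" "x \<noteq> u6"
    using x EV(3)[OF x(1)] EV(3)[OF x(2)] by auto
  have con0: "connected_on E B0"
    unfolding B0_def by (rule connected_insert[of _ c], rule connected_insert[of _ c]) simp_all
  have con1: "connected_on E B1"
    unfolding B1_def by (rule connected_insert[of _ v2], rule connected_insert[of _ u3]) simp_all
  have con2: "connected_on E B2"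
    unfolding B2_def by (rule connected_insert[of _ v4], rule connected_insert[of _ u4]) simp_all
  have disj: "B0 \<inter> B1 = {}" "B0 \<inter> B2 = {}" "B1 \<inter> B2 = {}" by (auto simp: B0_def B1_def B2_def)
  have "\<exists>g :: 'a \<Rightarrow> nat. (\<forall>x\<in>V. g x < 4) \<and> (\<forall>B\<in>{B0,B1,B2}. \<forall>x\<in>B. \<forall>y\<in>B. g x = g y) \<and>
    (\<forall>x y. E x y \<and> (\<forall>B\<in>{B0,B1,B2}. x \<in> B \<longrightarrow> y \<notin> B) \<longrightarrow> g x \<noteq> g y) \<and> g d = 0 \<and> g u1 = 1 \<and> g u2 \<in> {0,2}"
  proof (rule contract_blocks_normalised[of _ B2 v4 v5])
    show "B \<subseteq> V \<and> connected_on E B" if "B \<in> {B0, B1, B2}" for B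
      using that con0 con1 con2 inV xV by (auto simp: B0_def B1_def B2_def)
    show "B \<inter> C = {}" if "B \<in> {B0, B1, B2}" "C \<in> {B0, B1, B2}" "B \<noteq> C" for B C
      using that disj by auto
    show "u1 \<notin> B" if "B \<in> {B0, B1, B2}" for B using that by (auto simp: B0_def B1_def B2_def)
    show "E d u1" "E u1 u2" using ring_edges Esym by auto
  qed (auto simp: B2_def)
  then obtain g :: "'a \<Rightarrow> nat" where "(\<forall>x\<in>V. g x < 4) \<and> (\<forall>B\<in>{B0,B1,B2}. \<forall>x\<in>B. \<forall>y\<in>B. g x = g y) \<and>
    (\<forall>x y. E x y \<and> (\<forall>B\<in>{B0,B1,B2}. x \<in> B \<longrightarrow> y \<notin> B) \<longrightarrow> g x \<noteq> g y) \<and> g d = 0 \<and> g u1 = 1 \<and> g u2 \<in> {0,2}" ..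
  then have g1: "\<forall>x\<in>V. g x < 4" and g2: "\<forall>B\<in>{B0,B1,B2}. \<forall>x\<in>B. \<forall>y\<in>B. g x = g y"
    and g3: "\<forall>x y. E x y \<and> (\<forall>B\<in>{B0,B1,B2}. x \<in> B \<longrightarrow> y \<notin> B) \<longrightarrow> g x \<noteq> g y"
    and g4: "g d = 0" "g u1 = 1" "g u2 \<in> {0,2}"
    by - (elim conjE, assumption)+
  have sep: "g s \<noteq> g t" if "E s t" "s \<in> B0 \<Longrightarrow> t \<notin> B0" "s \<in> B1 \<Longrightarrow> t \<notin> B1" "s \<in> B2 \<Longrightarrow> t \<notin> B2" for s t
    using g3[rule_format, of s t] that by simp
  have eq0: "g a = g x" using g2[rule_format, of B0 a x] by (simp add: B0_def)
  have eq1: "g v1 = g u3" using g2[rule_format, of B1 v1 u3] by (simp add: B1_def)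
  have eq2: "g v5 = g u4" using g2[rule_format, of B2 v5 u4] by (simp add: B2_def)
  have pc: "partial_colouring core g"
    unfolding partial_colouring_def
  proof (intro conjI allI impI)
    show "\<forall>v\<in>V. g v < 4" by (fact g1)
    fix s t assume st: "E s t \<and> s \<notin> core \<and> t \<notin> core"
    then have "s \<noteq> t" using EV(3)[of s t] by simp
    then show "g s \<noteq> g t" using sep[of s t] st by (auto simp: B0_def B1_def B2_def)
  qed
  have "g v1 \<noteq> g d" "g v1 \<noteq> g u1" "g v5 \<noteq> g d" "g v5 \<noteq> g u6" "g a \<noteq> g d"
    by (rule sep; simp add: B0_def B1_def B2_def)+
  then have n: "g u3 \<noteq> g d" "g u3 \<noteq> g u1" "g u4 \<noteq> g d" "g u4 \<noteq> g u6" "g x \<noteq> g d"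
    by (simp_all add: eq0 eq1 eq2)
  have pr: "g s \<noteq> g t" if "E s t" "s \<notin> core" "t \<notin> core" for s t
    using pc that unfolding partial_colouring_def by blast
  have r: "g u2 \<noteq> g u3" "g u5 \<noteq> g u4" "g u6 \<noteq> g u5" "g u6 \<noteq> g d" "g x \<noteq> g u3" "g x \<noteq> g u4"
    by (rule pr; use ring_edges ring_edges' x in simp)+
  have lt: "g u3 < 4" "g u4 < 4" "g u5 < 4" "g u6 < 4" "g x < 4" using g1 inV xV by auto
  have "core_ext 0 1 (g u2) (g u3) (g x) (g u4) (g u5) (g u6) \<or> (g u2, g u3, g x, g u4, g u5, g u6) = (2,3,1,3,2,1) \<or>
    (g u2, g u3, g x, g u4, g u5, g u6) = (2,3,2,1,2,3) \<or> (g u2, g u3, g x, g u4, g u5, g u6) = (2,3,2,3,2,1)"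
    by (rule core_ext_contraction2) (use g4 n r lt in simp_all)
  moreover have "\<not> core_ext 0 1 (g u2) (g u3) (g x) (g u4) (g u5) (g u6)"
  proof
    assume "core_ext 0 1 (g u2) (g u3) (g x) (g u4) (g u5) (g u6)"
    then have "core_ext (g d) (g u1) (g u2) (g u3) (g x) (g u4) (g u5) (g u6)" by (simp only: g4(1,2))
    then show False by (rule not_core_ext[OF pc])
  qed
  ultimately show thesis by (intro that[OF pc g4(1,2)]) simp
qed

section \<open>Kempe switches on the exceptional colourings\<close>

lemma switch_contradiction:
  assumes "partial_colouring core g" "w \<in> V - core" "g w = i \<or> g w = j" "i < 4" "j < 4" "i \<noteq> j"
    and "h = kempe_switch core g i j w"
    and "core_ext (h d) (h u1) (h u2) (h u3) (h x) (h u4) (h u5) (h u6)"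
  shows False
proof -
  have "partial_colouring core h"
    unfolding assms(7) by (rule partial_colouring_kempe_switch) (use assms(1-6) in simp_all)
  then show False using assms(8) by (rule not_core_ext)
qed

text \<open>The pairs 1/3 and 0/2 are complementary, so a chain of one pair never meets a chain of
  the other. Either a 1/3 switch changes few enough boundary vertices to give an extendable
  colouring, or a 1/3 chain joins two boundary vertices. In the latter case some 0/2 chain cannot
  reach the other boundary vertices without a forbidden crossing, and switching it changes a single
  boundary colour; failing that, another 1/3 chain is confined in the same way.\<close>

lemma kempe_contradiction:
  assumes x: "E x u3" "E x u4" "x \<noteq> u1" "x \<noteq> u6" and g: "partial_colouring core g" "g d = 0" "g u1 = 1" "g u2 = 2" "g u3 = 3"
    and cases: "(g x, g u4, g u5, g u6) = (1,3,2,1) \<or> (g x, g u4, g u5, g u6) = (2,1,2,3) \<or> (g x, g u4, g u5, g u6) = (2,3,2,1)"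
  shows False
proof -
  define X where "X = kempe_chain core g 1 3"
  define Y where "Y = kempe_chain core g 0 2"
  have inVc: "d \<in> V - core" "u1 \<in> V - core" "u2 \<in> V - core" "u3 \<in> V - core" "u4 \<in> V - core"
    "u5 \<in> V - core" "u6 \<in> V - core" "x \<in> V - core"
    using inV xV by auto
  have X: "w \<in> X w" "connected_on E (X w)" "X w \<subseteq> V - core" "\<And>z. z \<in> X w \<Longrightarrow> g z = 1 \<or> g z = 3"
    "\<And>s t. s \<in> X w \<Longrightarrow> E s t \<Longrightarrow> t \<notin> core \<Longrightarrow> g t = 1 \<or> g t = 3 \<Longrightarrow> t \<in> X w"
    if "w \<in> V - core" "g w = 1 \<or> g w = 3" for w
  proof -
    have w: "g w \<in> {1,3}" using that(2) by simp
    note K = kempe_chain_props[of w core g 1 3, OF that(1) w, folded X_def]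
    show "w \<in> X w" "connected_on E (X w)" "X w \<subseteq> V - core" "\<And>z. z \<in> X w \<Longrightarrow> g z = 1 \<or> g z = 3"
      by (fact K)+
    show "t \<in> X w" if "s \<in> X w" "E s t" "t \<notin> core" "g t = 1 \<or> g t = 3" for s t
      by (rule K(5)[OF that(1-3)]) (use that(4) in simp)
  qed
  have Y: "w \<in> Y w" "connected_on E (Y w)" "Y w \<subseteq> V - core" "\<And>z. z \<in> Y w \<Longrightarrow> g z = 0 \<or> g z = 2"
    if "w \<in> V - core" "g w = 0 \<or> g w = 2" for w
  proof -
    have w: "g w \<in> {0,2}" using that(2) by simp
    note K = kempe_chain_props[of w core g 0 2, OF that(1) w, folded Y_def]
    show "w \<in> Y w" "connected_on E (Y w)" "Y w \<subseteq> V - core" "\<And>z. z \<in> Y w \<Longrightarrow> g z = 0 \<or> g z = 2"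
      by (fact K)+
  qed
  have XY: "X w \<inter> Y z = {}"
    if "w \<in> V - core" "g w = 1 \<or> g w = 3" "z \<in> V - core" "g z = 0 \<or> g z = 2" for w z
  proof -
    have "z' \<notin> Y z" if "z' \<in> X w" for z'
      using X(4)[OF \<open>w \<in> V - core\<close> \<open>g w = 1 \<or> g w = 3\<close> that] Y(4)[OF \<open>z \<in> V - core\<close> \<open>g z = 0 \<or> g z = 2\<close>, of z']
      by auto
    then show ?thesis by blast
  qed
  have Xeq: "X z = X w" if "z \<in> X w" for w z
    using kempe_chain_eq that unfolding X_def .
  define SX where "SX = kempe_switch core g 1 3"
  define SY where "SY = kempe_switch core g 0 2"
  have SX: "SX w z = (if z \<in> X w then (if g z = 1 then 3 else 1) else g z)"
    and SY: "SY w z = (if z \<in> Y w then (if g z = 0 then 2 else 0) else g z)" for w z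
    by (simp_all add: SX_def SY_def X_def Y_def kempe_switch_def)
  have sX: False if "w \<in> V - core" "g w = 1 \<or> g w = 3"
    "core_ext (SX w d) (SX w u1) (SX w u2) (SX w u3) (SX w x) (SX w u4) (SX w u5) (SX w u6)" for w
    by (rule switch_contradiction[OF g(1) that(1,2) _ _ _ _ that(3)]) (simp_all add: SX_def)
  have sY: False if "w \<in> V - core" "g w = 0 \<or> g w = 2"
    "core_ext (SY w d) (SY w u1) (SY w u2) (SY w u3) (SY w x) (SY w u4) (SY w u5) (SY w u6)" for w
    by (rule switch_contradiction[OF g(1) that(1,2) _ _ _ _ that(3)]) (simp_all add: SY_def)
  have nX: "z \<notin> X w" if "g z = 0 \<or> g z = 2" "w \<in> V - core" "g w = 1 \<or> g w = 3" for z w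
    using X(4)[OF that(2,3), of z] that(1) by auto
  have nY: "z \<notin> Y w" if "g z = 1 \<or> g z = 3" "w \<in> V - core" "g w = 0 \<or> g w = 2" for z w
    using Y(4)[OF that(2,3), of z] that(1) by auto
  have "\<not> ((g x, g u4, g u5, g u6) = (1,3,2,1))"
  proof
    assume "(g x, g u4, g u5, g u6) = (1,3,2,1)"
    then have v: "g x = 1" "g u4 = 3" "g u5 = 2" "g u6 = 1" by auto
    note Xu = X[OF inVc(7), unfolded v(4), simplified]
    have nX6: "d \<notin> X u6" "u2 \<notin> X u6" "u5 \<notin> X u6"
      by (rule nX; use v g inVc in simp)+
    show False
    proof (cases "u1 \<in> X u6")
      case True
      \<comment> \<open>The chain from \<open>u1\<close> to \<open>u6\<close> cuts \<open>d\<close>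
        off from \<open>u2\<close> and \<open>u5\<close>, so among the boundary vertices only
        \<open>d\<close> is recoloured.\<close>
      note Yd = Y[OF inVc(1), unfolded g(2), simplified]
      have XYd: "X u6 \<inter> Y d = {}" by (rule XY) (use v g inVc in simp_all)
      have "u2 \<notin> Y d"
        using crossing_at_d[OF Xu(2,3) True Xu(1) Yd(2,3,1) _ XYd] by blast
      moreover have "u5 \<notin> Y d"
        using crossing_at_d'[OF Xu(2,3,1) True Yd(2,3,1) _ XYd] by blast
      moreover have "u1 \<notin> Y d" "u3 \<notin> Y d" "x \<notin> Y d" "u4 \<notin> Y d" "u6 \<notin> Y d"
        by (rule nY; use v g inVc in simp)+
      ultimately show False
        by (intro sY[OF inVc(1)]) (simp_all add: SY Yd(1) g(2-5) v core_ext_switched(1) del: One_nat_def)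
    next
      case False
      \<comment> \<open>\<open>x\<close> has colour 1 and its neighbours \<open>u3\<close>,
        \<open>u4\<close> have colour 3: all three lie in the chain of \<open>u6\<close> or none
        does, and both outcomes extend.\<close>
      have "x \<in> X u6 \<Longrightarrow> u3 \<in> X u6" by (rule Xu(5)[OF _ x(1)]) (simp_all add: g(5))
      moreover have "x \<in> X u6 \<Longrightarrow> u4 \<in> X u6" by (rule Xu(5)[OF _ x(2)]) (simp_all add: v)
      moreover have "u3 \<in> X u6 \<Longrightarrow> x \<in> X u6" by (rule Xu(5)[OF _ Esym[OF x(1)]]) (simp_all add: v)
      moreover have "u4 \<in> X u6 \<Longrightarrow> x \<in> X u6" by (rule Xu(5)[OF _ Esym[OF x(2)]]) (simp_all add: v)
      ultimately have mid: "u3 \<in> X u6 \<longleftrightarrow> x \<in> X u6" "u4 \<in> X u6 \<longleftrightarrow> x \<in> X u6" by iprover+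
      show False
        by (rule sX[OF inVc(7)], simp add: v)
           (cases "x \<in> X u6"; simp add: SX Xu(1) nX6 False mid g(2-5) v core_ext_switched(2,3) del: One_nat_def)
    qed
  qed
  moreover have "\<not> ((g x, g u4, g u5, g u6) = (2,1,2,3))"
  proof
    assume "(g x, g u4, g u5, g u6) = (2,1,2,3)"
    then have v: "g x = 2" "g u4 = 1" "g u5 = 2" "g u6 = 3" by auto
    note Xu = X[OF inVc(5), unfolded v(2), simplified]
    have nX4: "d \<notin> X u4" "u2 \<notin> X u4" "u5 \<notin> X u4" "x \<notin> X u4"
      by (rule nX; use v g inVc in simp)+
    \<comment> \<open>If the chain of \<open>u4\<close> reaches \<open>u3\<close>, it isolates
      \<open>x\<close>; if it reaches \<open>u6\<close>, it isolates \<open>u5\<close>. Otherwise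
      switching it at \<open>u4\<close> is good whether or not it contains
      \<open>u1\<close>.\<close>
    consider "u3 \<in> X u4" | "u6 \<in> X u4" | "u3 \<notin> X u4" "u6 \<notin> X u4" by blast
    then show False
    proof cases
      case 1
      note Yx = Y[OF inVc(8), unfolded v(1), simplified]
      have XYx: "X u4 \<inter> Y x = {}" by (rule XY) (use v g inVc in simp_all)
      have "t \<notin> Y x" if "t \<in> {d, u2, u5}" for t
        using crossing_at_x[OF x(1,2) Xu(2,3) 1 Xu(1) Yx(2,3,1) _ that XYx] by blast
      then have "d \<notin> Y x" "u2 \<notin> Y x" "u5 \<notin> Y x" by simp_all
      moreover have "u1 \<notin> Y x" "u3 \<notin> Y x" "u4 \<notin> Y x" "u6 \<notin> Y x"
        by (rule nY; use v g inVc in simp)+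
      ultimately show False
        by (intro sY[OF inVc(8)]) (simp_all add: SY Yx(1) g(2-5) v core_ext_switched(4) del: One_nat_def)
    next
      case 2
      note Yu = Y[OF inVc(6), unfolded v(3), simplified]
      have XYu: "X u4 \<inter> Y u5 = {}" by (rule XY) (use v g inVc in simp_all)
      have "t \<notin> Y u5" if "t \<in> {d, u2, x}" for t
        using crossing_at_u5[OF Xu(2,3,1) 2 nX4(1) Yu(2,3,1) _ that XYu] by blast
      then have "d \<notin> Y u5" "u2 \<notin> Y u5" "x \<notin> Y u5" by simp_all
      moreover have "u1 \<notin> Y u5" "u3 \<notin> Y u5" "u4 \<notin> Y u5" "u6 \<notin> Y u5"
        by (rule nY; use v g inVc in simp)+
      ultimately show False
        by (intro sY[OF inVc(6)]) (simp_all add: SY Yu(1) g(2-5) v core_ext_switched(5) del: One_nat_def)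
    next
      case 3
      show False
        by (rule sX[OF inVc(5)], simp add: v)
           (cases "u1 \<in> X u4"; simp add: SX Xu(1) nX4 3 g(2-5) v core_ext_switched(6,7) del: One_nat_def)
    qed
  qed
  moreover have "\<not> ((g x, g u4, g u5, g u6) = (2,3,2,1))"
  proof
    assume "(g x, g u4, g u5, g u6) = (2,3,2,1)"
    then have v: "g x = 2" "g u4 = 3" "g u5 = 2" "g u6 = 1" by auto
    note Xu = X[OF inVc(7), unfolded v(4), simplified]
    note X1 = X[OF inVc(2), unfolded g(3), simplified]
    have nX6: "d \<notin> X u6" "u2 \<notin> X u6" "u5 \<notin> X u6" "x \<notin> X u6"
      by (rule nX; use v g inVc in simp)+
    have nX1: "d \<notin> X u1" "u2 \<notin> X u1" "u5 \<notin> X u1" "x \<notin> X u1"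
      by (rule nX; use v g inVc in simp)+
    \<comment> \<open>The first two alternatives isolate \<open>u5\<close> and \<open>u2\<close>,
      the third allows a switch at \<open>u6\<close>. In the last one \<open>u6\<close> is joined to
      \<open>u3\<close> but \<open>u1\<close> is not, so the chains of \<open>u1\<close> and
      \<open>u6\<close> differ and can be played against each other.\<close>
    consider "u4 \<in> X u6" | "u3 \<in> X u1" | "u4 \<notin> X u6" "u3 \<notin> X u6"
      | "u4 \<notin> X u6" "u3 \<in> X u6" "u3 \<notin> X u1" by blast
    then show False
    proof cases
      case 1
      note Yu = Y[OF inVc(6), unfolded v(3), simplified]
      have XYu: "X u6 \<inter> Y u5 = {}" by (rule XY) (use v g inVc in simp_all)
      have "t \<notin> Y u5" if "t \<in> {d, u2, x}" for t
        using crossing_at_u5[OF Xu(2,3) 1 Xu(1) nX6(1) Yu(2,3,1) _ that XYu] by blast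
      then have "d \<notin> Y u5" "u2 \<notin> Y u5" "x \<notin> Y u5" by simp_all
      moreover have "u1 \<notin> Y u5" "u3 \<notin> Y u5" "u4 \<notin> Y u5" "u6 \<notin> Y u5"
        by (rule nY; use v g inVc in simp)+
      ultimately show False
        by (intro sY[OF inVc(6)]) (simp_all add: SY Yu(1) g(2-5) v core_ext_switched(8) del: One_nat_def)
    next
      case 2
      note Yu = Y[OF inVc(3), unfolded g(4), simplified]
      have XYu: "X u1 \<inter> Y u2 = {}" by (rule XY) (use v g inVc in simp_all)
      have "t \<notin> Y u2" if "t \<in> {d, u5, x}" for t
        using crossing_at_u2[OF X1(2,3) 2 X1(1) nX1(1) Yu(2,3,1) _ that XYu] by blast
      then have "d \<notin> Y u2" "u5 \<notin> Y u2" "x \<notin> Y u2" by simp_all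
      moreover have "u1 \<notin> Y u2" "u3 \<notin> Y u2" "u4 \<notin> Y u2" "u6 \<notin> Y u2"
        by (rule nY; use v g inVc in simp)+
      ultimately show False
        by (intro sY[OF inVc(3)]) (simp_all add: SY Yu(1) g(2-5) v core_ext_switched(9) del: One_nat_def)
    next
      case 3
      show False
        by (rule sX[OF inVc(7)], simp add: v)
           (cases "u1 \<in> X u6"; simp add: SX Xu(1) nX6 3 g(2-5) v core_ext_switched(6,7) del: One_nat_def)
    next
      case 4
      \<comment> \<open>Two 1/3 chains with a common vertex coincide. This disjointness replaces the
        one given elsewhere by complementary colours.\<close>
      have ne: "z \<notin> X u6" if "z \<in> X u1" for z
        proof
        assume "z \<in> X u6"
        then have "X u1 = X u6" using Xeq[OF that] Xeq[of z u6] by simp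
        then show False using 4 by simp
      qed
      have u6: "u6 \<notin> X u1" using ne Xu(1) by blast
      have "u4 \<notin> X u1"
      proof
        assume u4: "u4 \<in> X u1"
        have "X u1 \<inter> X u6 = {}" using ne by blast
        moreover have "{u2, x, u5, d} \<inter> (X u1 \<union> X u6) = {}" using nX1 nX6 by simp
        ultimately show False
          using crossing_at_core[OF x(1,2) X1(2,3,1) u4 Xu(2,3) 4(2) Xu(1)] by blast
      qed
      then show False
        by (intro sX[OF inVc(2)]) (simp_all add: SX X1(1) nX1 4 u6 g(2-5) v core_ext_switched(10) del: One_nat_def)
    qed
  qed
  ultimately show False using cases by blast
qed

text \<open>One contraction settles \<open>x\<close> equal to \<open>u3\<close>, \<open>u1\<close>
  or \<open>u6\<close> and \<open>x\<close> nonadjacent to \<open>u3\<close>; the reflection does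
  the same with \<open>u4\<close>. What remains is a new vertex adjacent to both \<open>u3\<close>
  and \<open>u4\<close>, the case needing switches.\<close>

lemma no_degree_7_hub: False
proof -
  interpret m: dumbbell_hub V E b a v5 v4 v2 v1 c d u6 u5 u4 u3 u2 u1 x by (rule mirror_hub)
  show False
  proof (cases "x \<in> {u3, u1, u6}")
    case True
    then show False using hub_contraction1[of "{}"] by blast
  next
    case False
    then have x: "x \<noteq> u3" "x \<noteq> u1" "x \<noteq> u6" by auto
    have x4: "x \<noteq> u4" using m.hub_contraction1[of "{}"] by blast
    have e3: "E x u3" using hub_contraction1[of "{x}"] x x4 by blast
    have e4: "E x u4" using m.hub_contraction1[of "{x}"] x x4 by blast
    obtain g where g: "partial_colouring core g" "g d = 0" "g u1 = 1"
      "(g u2, g u3, g x, g u4, g u5, g u6) = (2,3,1,3,2,1) \<or> (g u2, g u3, g x, g u4, g u5, g u6) = (2,3,2,1,2,3) \<or>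
       (g u2, g u3, g x, g u4, g u5, g u6) = (2,3,2,3,2,1)"
      by (rule hub_contraction2[OF e3 e4 x(2,3)])
    have "g u2 = 2" "g u3 = 3" using g(4) by auto
    then show False
      by (rule kempe_contradiction[OF e3 e4 x(2,3) g(1-3)]) (use g(4) in auto)
  qed
qed

end

text \<open>The element \<open>s\<close> is a dummy: equality of \<open>M\<close> and
  \<open>S\<close> is expressed as insertion of an element already present, so that both
  cardinalities take the same form.\<close>

lemma eq_insert_if_card_le_Suc:
  assumes "finite M" "S \<subseteq> M" "s \<in> S" "card M \<le> Suc (card S)"
  shows "\<exists>x. M = insert x S \<and> (x = s \<or> x \<notin> S)"
proof (cases "M = S")
  case True
  then show ?thesis using assms(3) by (intro exI[of _ s]) auto
next
  case False
  then obtain x where x: "x \<in> M" "x \<notin> S" using assms(2) by blast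
  have "finite S" using assms(1,2) by (rule finite_subset[rotated])
  then have "insert x S = M"
    using assms x by (intro card_seteq) auto
  then show ?thesis using x by blast
qed

lemma (in dumbbell) deg_c_ge_8: "deg V E c \<ge> 8"
proof (rule ccontr)
  assume "\<not> deg V E c \<ge> 8"
  then have le: "card (nbrs V E c) \<le> Suc (card {a, b, v2, v4, u3, u4})" by (simp add: deg_def)
  have fin: "finite (nbrs V E c)" using finV by (simp add: nbrs_def)
  have sub: "{a, b, v2, v4, u3, u4} \<subseteq> nbrs V E c"
    using ring_edges ring_edges' by (auto simp: Enbrs[symmetric] intro: Esym)
  obtain x where N: "nbrs V E c = insert x {a, b, v2, v4, u3, u4}"
    and x: "x = u3 \<or> x \<notin> {a, b, v2, v4, u3, u4}"
    using eq_insert_if_card_le_Suc[OF fin sub _ le, of u3] by auto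
  have "E c x" by (simp add: Enbrs N)
  \<comment> \<open>The known neighbourhoods of \<open>v1\<close> and \<open>v5\<close> do not
    contain \<open>c\<close>, and there are no loops; the other core vertices are excluded by the
    choice of \<open>x\<close>.\<close>
  then have "x \<noteq> v1" "x \<noteq> v5" "x \<noteq> c" using EV(3)[of c x] by auto
  then have "x \<notin> {a, b, v1, v2, v4, v5, c}" using x by auto
  moreover have "nbrs V E c = {a, b, v2, v4, u3, u4, x}"
    unfolding N by (simp only: insert_commute)
  ultimately have "dumbbell_hub V E a b v1 v2 v4 v5 c d u1 u2 u3 u4 u5 u6 x"
    by unfold_locales
  then show False by (rule dumbbell_hub.no_degree_7_hub)
qed

theorem theorem4p3:
  fixes V :: "'a set" and E :: "'a \<Rightarrow> 'a \<Rightarrow> bool"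
    and a b v1 v2 v4 v5 c d u1 u2 u3 u4 u5 u6 :: 'a
  assumes EP: "eMPGN4 V E"
    and inV: "set [a, b, v1, v2, v4, v5, c, d, u1, u2, u3, u4, u5, u6] \<subseteq> V"
    and dist: "distinct [a, b, v1, v2, v4, v5, c, d, u1, u2, u3, u4, u5, u6]"
    and deg5: "\<forall>x\<in>{a, b, v1, v2, v4, v5}. deg V E x = 5"
    and Na: "nbrs V E a = {b, c, d, v1, v2}"
    and Nb: "nbrs V E b = {a, c, d, v4, v5}"
    and Nv1: "nbrs V E v1 = {a, v2, d, u1, u2}"
    and Nv2: "nbrs V E v2 = {a, v1, c, u2, u3}"
    and Nv4: "nbrs V E v4 = {b, v5, c, u4, u5}"
    and Nv5: "nbrs V E v5 = {b, v4, d, u5, u6}"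
  shows "deg V E c \<ge> 8 \<and> deg V E d \<ge> 8"
proof -
  interpret dumbbell V E a b v1 v2 v4 v5 c d u1 u2 u3 u4 u5 u6
    by unfold_locales (fact assms)+
  show ?thesis using deg_c_ge_8 dumbbell.deg_c_ge_8[OF swap_cd] by simp
qed

end
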